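(* Suppose that the filtration $\mathbb F=(\mathcal F_t)_{t\ge 0}$ satisfies the usual conditions. Let $(M_t)_{t\ge 0}$ be a convex and integrably bounded set-valued $\mathbb F$-submartingale, and let $M_{t+}$, $t\ge 0$, be its right limits along the rationals (as defined in the context). Then: (i) For each $t\ge 0$, $M_{t+}$ is an $\mathcal F_t$-measurable integrably bounded set-valued random variable with compact convex values $\mathbb P$-a.s., and $M_t\subseteq M_{t+}$ $\mathbb P$-a.s. Moreover, $M_t=M_{t+}$ $\mathbb P$-a.s. if and only if, for every $x^*\in\mathscr W$, the function $r\mapsto s(x^*,\mathbb E[M_r])$ is right-continuous at $r=t$. (ii) The process $(M_{t+})_{t\ge 0}$ is a Hausdorff càdlàg (right-continuous and left-limited), convex, and integrably bounded set-valued $\mathbb F$-submartingale. If, in addition, $(M_t)_{t\ge 0}$ is a set-valued $\mathbb F$-martingale, then so is $(M_{t+})_{t\ge 0}$.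
   Context: Sets. $\mathbb R^d$ carries the Euclidean inner product $\langle\cdot,\cdot\rangle$ and norm $|\cdot|$; $\mathbb B=\{x\in\mathbb R^d: |x|\le 1\}$. For nonempty closed $C,D\subseteq\mathbb R^d$: $d(x,C)=\inf_{y\in C}|x-y|$; the Hausdorff distance is $h(C,D)=\max\{\sup_{x\in C}d(x,D),\sup_{y\in D}d(y,C)\}$; $\|C\|=\sup_{x\in C}|x|$; the support function is $s(x^*,C)=\sup_{x\in C}\langle x^*,x\rangle$. "Hausdorff" limits and continuity are with respect to $h$. $\mathscr W$ is a fixed countable dense subset of $\mathbb B$ with $0\notin\mathscr W$. Set-valued random variables. $(\Omega,\mathcal F,\mathbb P)$ is a probability space, $\mathcal G\subseteq\mathcal F$ a sub-$\sigma$-algebra. A map $\Xi$ from $\Omega$ to the nonempty closed subsets of $\mathbb R^d$ is $\mathcal G$-measurable if $\{\omega:\Xi(\omega)\cap C\ne\emptyset\}\in\mathcal G$ for all closed $C$; such maps are identified up to a.s. equality. $S^1_{\mathcal G}(\Xi)$ is the set of $\mathcal G$-measurable integrable random vectors $\xi$ with $\xi\in\Xi$ a.s. $\Xi$ is integrable if $S^1_{\mathcal F}(\Xi)\neq\emptyset$ and integrably bounded if $\mathbb E[\|\Xi\|]<\infty$. $\mathbb E[\Xi]$ is the closure in $\mathbb R^d$ of $\{\mathbb E[\xi]:\xi\in S^1_{\mathcal F}(\Xi)\}$. $\mathbb E[\Xi|\mathcal G]$ is the a.s. unique $\mathcal G$-measurable integrable set-valued random variable such that $S^1_{\mathcal G}(\mathbb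 E[\Xi|\mathcal G])$ is the $L^1$-closure of $\{\mathbb E[\xi|\mathcal G]:\xi\in S^1_{\mathcal F}(\Xi)\}$. Processes. A set-valued process $(M_t)_{t\ge0}$ is a family of $\mathcal F$-measurable (closed nonempty valued) set-valued random variables; it is $\mathbb F$-adapted if each $M_t$ is $\mathcal F_t$-measurable, convex if each $M_t$ has convex values, integrable (integrably bounded) if each $M_t$ is. An $\mathbb F$-adapted integrable set-valued process is a set-valued $\mathbb F$-submartingale if $\mathbb E[M_t|\mathcal F_s]\supseteq M_s$ a.s. for all $s\le t$, and a set-valued $\mathbb F$-martingale if equality holds a.s. for all $s\le t$. The usual conditions: $\mathbb F$ is right-continuous and augmented (complete, with all $\mathbb P$-null sets in $\mathcal F_0$). One-sided limits. For a convex integrably bounded set-valued $\mathbb F$-submartingale there is an event $\bar\Omega$ with $\mathbb P(\bar\Omega)=1$ on which the Hausdorff limits $M_{t-}=\lim_{r\in\mathbb Q,\,r\uparrow t}M_r$ ($t>0$) and $M_{t+}=\lim_{r\in\mathbb Q,\,r\downarrow t}M_r$ ($t\ge0$) all exist as nonempty compact convex sets. Fix such $\bar\Omega$ and set $M_{t-}(\omega)=M_{t+}(\omega)=\{0\}$ for $\omega\notin\bar\Omega$. *)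

theory Defs
  imports "HOL-Probability.Probability"
begin

section \<open>Closed sets\<close>

text \<open>The Hausdorff distance of unbounded closed sets may be infinite, hence the type \<^typ>\<open>ennreal\<close>;
  \<^const>\<open>infdist\<close> is the distance to a set provided that this set is nonempty.\<close>

definition hausdorff_dist :: "'b::euclidean_space set \<Rightarrow> 'b set \<Rightarrow> ennreal" where
  "hausdorff_dist C D =
    max (SUP x\<in>C. ennreal (infdist x D)) (SUP y\<in>D. ennreal (infdist y C))"

definition set_norm :: "'b::euclidean_space set \<Rightarrow> ennreal" where
  "set_norm C = (SUP x\<in>C. ennreal (norm x))"

definition support_fun :: "'b::euclidean_space \<Rightarrow> 'b set \<Rightarrow> ereal" where
  "support_fun x' C = (SUP x\<in>C. ereal (x' \<bullet> x))"

definition hausdorff_limit :: "('i \<Rightarrow> 'b::euclidean_space set) \<Rightarrow> 'b set \<Rightarrow> 'i filter \<Rightarrow> bool" where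
  "hausdorff_limit f L A \<longleftrightarrow>
    closed L \<and> L \<noteq> {} \<and> ((\<lambda>i. hausdorff_dist (f i) L) \<longlongrightarrow> 0) A"

definition hausdorff_cadlag :: "(real \<Rightarrow> 'b::euclidean_space set) \<Rightarrow> bool" where
  "hausdorff_cadlag f \<longleftrightarrow>
    (\<forall>t\<ge>0. hausdorff_limit f (f t) (at_right t)) \<and>
    (\<forall>t>0. \<exists>L. hausdorff_limit f L (at_left t))"


section \<open>Set-valued random variables\<close>

text \<open>A sub-\<open>\<sigma>\<close>-algebra is represented, as in the library's theory of conditional
  expectations, by a measure \<open>G\<close> of which only \<^term>\<open>space G\<close> and \<^term>\<open>sets G\<close> matter
  (\<^const>\<open>subalgebra\<close>).\<close>

definition sv_random_variable :: "'a measure \<Rightarrow> ('a \<Rightarrow> 'b::euclidean_space set) \<Rightarrow> bool" where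
  "sv_random_variable G X \<longleftrightarrow>
    (\<forall>\<omega>\<in>space G. closed (X \<omega>) \<and> X \<omega> \<noteq> {}) \<and>
    (\<forall>C. closed C \<longrightarrow> {\<omega>\<in>space G. X \<omega> \<inter> C \<noteq> {}} \<in> sets G)"

definition selections :: "'a measure \<Rightarrow> 'a measure \<Rightarrow> ('a \<Rightarrow> 'b::euclidean_space set) \<Rightarrow> ('a \<Rightarrow> 'b) set" where
  "selections P G X =
    {\<xi>. \<xi> \<in> borel_measurable G \<and> integrable P \<xi> \<and> (AE \<omega> in P. \<xi> \<omega> \<in> X \<omega>)}"

definition sv_integrable :: "'a measure \<Rightarrow> ('a \<Rightarrow> 'b::euclidean_space set) \<Rightarrow> bool" where
  "sv_integrable P X \<longleftrightarrow> selections P P X \<noteq> {}"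

definition integrably_bounded :: "'a measure \<Rightarrow> ('a \<Rightarrow> 'b::euclidean_space set) \<Rightarrow> bool" where
  "integrably_bounded P X \<longleftrightarrow> (\<integral>\<^sup>+\<omega>. set_norm (X \<omega>) \<partial>P) < \<infinity>"

definition sv_expectation :: "'a measure \<Rightarrow> ('a \<Rightarrow> 'b::euclidean_space set) \<Rightarrow> 'b set" where
  "sv_expectation P X = closure ((\<lambda>\<xi>. integral\<^sup>L P \<xi>) ` selections P P X)"

text \<open>The library's conditional expectation is real-valued; for random vectors it is taken
  coordinatewise.\<close>

definition vec_cond_exp :: "'a measure \<Rightarrow> 'a measure \<Rightarrow> ('a \<Rightarrow> 'b::euclidean_space) \<Rightarrow> 'a \<Rightarrow> 'b" where
  "vec_cond_exp P G \<xi> \<omega> = (\<Sum>b\<in>Basis. real_cond_exp P G (\<lambda>\<omega>'. \<xi> \<omega>' \<bullet> b) \<omega> *\<^sub>R b)"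

text \<open>The closure is taken in \<open>L\<^sup>1\<close> of the sub-\<open>\<sigma>\<close>-algebra \<open>G\<close>: its elements are
  \<open>G\<close>-measurable representatives.\<close>

definition L1_closure :: "'a measure \<Rightarrow> 'a measure \<Rightarrow> ('a \<Rightarrow> 'b::euclidean_space) set \<Rightarrow> ('a \<Rightarrow> 'b) set" where
  "L1_closure P G A =
    {\<eta>. \<eta> \<in> borel_measurable G \<and> integrable P \<eta> \<and>
        (\<forall>\<epsilon>>0. \<exists>\<zeta>\<in>A. (\<integral>\<omega>. norm (\<eta> \<omega> - \<zeta> \<omega>) \<partial>P) < \<epsilon>)}"

text \<open>\<open>Y\<close> is a version of the conditional expectation of \<open>X\<close> given \<open>G\<close>, which is determined
  only up to almost sure equality.\<close>

definition has_sv_cond_exp ::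
    "'a measure \<Rightarrow> 'a measure \<Rightarrow> ('a \<Rightarrow> 'b::euclidean_space set) \<Rightarrow> ('a \<Rightarrow> 'b set) \<Rightarrow> bool" where
  "has_sv_cond_exp P G X Y \<longleftrightarrow>
    sv_random_variable G Y \<and> sv_integrable P Y \<and>
    selections P G Y = L1_closure P G (vec_cond_exp P G ` selections P P X)"


section \<open>Set-valued processes\<close>

text \<open>Time is \<open>[0, \<infinity>)\<close>; values of families indexed by \<^typ>\<open>real\<close> at negative times are
  irrelevant. (The library locale \<open>filtration\<close> would constrain them.)\<close>

definition time_filtration :: "'a measure \<Rightarrow> (real \<Rightarrow> 'a measure) \<Rightarrow> bool" where
  "time_filtration P F \<longleftrightarrow>
    (\<forall>t\<ge>0. subalgebra P (F t)) \<and>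
    (\<forall>s\<ge>0. \<forall>t\<ge>s. sets (F s) \<subseteq> sets (F t))"

definition usual_conditions :: "'a measure \<Rightarrow> (real \<Rightarrow> 'a measure) \<Rightarrow> bool" where
  "usual_conditions P F \<longleftrightarrow>
    (\<forall>t\<ge>0. sets (F t) = (\<Inter>s\<in>{t<..}. sets (F s))) \<and>
    complete_measure P \<and> null_sets P \<subseteq> sets (F 0)"

definition sv_process :: "'a measure \<Rightarrow> (real \<Rightarrow> 'a \<Rightarrow> 'b::euclidean_space set) \<Rightarrow> bool" where
  "sv_process P M \<longleftrightarrow> (\<forall>t\<ge>0. sv_random_variable P (M t))"

definition sv_adapted :: "(real \<Rightarrow> 'a measure) \<Rightarrow> (real \<Rightarrow> 'a \<Rightarrow> 'b::euclidean_space set) \<Rightarrow> bool" where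
  "sv_adapted F M \<longleftrightarrow> (\<forall>t\<ge>0. sv_random_variable (F t) (M t))"

text \<open>Set-valued random variables are identified up to almost sure equality, so convexity
  of the values is required almost surely.\<close>

definition convex_process :: "'a measure \<Rightarrow> (real \<Rightarrow> 'a \<Rightarrow> 'b::euclidean_space set) \<Rightarrow> bool" where
  "convex_process P M \<longleftrightarrow> (\<forall>t\<ge>0. AE \<omega> in P. convex (M t \<omega>))"

definition integrable_process :: "'a measure \<Rightarrow> (real \<Rightarrow> 'a \<Rightarrow> 'b::euclidean_space set) \<Rightarrow> bool" where
  "integrable_process P M \<longleftrightarrow> (\<forall>t\<ge>0. sv_integrable P (M t))"

definition integrably_bounded_process :: "'a measure \<Rightarrow> (real \<Rightarrow> 'a \<Rightarrow> 'b::euclidean_space set) \<Rightarrow> bool" where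
  "integrably_bounded_process P M \<longleftrightarrow> (\<forall>t\<ge>0. integrably_bounded P (M t))"

definition sv_submartingale ::
    "'a measure \<Rightarrow> (real \<Rightarrow> 'a measure) \<Rightarrow> (real \<Rightarrow> 'a \<Rightarrow> 'b::euclidean_space set) \<Rightarrow> bool" where
  "sv_submartingale P F M \<longleftrightarrow>
    sv_process P M \<and> sv_adapted F M \<and> integrable_process P M \<and>
    (\<forall>s\<ge>0. \<forall>t\<ge>s. \<exists>Y. has_sv_cond_exp P (F s) (M t) Y \<and> (AE \<omega> in P. M s \<omega> \<subseteq> Y \<omega>))"

definition sv_martingale ::
    "'a measure \<Rightarrow> (real \<Rightarrow> 'a measure) \<Rightarrow> (real \<Rightarrow> 'a \<Rightarrow> 'b::euclidean_space set) \<Rightarrow> bool" where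
  "sv_martingale P F M \<longleftrightarrow>
    sv_process P M \<and> sv_adapted F M \<and> integrable_process P M \<and>
    (\<forall>s\<ge>0. \<forall>t\<ge>s. \<exists>Y. has_sv_cond_exp P (F s) (M t) Y \<and> (AE \<omega> in P. M s \<omega> = Y \<omega>))"


section \<open>One-sided limits along the rationals\<close>

definition rational_left :: "real \<Rightarrow> real filter" where
  "rational_left t = at t within (\<rat> \<inter> {0..<t})"

definition rational_right :: "real \<Rightarrow> real filter" where
  "rational_right t = at t within (\<rat> \<inter> {t<..})"

definition limit_event :: "'a measure \<Rightarrow> (real \<Rightarrow> 'a \<Rightarrow> 'b::euclidean_space set) \<Rightarrow> 'a set \<Rightarrow> bool" where
  "limit_event P M \<Omega>' \<longleftrightarrow>
    \<Omega>' \<in> sets P \<and> measure P \<Omega>' = 1 \<and>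
    (\<forall>\<omega>\<in>\<Omega>'.
      (\<forall>t>0. \<exists>L. L \<noteq> {} \<and> compact L \<and> convex L \<and>
                  hausdorff_limit (\<lambda>r. M r \<omega>) L (rational_left t)) \<and>
      (\<forall>t\<ge>0. \<exists>L. L \<noteq> {} \<and> compact L \<and> convex L \<and>
                  hausdorff_limit (\<lambda>r. M r \<omega>) L (rational_right t)))"

definition right_limit ::
    "'a set \<Rightarrow> (real \<Rightarrow> 'a \<Rightarrow> 'b::euclidean_space set) \<Rightarrow> real \<Rightarrow> 'a \<Rightarrow> 'b set" where
  "right_limit \<Omega>' M t \<omega> =
    (if \<omega> \<in> \<Omega>' then (THE L. hausdorff_limit (\<lambda>r. M r \<omega>) L (rational_right t)) else {0})"

end

theory Submission
  imports Defs
begin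

text \<open>The filtration being complete, \<open>M\<close> may be modified to have compact convex values everywhere; closest
  points then give measurable selections, and inclusions of random sets can be tested on selections. The
  submartingale property dominates \<open>\<parallel>M\<^sub>r\<parallel>\<close> for \<open>r \<le> u\<close> by a multiple of \<open>E[\<parallel>M\<^sub>u\<parallel> | F\<^sub>r]\<close>, so a truncation argument upgrades
  almost sure Hausdorff convergence along rationals \<open>r \<down> t\<close> to \<open>L\<^sup>1\<close>-convergence: a selection of \<open>M\<^sub>r\<close> and its closest
  point in \<open>M\<^sub>t\<^sub>+\<close> are close in \<open>L\<^sup>1\<close>, and conversely. Every assertion on conditional expectations passes to the limit
  by moving selections back and forth in this way. For the criterion in (i), \<open>r \<mapsto> s(x, E[M\<^sub>r]) = E[s(x, M\<^sub>r)]\<close> is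
  nondecreasing with right limit \<open>E[s(x, M\<^sub>t\<^sub>+)]\<close>, and \<open>M\<^sub>t \<subseteq> M\<^sub>t\<^sub>+\<close> makes equality of the integrals equality of the
  support functions.\<close>

section \<open>Hausdorff distance and support functions of compact sets\<close>

text \<open>The conditional expectation of a random set is given only through the L1-closure of
  conditioned selections. Almost sure Hausdorff convergence therefore helps only once selections can
  be moved with small L1-error, and ordinary dominated convergence does not give this, because the
  majorant E[ . | F r] changes with r. Vectors are conditioned coordinatewise, which brings in the
  dimension as a factor; it is harmless, since bounds only have to be finite or to tend to 0.
  Compact convex values matter because the metric projection onto them is single valued and
  nonexpansive, so projecting a measurable vector gives a measurable selection. The submartingale
  property includes the existence of a version of the conditional expectation; for the right limits
  this comes from a representation theorem for decomposable sets of random vectors. Between times s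
  \<le> t the argument runs along rationals q n < r n tending to s and t from above; they are
  strictly ordered even when s = t, so the hypothesis on M can be used between them.\<close>

lemma hausdorff_dist_le_iff:
  assumes "0 \<le> e"
  shows "hausdorff_dist A B \<le> ennreal e \<longleftrightarrow>
    (\<forall>x\<in>A. infdist x B \<le> e) \<and> (\<forall>y\<in>B. infdist y A \<le> e)"
  using assms by (auto simp: hausdorff_dist_def SUP_le_iff ennreal_le_iff)

lemma hausdorff_dist_commute: "hausdorff_dist A B = hausdorff_dist B A"
  by (simp add: hausdorff_dist_def max.commute)

lemma infdist_le_add:
  fixes B :: "'b::euclidean_space set"
  assumes "A \<noteq> {}" "\<And>y. y \<in> A \<Longrightarrow> infdist y B \<le> e"
  shows "infdist x B \<le> infdist x A + e"
proof -
  have "infdist x B - e \<le> dist x y" if "y \<in> A" for y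
    using assms(2)[OF that] infdist_triangle[of x B y] by linarith
  then have "infdist x B - e \<le> infdist x A"
    unfolding infdist_notempty[OF assms(1)] using assms(1) by (intro cINF_greatest)
  then show ?thesis by simp
qed

text \<open>Distances of type \<open>ennreal\<close> are handled through real upper bounds, to which
  the facts on \<open>infdist\<close> apply. The middle set must be nonempty because
  \<open>infdist\<close> to the empty set is 0.\<close>

lemma hausdorff_dist_triangle_le:
  assumes "B \<noteq> {}" "0 \<le> a" "0 \<le> b" "hausdorff_dist A B \<le> ennreal a" "hausdorff_dist B C \<le> ennreal b"
  shows "hausdorff_dist A C \<le> ennreal (a + b)"
proof -
  have 1: "\<And>x. x \<in> A \<Longrightarrow> infdist x B \<le> a" "\<And>x. x \<in> B \<Longrightarrow> infdist x A \<le> a"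
    "\<And>x. x \<in> B \<Longrightarrow> infdist x C \<le> b" "\<And>x. x \<in> C \<Longrightarrow> infdist x B \<le> b"
    using assms by (auto simp: hausdorff_dist_le_iff)
  have "infdist x C \<le> a + b" if "x \<in> A" for x
    using infdist_le_add[of B C b x] 1 assms that by force
  moreover have "infdist x A \<le> a + b" if "x \<in> C" for x
    using infdist_le_add[of B A a x] 1 assms that by force
  ultimately show ?thesis using assms by (simp add: hausdorff_dist_le_iff del: ennreal_plus)
qed

lemma hausdorff_limit_iff:
  "hausdorff_limit f L A \<longleftrightarrow> closed L \<and> L \<noteq> {} \<and>
    (\<forall>e>0. \<forall>\<^sub>F i in A. hausdorff_dist (f i) L \<le> ennreal e)"
proof -
  have "((\<lambda>i. hausdorff_dist (f i) L) \<longlongrightarrow> 0) A \<longleftrightarrow>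
    (\<forall>e>0. \<forall>\<^sub>F i in A. hausdorff_dist (f i) L \<le> ennreal e)" (is "?l \<longleftrightarrow> ?r")
  proof
    assume ?l
    then show ?r
      by (auto dest!: order_tendstoD(2)[of _ 0 _ "ennreal _"] elim!: eventually_mono)
  next
    assume r: ?r
    show ?l
    proof (rule order_tendstoI)
      fix a :: ennreal assume "0 < a"
      then obtain b where b: "0 < b" "b < a" using dense by blast
      then obtain e where e: "b = ennreal e" "0 < e"
        by (cases b) (auto simp: ennreal_less_zero_iff)
      show "\<forall>\<^sub>F i in A. hausdorff_dist (f i) L < a"
        using r[rule_format, OF e(2)] by eventually_elim (use b e in auto)
    qed simp
  qed
  then show ?thesis by (simp add: hausdorff_limit_def)
qed

text \<open>This evaluates the \<open>THE\<close> in \<open>right_limit\<close>. By the triangle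
  inequality through \<open>f i\<close> two limits are at Hausdorff distance 0, hence equal as
  closed sets; the last assumption makes the middle set nonempty.\<close>

lemma hausdorff_limit_unique:
  assumes "hausdorff_limit f K A" "hausdorff_limit f L A" "A \<noteq> bot" "\<forall>\<^sub>F i in A. f i \<noteq> {}"
  shows "K = L"
proof -
  have half: "hausdorff_dist K L \<le> ennreal (e + e)" if "0 < e" for e
  proof -
    have "\<forall>\<^sub>F i in A. hausdorff_dist (f i) K \<le> ennreal e" "\<forall>\<^sub>F i in A. hausdorff_dist (f i) L \<le> ennreal e"
      using assms(1,2) that unfolding hausdorff_limit_iff by blast+
    with assms(4) have "\<forall>\<^sub>F i in A. hausdorff_dist K L \<le> ennreal (e + e)"
    proof eventually_elim
      case (elim i)
      then show ?case
        using that by (intro hausdorff_dist_triangle_le[of "f i"]) (simp_all add: hausdorff_dist_commute[of K])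
    qed
    then show ?thesis using assms(3) by (simp add: eventually_const)
  qed
  have *: "hausdorff_dist K L \<le> ennreal e" if "0 < e" for e
    using half[of "e / 2"] that by (simp del: ennreal_plus)
  have cl: "closed K" "K \<noteq> {}" "closed L" "L \<noteq> {}"
    using assms(1,2) by (auto simp: hausdorff_limit_def)
  have "infdist x L \<le> 0" if "x \<in> K" for x
    using * that by (rule_tac field_le_epsilon) (simp add: hausdorff_dist_le_iff)
  then have "x \<in> L" if "x \<in> K" for x
    using that infdist_nonneg[of x L] in_closed_iff_infdist_zero[OF cl(3,4), of x] by force
  moreover have "infdist x K \<le> 0" if "x \<in> L" for x
    using * that by (rule_tac field_le_epsilon) (simp add: hausdorff_dist_le_iff)
  then have "x \<in> K" if "x \<in> L" for x
    using that infdist_nonneg[of x K] in_closed_iff_infdist_zero[OF cl(1,2), of x] by force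
  ultimately show ?thesis by blast
qed

text \<open>Real-valued versions of \<^const>\<open>support_fun\<close> and \<^const>\<open>set_norm\<close>, meaningful
  for nonempty bounded sets.\<close>

definition supp :: "'b::euclidean_space \<Rightarrow> 'b set \<Rightarrow> real" where
  "supp x A = (SUP y\<in>A. x \<bullet> y)"

definition radius :: "'b::euclidean_space set \<Rightarrow> real" where
  "radius A = (SUP y\<in>A. norm y)"

lemma supp_attained:
  assumes "compact A" "A \<noteq> {}"
  obtains y where "y \<in> A" "supp x A = x \<bullet> y"
proof -
  obtain y where "y \<in> A" "\<forall>z\<in>A. x \<bullet> z \<le> x \<bullet> y"
    using continuous_attains_sup[OF assms, of "\<lambda>y. x \<bullet> y"]
      linear_continuous_on[OF bounded_linear_inner_right] by blast
  then have "supp x A = x \<bullet> y"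
    unfolding supp_def by (intro cSup_eq_maximum) auto
  then show thesis using that \<open>y \<in> A\<close> by auto
qed

lemma radius_attained:
  assumes "compact A" "A \<noteq> {}"
  obtains y where "y \<in> A" "radius A = norm y"
proof -
  obtain y where "y \<in> A" "\<forall>z\<in>A. norm z \<le> norm y"
    using continuous_attains_sup[OF assms, of norm] by (auto intro!: continuous_intros)
  then have "radius A = norm y"
    unfolding radius_def by (intro cSup_eq_maximum) auto
  then show thesis using that \<open>y \<in> A\<close> by auto
qed

lemma supp_upper:
  assumes "compact A" "y \<in> A"
  shows "x \<bullet> y \<le> supp x A"
proof -
  have "compact ((\<lambda>y. x \<bullet> y) ` A)"
    using assms(1) by (intro compact_continuous_image linear_continuous_on bounded_linear_inner_right)
  then show ?thesis
    unfolding supp_def using assms(2)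
    by (intro cSUP_upper bounded_imp_bdd_above compact_imp_bounded)
qed

lemma radius_upper:
  assumes "compact A" "y \<in> A"
  shows "norm y \<le> radius A"
proof -
  have "compact (norm ` A)"
    using assms(1) by (intro compact_continuous_image continuous_on_norm_id)
  then show ?thesis
    unfolding radius_def using assms(2)
    by (intro cSUP_upper bounded_imp_bdd_above compact_imp_bounded)
qed

lemma radius_nonneg: "compact A \<Longrightarrow> A \<noteq> {} \<Longrightarrow> 0 \<le> radius A"
  by (rule radius_attained[of A]) auto

lemma set_norm_eq_radius:
  assumes "compact A" "A \<noteq> {}"
  shows "set_norm A = ennreal (radius A)"
proof -
  obtain y where "y \<in> A" "radius A = norm y" using radius_attained assms by blast
  then show ?thesis unfolding set_norm_def
    by (intro antisym SUP_least)
      (use radius_upper[OF assms(1)] in \<open>auto intro!: SUP_upper2 ennreal_leI\<close>)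
qed

lemma nearest_point_exists:
  fixes B :: "'b::euclidean_space set"
  assumes "closed B" "B \<noteq> {}"
  obtains z where "z \<in> B" "infdist y B = dist y z"
  using infdist_attains_inf[OF assms, of y] by metis

text \<open>A maximiser of \<open>x\<close> on \<open>A\<close> is replaced by its nearest point in
  \<open>B\<close>. One half of the Hausdorff distance enters; a second application with
  \<open>A\<close> and \<open>B\<close> exchanged gives the Lipschitz estimate.\<close>

lemma supp_le_add:
  fixes A :: "'b::euclidean_space set"
  assumes "compact A" "A \<noteq> {}" "compact B" "B \<noteq> {}" "\<And>y. y \<in> A \<Longrightarrow> infdist y B \<le> e"
  shows "supp x A \<le> supp x B + norm x * e"
proof -
  obtain y where y: "y \<in> A" "supp x A = x \<bullet> y" using supp_attained assms by blast
  obtain z where z: "z \<in> B" "infdist y B = dist y z"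
    using nearest_point_exists assms compact_imp_closed by metis
  have "x \<bullet> y - x \<bullet> z \<le> norm x * dist y z"
    using norm_cauchy_schwarz[of x "y - z"] by (simp add: dist_norm inner_diff_right)
  also have "\<dots> \<le> norm x * e"
    using assms(5)[OF y(1)] z by (intro mult_left_mono) auto
  finally show ?thesis using supp_upper[OF assms(3) z(1), of x] y by linarith
qed

lemma radius_le_add:
  fixes A :: "'b::euclidean_space set"
  assumes "compact A" "A \<noteq> {}" "compact B" "B \<noteq> {}" "\<And>y. y \<in> A \<Longrightarrow> infdist y B \<le> e"
  shows "radius A \<le> radius B + e"
proof -
  obtain y where y: "y \<in> A" "radius A = norm y" using radius_attained assms by blast
  obtain z where z: "z \<in> B" "infdist y B = dist y z"
    using nearest_point_exists assms compact_imp_closed by metis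
  have "norm y - norm z \<le> e"
    using assms(5)[OF y(1)] z norm_triangle_ineq2[of y z] by (simp add: dist_norm)
  then show ?thesis using radius_upper[OF assms(3) z(1)] y by linarith
qed

lemma supp_mono:
  assumes "compact A" "compact B" "A \<subseteq> B" "A \<noteq> {}"
  shows "supp x A \<le> supp x B"
  using supp_upper[OF assms(2)] supp_attained[OF assms(1,4), of x] assms(3) by (metis subsetD)

text \<open>A point outside \<open>B\<close> is strictly separated from \<open>B\<close> by a unit
  vector. Since \<open>y\<close> and \<open>B\<close> lie in one ball, the gap survives a small
  change of that vector, so some vector of \<open>W\<close> separates as well.\<close>

lemma mem_of_supp_dense:
  fixes B :: "'b::euclidean_space set"
  assumes B: "compact B" "convex B" "B \<noteq> {}"
    and W: "cball 0 1 \<subseteq> closure W" "\<And>w. w \<in> W \<Longrightarrow> w \<bullet> y \<le> supp w B"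
  shows "y \<in> B"
proof (rule ccontr)
  assume "y \<notin> B"
  then obtain a b where ab: "a \<bullet> y < b" "\<And>x. x \<in> B \<Longrightarrow> a \<bullet> x > b"
    using separating_hyperplane_closed_point[of B y] B compact_imp_closed by blast
  then have "a \<noteq> 0" using B by auto
  \<comment> \<open>The separating half-space has \<open>B\<close> on the side of large values; the
    sign is reversed to match \<open>supp\<close>, and the norm is made 1 to land in the ball where
    \<open>W\<close> is dense.\<close>
  define c where "c = - (a /\<^sub>R norm a)"
  have c: "norm c = 1" using \<open>a \<noteq> 0\<close> by (simp add: c_def)
  have "c \<bullet> x < c \<bullet> y" if "x \<in> B" for x
    using ab(1) ab(2)[OF that] \<open>a \<noteq> 0\<close> by (simp add: c_def divide_simps)
  then have "supp c B < c \<bullet> y" using supp_attained[OF B(1,3), of c] by metis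
  define d where "d = c \<bullet> y - supp c B"
  have "d > 0" using \<open>supp c B < c \<bullet> y\<close> by (simp add: d_def)
  have "bounded (insert y B)" using compact_imp_bounded[OF B(1)] by simp
  then obtain R where R: "R > 0" "\<And>x. x \<in> B \<Longrightarrow> norm x \<le> R" "norm y \<le> R"
    unfolding bounded_pos by auto
  have "c \<in> closure W" using c W(1) by auto
  \<comment> \<open>On vectors of norm at most \<open>R\<close>, passing from \<open>c\<close> to
    \<open>w\<close> changes the inner product by less than half of the gap \<open>d\<close>; this
    happens twice, at \<open>x\<close> and at \<open>y\<close>.\<close>
  then obtain w where w: "w \<in> W" "dist w c < d / (2 * R)"
    using closure_approachableD[of c W "d / (2 * R)"] \<open>d > 0\<close> R(1) by (auto simp: dist_commute)
  have *: "\<bar>w \<bullet> x - c \<bullet> x\<bar> < d / 2" if "norm x \<le> R" for x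
  proof -
    have "\<bar>w \<bullet> x - c \<bullet> x\<bar> \<le> norm (w - c) * norm x"
      using Cauchy_Schwarz_ineq2[of "w - c" x] by (simp add: inner_diff_left)
    also have "\<dots> \<le> norm (w - c) * R" using that by (intro mult_left_mono) auto
    also have "\<dots> < d / (2 * R) * R" using w R(1) by (intro mult_strict_right_mono) (auto simp: dist_norm)
    finally show ?thesis using R(1) by simp
  qed
  obtain x where x: "x \<in> B" "supp w B = w \<bullet> x" using supp_attained B by blast
  have "w \<bullet> y \<le> w \<bullet> x" using W(2)[OF w(1)] x by simp
  then show False
    using *[OF R(2)[OF x(1)]] *[OF R(3)] supp_upper[OF B(1) x(1), of c] d_def by linarith
qed

section \<open>Measurability\<close>

lemma sv_random_variable_hits:
  "sv_random_variable G X \<Longrightarrow> closed C \<Longrightarrow> {\<omega>\<in>space G. X \<omega> \<inter> C \<noteq> {}} \<in> sets G"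
  by (auto simp: sv_random_variable_def)

lemma sv_random_variable_infdist:
  assumes "sv_random_variable G X"
  shows "(\<lambda>\<omega>. infdist x (X \<omega>)) \<in> borel_measurable G"
proof (rule borel_measurable_iff_le[THEN iffD2, rule_format])
  fix a :: real
  have "infdist x (X \<omega>) \<le> a \<longleftrightarrow> X \<omega> \<inter> cball x a \<noteq> {}" if "\<omega> \<in> space G" for \<omega>
  proof -
    have "closed (X \<omega>)" "X \<omega> \<noteq> {}" using assms that by (auto simp: sv_random_variable_def)
    then show ?thesis
    proof (intro iffI)
      assume "infdist x (X \<omega>) \<le> a"
      then show "X \<omega> \<inter> cball x a \<noteq> {}"
        using nearest_point_exists[OF \<open>closed (X \<omega>)\<close> \<open>X \<omega> \<noteq> {}\<close>, of x] by (metis disjoint_iff mem_cball)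
    qed (auto intro: infdist_le2)
  qed
  then have "{\<omega>\<in>space G. infdist x (X \<omega>) \<le> a} = {\<omega>\<in>space G. X \<omega> \<inter> cball x a \<noteq> {}}" by auto
  then show "{\<omega>\<in>space G. infdist x (X \<omega>) \<le> a} \<in> sets G"
    using sv_random_variable_hits[OF assms] by simp
qed

text \<open>Distance functions pass to pointwise limits, and this criterion turns them back into
  hitting events. On a compact \<open>K\<close> the distance to the random set attains its minimum,
  so \<open>K\<close> is hit iff the distances over a countable dense subset of \<open>K\<close>
  have infimum 0; a closed set is a countable union of compact ones.\<close>

lemma sv_random_variableI_infdist:
  fixes X :: "'a \<Rightarrow> 'b::euclidean_space set"
  assumes cl: "\<And>\<omega>. \<omega> \<in> space G \<Longrightarrow> closed (X \<omega>)" "\<And>\<omega>. \<omega> \<in> space G \<Longrightarrow> X \<omega> \<noteq> {}"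
    and m: "\<And>x. (\<lambda>\<omega>. infdist x (X \<omega>)) \<in> borel_measurable G"
  shows "sv_random_variable G X"
proof -
  have comp: "{\<omega>\<in>space G. X \<omega> \<inter> K \<noteq> {}} \<in> sets G" if K: "compact K" for K
  proof (cases "K = {}")
    case False
    obtain D where D: "countable D" "D \<subseteq> K" "K \<subseteq> closure D"
      using separable[of K] by metis
    have "X \<omega> \<inter> K \<noteq> {} \<longleftrightarrow> (\<forall>n::nat. \<exists>d\<in>D. infdist d (X \<omega>) < 1 / Suc n)" if "\<omega> \<in> space G" for \<omega>
    proof
      assume "X \<omega> \<inter> K \<noteq> {}"
      then obtain x where x: "x \<in> X \<omega>" "x \<in> closure D" using D by auto
      show "\<forall>n::nat. \<exists>d\<in>D. infdist d (X \<omega>) < 1 / Suc n"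
      proof
        fix n :: nat
        obtain d where "d \<in> D" "dist d x < 1 / Suc n"
          using closure_approachableD[OF x(2), of "1 / Suc n"] by (auto simp: dist_commute)
        then show "\<exists>d\<in>D. infdist d (X \<omega>) < 1 / Suc n"
          using infdist_le[OF x(1), of d] by force
      qed
    next
      assume r: "\<forall>n::nat. \<exists>d\<in>D. infdist d (X \<omega>) < 1 / Suc n"
      obtain k where k: "k \<in> K" "\<And>y. y \<in> K \<Longrightarrow> infdist k (X \<omega>) \<le> infdist y (X \<omega>)"
        using continuous_attains_inf[OF K False continuous_on_infdist[OF continuous_on_id]] by blast
      have "infdist k (X \<omega>) \<le> 0"
      proof (rule ccontr)
        assume "\<not> ?thesis"
        then obtain n :: nat where "1 / Suc n < infdist k (X \<omega>)"
          using nat_approx_posE[of "infdist k (X \<omega>)"] by (auto simp: not_le)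
        moreover obtain d where "d \<in> D" "infdist d (X \<omega>) < 1 / Suc n" using r by blast
        ultimately show False using k(2)[of d] D(2) by auto
      qed
      then have "k \<in> X \<omega>"
        using in_closed_iff_infdist_zero[OF cl(1)[OF that] cl(2)[OF that], of k] infdist_nonneg[of k "X \<omega>"] by force
      then show "X \<omega> \<inter> K \<noteq> {}" using k by auto
    qed
    then have "{\<omega>\<in>space G. X \<omega> \<inter> K \<noteq> {}} =
        {\<omega>\<in>space G. \<forall>n::nat. \<exists>d\<in>D. infdist d (X \<omega>) < 1 / Suc n}" by auto
    also have "\<dots> \<in> sets G"
      by (intro sets.sets_Collect_countable_All sets.sets_Collect_countable_Ex' D)
        (use m in measurable)
    finally show ?thesis .
  qed simp
  have "{\<omega>\<in>space G. X \<omega> \<inter> C \<noteq> {}} \<in> sets G" if "closed C" for C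
  proof -
    have "{\<omega>\<in>space G. X \<omega> \<inter> C \<noteq> {}} = (\<Union>n::nat. {\<omega>\<in>space G. X \<omega> \<inter> (C \<inter> cball 0 (real n)) \<noteq> {}})"
    proof (intro set_eqI iffI)
      fix \<omega> assume "\<omega> \<in> {\<omega>\<in>space G. X \<omega> \<inter> C \<noteq> {}}"
      then obtain x where "\<omega> \<in> space G" "x \<in> X \<omega>" "x \<in> C" by auto
      moreover obtain n :: nat where "norm x \<le> real n" using real_arch_simple by blast
      ultimately show "\<omega> \<in> (\<Union>n::nat. {\<omega>\<in>space G. X \<omega> \<inter> (C \<inter> cball 0 (real n)) \<noteq> {}})"
        by (auto intro!: exI[of _ n])
    qed auto
    also have "\<dots> \<in> sets G"
      using that by (intro sets.countable_UN) (auto intro!: comp closed_Int_compact)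
    finally show ?thesis .
  qed
  then show ?thesis using cl by (auto simp: sv_random_variable_def)
qed

lemma sv_random_variable_mono:
  assumes "sv_random_variable G X" "sets G \<subseteq> sets H" "space G = space H"
  shows "sv_random_variable H X"
  using assms by (auto simp: sv_random_variable_def)

text \<open>The values may be unbounded and the supremum need not be attained, so a norm above
  \<open>a\<close> is expressed by hitting the complement of an open ball of rational radius above
  \<open>a\<close>. It is applied to \<open>M t\<close> before compactness is known.\<close>

lemma set_norm_measurable:
  assumes "sv_random_variable G X"
  shows "(\<lambda>\<omega>. set_norm (X \<omega>)) \<in> borel_measurable G"
proof (rule borel_measurableI_greater)
  fix a :: ennreal
  have cl: "closed {x::'b. ennreal c \<le> ennreal (norm x)}" if "0 \<le> c" for c
    using that by (auto simp: ennreal_le_iff intro!: closed_Collect_le continuous_intros)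
  then have *: "{\<omega>\<in>space G. X \<omega> \<inter> {x. ennreal (real_of_rat q) \<le> ennreal (norm x)} \<noteq> {}} \<in> sets G" if "0 \<le> q" for q
    using that by (intro sv_random_variable_hits[OF assms] cl) simp
  have "a < set_norm (X \<omega>) \<longleftrightarrow>
    (\<exists>q\<in>{q. 0 \<le> q \<and> a < ennreal (real_of_rat q)}. X \<omega> \<inter> {x. ennreal (real_of_rat q) \<le> ennreal (norm x)} \<noteq> {})" for \<omega>
  proof
    assume "a < set_norm (X \<omega>)"
    then obtain x where x: "x \<in> X \<omega>" "a < ennreal (norm x)" by (auto simp: set_norm_def less_SUP_iff)
    then obtain r where r: "a = ennreal r" "0 \<le> r" "r < norm x"
      by (cases a) (auto simp: ennreal_less_iff)
    then obtain q where "r < real_of_rat q" "real_of_rat q < norm x" using of_rat_dense by blast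
    then show "\<exists>q\<in>{q. 0 \<le> q \<and> a < ennreal (real_of_rat q)}. X \<omega> \<inter> {x. ennreal (real_of_rat q) \<le> ennreal (norm x)} \<noteq> {}"
    proof (intro bexI[of _ q])
      have "0 < real_of_rat q" using r \<open>r < real_of_rat q\<close> by linarith
      then show "q \<in> {q. 0 \<le> q \<and> a < ennreal (real_of_rat q)}"
        using r \<open>r < real_of_rat q\<close> by (simp add: ennreal_less_iff)
      show "X \<omega> \<inter> {x. ennreal (real_of_rat q) \<le> ennreal (norm x)} \<noteq> {}"
        using x(1) \<open>real_of_rat q < norm x\<close> by (auto intro!: ennreal_leI)
    qed
  next
    assume "\<exists>q\<in>{q. 0 \<le> q \<and> a < ennreal (real_of_rat q)}. X \<omega> \<inter> {x. ennreal (real_of_rat q) \<le> ennreal (norm x)} \<noteq> {}"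
    then show "a < set_norm (X \<omega>)" unfolding set_norm_def less_SUP_iff
      by (auto intro: less_le_trans ennreal_leI)
  qed
  then have "{\<omega>\<in>space G. a < set_norm (X \<omega>)} = (\<Union>q\<in>{q. 0 \<le> q \<and> a < ennreal (real_of_rat q)}.
      {\<omega>\<in>space G. X \<omega> \<inter> {x. ennreal (real_of_rat q) \<le> ennreal (norm x)} \<noteq> {}})" by auto
  also have "\<dots> \<in> sets G"
    by (rule sets.countable_UN'[OF countableI_type]) (use * in blast)
  finally show "{\<omega>\<in>space G. a < set_norm (X \<omega>)} \<in> sets G" .
qed

section \<open>Compact convex random sets and measurable projections\<close>

text \<open>The properties of the values are required at every point of the type, so that no
  exceptional set and no membership in the space has to be carried along.\<close>

definition compact_convex_rv :: "'a measure \<Rightarrow> ('a \<Rightarrow> 'b::euclidean_space set) \<Rightarrow> bool" where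
  "compact_convex_rv G X \<longleftrightarrow>
    (\<forall>\<omega>. compact (X \<omega>) \<and> convex (X \<omega>) \<and> X \<omega> \<noteq> {}) \<and> sv_random_variable G X"

lemma compact_convex_rvD:
  assumes "compact_convex_rv G X"
  shows "compact (X \<omega>)" "convex (X \<omega>)" "X \<omega> \<noteq> {}" "closed (X \<omega>)"
  using assms by (auto simp: compact_convex_rv_def compact_imp_closed)

lemma compact_convex_rv_sv: "compact_convex_rv G X \<Longrightarrow> sv_random_variable G X"
  by (simp add: compact_convex_rv_def)

lemma compact_convex_rv_mono:
  "compact_convex_rv G X \<Longrightarrow> sets G \<subseteq> sets H \<Longrightarrow> space G = space H \<Longrightarrow> compact_convex_rv H X"
  by (auto simp: compact_convex_rv_def intro: sv_random_variable_mono)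

lemma supp_measurable:
  assumes "compact_convex_rv G X"
  shows "(\<lambda>\<omega>. supp x (X \<omega>)) \<in> borel_measurable G"
proof (rule borel_measurable_iff_ge[THEN iffD2, rule_format])
  fix a
  have "a \<le> supp x (X \<omega>) \<longleftrightarrow> X \<omega> \<inter> {y. x \<bullet> y \<ge> a} \<noteq> {}" for \<omega>
    by (rule supp_attained[OF compact_convex_rvD(1,3)[OF assms], of \<omega> x])
      (auto dest: supp_upper[OF compact_convex_rvD(1)[OF assms], of _ _ x])
  then show "{\<omega>\<in>space G. a \<le> supp x (X \<omega>)} \<in> sets G"
    using sv_random_variable_hits[OF compact_convex_rv_sv[OF assms] closed_halfspace_ge[of a x]] by simp
qed

lemma radius_measurable:
  assumes "compact_convex_rv G X"
  shows "(\<lambda>\<omega>. radius (X \<omega>)) \<in> borel_measurable G"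
proof (rule borel_measurable_iff_ge[THEN iffD2, rule_format])
  fix a
  have "a \<le> radius (X \<omega>) \<longleftrightarrow> X \<omega> \<inter> {y. a \<le> norm y} \<noteq> {}" for \<omega>
    by (rule radius_attained[OF compact_convex_rvD(1,3)[OF assms], of \<omega>])
      (auto dest: radius_upper[OF compact_convex_rvD(1)[OF assms]])
  moreover have "closed {y::'b. a \<le> norm y}" by (intro closed_Collect_le continuous_intros)
  ultimately show "{\<omega>\<in>space G. a \<le> radius (X \<omega>)} \<in> sets G"
    using sv_random_variable_hits[OF compact_convex_rv_sv[OF assms]] by simp
qed

text \<open>The closest point lies in \<open>C\<close> iff every rational ball around
  \<open>q\<close> that meets the set also meets its intersection with \<open>C\<close>. Otherwise a
  rational radius fits strictly between the distances from \<open>q\<close> to the set and to that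
  intersection; once these distances agree, uniqueness of the closest point concludes.\<close>

lemma closest_point_measurable_const:
  assumes "compact_convex_rv G X"
  shows "(\<lambda>\<omega>. closest_point (X \<omega>) q) \<in> borel_measurable G"
  unfolding borel_eq_closed
proof (rule measurable_measure_of)
  fix C :: "'b set" assume "C \<in> Collect closed"
  then have C: "closed C" by simp
  have "closest_point (X \<omega>) q \<in> C \<longleftrightarrow>
      (\<forall>a::rat. X \<omega> \<inter> cball q (real_of_rat a) = {} \<or> X \<omega> \<inter> (C \<inter> cball q (real_of_rat a)) \<noteq> {})"
    (is "_ \<longleftrightarrow> ?r") for \<omega>
  proof
    note X = compact_convex_rvD[OF assms, of \<omega>]
    let ?p = "closest_point (X \<omega>) q"
    note p = closest_point_exists[OF X(4,3), of q]
    show ?r if "?p \<in> C"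
    proof
      fix a :: rat
      have "?p \<in> X \<omega> \<inter> (C \<inter> cball q (real_of_rat a))" if "y \<in> X \<omega> \<inter> cball q (real_of_rat a)" for y
        using p(1) p(2)[rule_format, of y] that \<open>?p \<in> C\<close> by auto
      then show "X \<omega> \<inter> cball q (real_of_rat a) = {} \<or> X \<omega> \<inter> (C \<inter> cball q (real_of_rat a)) \<noteq> {}"
        by blast
    qed
    show "?p \<in> C" if r: ?r
    proof -
      obtain a :: rat where "dist q ?p < real_of_rat a"
        using of_rat_dense[of "dist q ?p" "dist q ?p + 1"] by auto
      then have ne: "X \<omega> \<inter> C \<noteq> {}"
        using r[rule_format, of a] p by auto
      have "compact (X \<omega> \<inter> C)" using X C by (intro compact_Int_closed)
      then obtain z where z: "z \<in> X \<omega>" "z \<in> C" "\<And>y. y \<in> X \<omega> \<Longrightarrow> y \<in> C \<Longrightarrow> dist q z \<le> dist q y"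
        using distance_attains_inf[OF compact_imp_closed ne, of q] by (metis IntE IntI)
      have "dist q z \<le> dist q ?p"
      proof (rule ccontr)
        assume "\<not> ?thesis"
        then obtain a :: rat where "dist q ?p < real_of_rat a" "real_of_rat a < dist q z"
          using of_rat_dense[of "dist q ?p" "dist q z"] by auto
        moreover have "?p \<in> X \<omega> \<inter> cball q (real_of_rat a)" using p(1) calculation(1) by simp
        then obtain y where "y \<in> X \<omega>" "y \<in> C" "dist q y \<le> real_of_rat a"
          using r[rule_format, of a] by auto
        ultimately show False using z(3)[of y] by simp
      qed
      then have "z = ?p"
        using p by (intro closest_point_unique[OF X(2,4) z(1)]) (blast intro: order_trans)
      then show ?thesis using z by simp
    qed
  qed
  then have "(\<lambda>\<omega>. closest_point (X \<omega>) q) -` C \<inter> space G = {\<omega>\<in>space G. \<forall>a::rat.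
     \<not> (X \<omega> \<inter> cball q (real_of_rat a) \<noteq> {}) \<or> X \<omega> \<inter> (C \<inter> cball q (real_of_rat a)) \<noteq> {}}" by auto
  also have "\<dots> \<in> sets G"
    by (intro sets.sets_Collect_countable_All sets.sets_Collect_disj sets.sets_Collect_neg
        sv_random_variable_hits[OF compact_convex_rv_sv[OF assms]] closed_Int C closed_cball)
  finally show "(\<lambda>\<omega>. closest_point (X \<omega>) q) -` C \<inter> space G \<in> sets G" .
qed auto

text \<open>For a simple function the projection is a countable case distinction over constants;
  continuity of the projection handles the limit.\<close>

lemma closest_point_measurable:
  assumes X: "compact_convex_rv G X" and f: "f \<in> borel_measurable G"
  shows "(\<lambda>\<omega>. closest_point (X \<omega>) (f \<omega>)) \<in> borel_measurable G"
proof -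
  obtain s where s: "\<And>i. simple_function G (s i)" "\<And>\<omega>. \<omega> \<in> space G \<Longrightarrow> (\<lambda>i. s i \<omega>) \<longlonglongrightarrow> f \<omega>"
    using borel_measurable_implies_sequence_metric[OF f, of 0] by metis
  show ?thesis
  proof (rule borel_measurable_LIMSEQ_metric)
    show "(\<lambda>\<omega>. closest_point (X \<omega>) (s i \<omega>)) \<in> borel_measurable G" for i
    proof (rule measurable_compose_countable'[where I="s i ` space G" and g="s i" and f="\<lambda>q \<omega>. closest_point (X \<omega>) q"])
      show "s i \<in> measurable G (count_space (s i ` space G))"
        using s(1)[of i] by (auto simp: measurable_count_space_eq2 simple_function_def)
      show "countable (s i ` space G)"
        using s(1)[of i] by (auto simp: simple_function_def countable_finite)
    qed (rule closest_point_measurable_const[OF X])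
    show "(\<lambda>i. closest_point (X \<omega>) (s i \<omega>)) \<longlonglongrightarrow> closest_point (X \<omega>) (f \<omega>)" if "\<omega> \<in> space G" for \<omega>
      using continuous_at_closest_point[of "X \<omega>" "f \<omega>"] compact_convex_rvD[OF X, of \<omega>] s(2)[OF that]
      by (auto intro: isCont_tendsto_compose)
  qed
qed

lemma closest_point_mem:
  "compact_convex_rv G X \<Longrightarrow> closest_point (X \<omega>) q \<in> X \<omega>"
  by (intro closest_point_exists(1) compact_convex_rvD)

lemma dist_closest_point:
  assumes "compact_convex_rv G X"
  shows "norm (q - closest_point (X \<omega>) q) = infdist q (X \<omega>)"
  using setdist_closest_point[of "X \<omega>" q] compact_convex_rvD(3,4)[OF assms]
  by (simp add: infdist_eq_setdist dist_norm)

section \<open>Conditional expectation of random vectors\<close>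

lemma selectionsD:
  assumes "\<xi> \<in> selections P G X"
  shows "\<xi> \<in> borel_measurable G" "integrable P \<xi>" "AE \<omega> in P. \<xi> \<omega> \<in> X \<omega>"
  using assms by (auto simp: selections_def)

lemma vec_cond_exp_inner_Basis:
  "b \<in> Basis \<Longrightarrow> vec_cond_exp P G \<xi> \<omega> \<bullet> b = real_cond_exp P G (\<lambda>\<omega>'. \<xi> \<omega>' \<bullet> b) \<omega>"
  by (simp add: vec_cond_exp_def inner_sum_left inner_Basis if_distrib sum.delta cong: if_cong)

lemma AE_eq_by_components:
  fixes f g :: "'a \<Rightarrow> 'b::euclidean_space"
  assumes "\<And>b. b \<in> Basis \<Longrightarrow> AE \<omega> in P. f \<omega> \<bullet> b = g \<omega> \<bullet> b"
  shows "AE \<omega> in P. f \<omega> = g \<omega>"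
proof -
  have "AE \<omega> in P. \<forall>b\<in>Basis. f \<omega> \<bullet> b = g \<omega> \<bullet> b"
    using assms by (intro AE_finite_allI) auto
  then show ?thesis by eventually_elim (auto intro: euclidean_eqI)
qed

lemma integrable_norm_diff:
  "integrable P f \<Longrightarrow> integrable P g \<Longrightarrow> integrable P (\<lambda>\<omega>. norm (f \<omega> - g \<omega> :: 'b::euclidean_space))"
  by (intro integrable_norm Bochner_Integration.integrable_diff)

lemma integral_norm_triangle:
  fixes f g h :: "'a \<Rightarrow> 'b::euclidean_space"
  assumes "integrable P f" "integrable P g" "integrable P h"
  shows "(\<integral>\<omega>. norm (f \<omega> - h \<omega>) \<partial>P) \<le> (\<integral>\<omega>. norm (f \<omega> - g \<omega>) \<partial>P) + (\<integral>\<omega>. norm (g \<omega> - h \<omega>) \<partial>P)"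
proof -
  have "(\<integral>\<omega>. norm (f \<omega> - h \<omega>) \<partial>P) \<le> (\<integral>\<omega>. norm (f \<omega> - g \<omega>) + norm (g \<omega> - h \<omega>) \<partial>P)"
    using assms by (intro integral_mono integrable_norm_diff Bochner_Integration.integrable_add)
      (auto intro: norm_diff_triangle_ineq norm_diff_triangle_le)
  also have "\<dots> = (\<integral>\<omega>. norm (f \<omega> - g \<omega>) \<partial>P) + (\<integral>\<omega>. norm (g \<omega> - h \<omega>) \<partial>P)"
    using assms by (intro Bochner_Integration.integral_add integrable_norm_diff)
  finally show ?thesis .
qed

lemma vec_cond_exp_measurable [measurable]: "vec_cond_exp P G \<xi> \<in> borel_measurable G"
  unfolding vec_cond_exp_def[abs_def] by measurable

context sigma_finite_subalgebra
begin

lemma vec_cond_exp_measurable2 [measurable]: "vec_cond_exp M F \<xi> \<in> borel_measurable M"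
  unfolding vec_cond_exp_def[abs_def] by measurable

lemma vec_cond_exp_integrable:
  "integrable M \<xi> \<Longrightarrow> integrable M (vec_cond_exp M F \<xi>)"
  unfolding vec_cond_exp_def[abs_def]
  by (intro Bochner_Integration.integrable_sum integrable_scaleR_left real_cond_exp_int integrable_inner_left)

lemma vec_cond_exp_inner:
  fixes \<xi> :: "'a \<Rightarrow> 'b::euclidean_space"
  assumes [measurable]: "integrable M \<xi>"
  shows "AE \<omega> in M. x \<bullet> vec_cond_exp M F \<xi> \<omega> = real_cond_exp M F (\<lambda>\<omega>. x \<bullet> \<xi> \<omega>) \<omega>"
proof -
  have "AE \<omega> in M. real_cond_exp M F (\<lambda>\<omega>. \<Sum>b\<in>Basis. (x \<bullet> b) * (\<xi> \<omega> \<bullet> b)) \<omega> =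
      (\<Sum>b\<in>Basis. real_cond_exp M F (\<lambda>\<omega>. (x \<bullet> b) * (\<xi> \<omega> \<bullet> b)) \<omega>)"
    using assms by (intro real_cond_exp_sum) auto
  moreover have "AE \<omega> in M. \<forall>b\<in>Basis. real_cond_exp M F (\<lambda>\<omega>. (x \<bullet> b) * (\<xi> \<omega> \<bullet> b)) \<omega> =
      (x \<bullet> b) * real_cond_exp M F (\<lambda>\<omega>. \<xi> \<omega> \<bullet> b) \<omega>"
    using assms by (intro AE_finite_allI real_cond_exp_cmult) auto
  ultimately show ?thesis
  proof eventually_elim
    case (elim \<omega>)
    have "x \<bullet> vec_cond_exp M F \<xi> \<omega> = (\<Sum>b\<in>Basis. (x \<bullet> b) * (vec_cond_exp M F \<xi> \<omega> \<bullet> b))"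
      by (rule euclidean_inner)
    then show ?case using elim by (simp add: vec_cond_exp_inner_Basis euclidean_inner[of x "\<xi> _"])
  qed
qed

lemma vec_cond_exp_diff:
  fixes \<xi> \<eta> :: "'a \<Rightarrow> 'b::euclidean_space"
  assumes "integrable M \<xi>" "integrable M \<eta>"
  shows "AE \<omega> in M. vec_cond_exp M F (\<lambda>\<omega>. \<xi> \<omega> - \<eta> \<omega>) \<omega> = vec_cond_exp M F \<xi> \<omega> - vec_cond_exp M F \<eta> \<omega>"
proof (rule AE_eq_by_components)
  fix b :: 'b assume b: "b \<in> Basis"
  show "AE \<omega> in M. vec_cond_exp M F (\<lambda>\<omega>. \<xi> \<omega> - \<eta> \<omega>) \<omega> \<bullet> b = (vec_cond_exp M F \<xi> \<omega> - vec_cond_exp M F \<eta> \<omega>) \<bullet> b"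
    unfolding inner_diff_left vec_cond_exp_inner_Basis[OF b]
    using assms by (intro real_cond_exp_diff integrable_inner_left)
qed

lemma vec_cond_exp_F_meas:
  fixes \<xi> :: "'a \<Rightarrow> 'b::euclidean_space"
  assumes "integrable M \<xi>" "\<xi> \<in> borel_measurable F"
  shows "AE \<omega> in M. vec_cond_exp M F \<xi> \<omega> = \<xi> \<omega>"
proof (rule AE_eq_by_components)
  fix b :: 'b assume b: "b \<in> Basis"
  show "AE \<omega> in M. vec_cond_exp M F \<xi> \<omega> \<bullet> b = \<xi> \<omega> \<bullet> b"
    unfolding vec_cond_exp_inner_Basis[OF b] using assms by (intro real_cond_exp_F_meas) auto
qed

lemma vec_cond_exp_nested:
  fixes \<xi> :: "'a \<Rightarrow> 'b::euclidean_space"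
  assumes "subalgebra M G" "subalgebra G F" "integrable M \<xi>"
  shows "AE \<omega> in M. vec_cond_exp M F (vec_cond_exp M G \<xi>) \<omega> = vec_cond_exp M F \<xi> \<omega>"
proof (rule AE_eq_by_components)
  fix b :: 'b assume b: "b \<in> Basis"
  show "AE \<omega> in M. vec_cond_exp M F (vec_cond_exp M G \<xi>) \<omega> \<bullet> b = vec_cond_exp M F \<xi> \<omega> \<bullet> b"
    unfolding vec_cond_exp_inner_Basis[OF b] using assms
    by (intro real_cond_exp_nested_subalg integrable_inner_left)
qed

text \<open>The splice is \<eta> plus the indicator of \<open>B\<close> times \<xi> - \<eta>, and
  the indicator, being measurable for \<open>F\<close>, can be taken out. This is the source of
  decomposability.\<close>

lemma vec_cond_exp_if:
  fixes \<xi> \<eta> :: "'a \<Rightarrow> 'b::euclidean_space"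
  assumes [measurable]: "integrable M \<xi>" "integrable M \<eta>" "B \<in> sets F"
  shows "AE \<omega> in M. vec_cond_exp M F (\<lambda>\<omega>. if \<omega> \<in> B then \<xi> \<omega> else \<eta> \<omega>) \<omega> =
    (if \<omega> \<in> B then vec_cond_exp M F \<xi> \<omega> else vec_cond_exp M F \<eta> \<omega>)"
proof (rule AE_eq_by_components)
  fix b :: 'b assume b: "b \<in> Basis"
  have B[measurable]: "B \<in> sets M" using subalg assms(3) by (auto simp: subalgebra_def)
  let ?d = "\<lambda>\<omega>. (\<xi> \<omega> - \<eta> \<omega>) \<bullet> b"
  have [measurable]: "integrable M ?d" using assms by auto
  have i: "integrable M (\<lambda>\<omega>. indicator B \<omega> * ?d \<omega>)"
    using integrable_mult_indicator[OF B \<open>integrable M ?d\<close>] by simp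
  have "AE \<omega> in M. real_cond_exp M F (\<lambda>\<omega>. indicator B \<omega> * ?d \<omega>) \<omega> = indicator B \<omega> * real_cond_exp M F ?d \<omega>"
    using i by (intro real_cond_exp_mult) auto
  moreover have "AE \<omega> in M. real_cond_exp M F (\<lambda>\<omega>. indicator B \<omega> * ?d \<omega> + \<eta> \<omega> \<bullet> b) \<omega> =
      real_cond_exp M F (\<lambda>\<omega>. indicator B \<omega> * ?d \<omega>) \<omega> + real_cond_exp M F (\<lambda>\<omega>. \<eta> \<omega> \<bullet> b) \<omega>"
    using i assms by (intro real_cond_exp_add) auto
  moreover have "AE \<omega> in M. real_cond_exp M F ?d \<omega> =
      real_cond_exp M F (\<lambda>\<omega>. \<xi> \<omega> \<bullet> b) \<omega> - real_cond_exp M F (\<lambda>\<omega>. \<eta> \<omega> \<bullet> b) \<omega>"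
    using assms unfolding inner_diff_left by (intro real_cond_exp_diff) auto
  moreover have "(\<lambda>\<omega>. (if \<omega> \<in> B then \<xi> \<omega> else \<eta> \<omega>) \<bullet> b) = (\<lambda>\<omega>. indicator B \<omega> * ?d \<omega> + \<eta> \<omega> \<bullet> b)"
    by (auto simp: fun_eq_iff inner_diff_left)
  ultimately show "AE \<omega> in M. vec_cond_exp M F (\<lambda>\<omega>. if \<omega> \<in> B then \<xi> \<omega> else \<eta> \<omega>) \<omega> \<bullet> b =
    (if \<omega> \<in> B then vec_cond_exp M F \<xi> \<omega> else vec_cond_exp M F \<eta> \<omega>) \<bullet> b"
    unfolding vec_cond_exp_inner_Basis[OF b]
    by (auto simp: vec_cond_exp_inner_Basis[OF b] split: if_splits elim!: eventually_elim2)
qed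

text \<open>The factor \<open>DIM('b)\<close> comes from bounding the norm by the sum of the
  absolute coordinates, each of which obeys the scalar estimate.\<close>

lemma vec_cond_exp_norm_le:
  fixes \<xi> :: "'a \<Rightarrow> 'b::euclidean_space"
  assumes "integrable M \<xi>" "integrable M g" "AE \<omega> in M. norm (\<xi> \<omega>) \<le> g \<omega>"
  shows "AE \<omega> in M. norm (vec_cond_exp M F \<xi> \<omega>) \<le> DIM('b) * real_cond_exp M F g \<omega>"
proof -
  have "AE \<omega> in M. \<bar>real_cond_exp M F (\<lambda>\<omega>. \<xi> \<omega> \<bullet> b) \<omega>\<bar> \<le> real_cond_exp M F g \<omega>" if b: "b \<in> Basis" for b
  proof -
    have le: "AE \<omega> in M. \<bar>\<xi> \<omega> \<bullet> b\<bar> \<le> g \<omega>"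
      using assms(3) by eventually_elim (use Basis_le_norm[OF b] order_trans in blast)
    have "AE \<omega> in M. real_cond_exp M F (\<lambda>\<omega>. \<xi> \<omega> \<bullet> b) \<omega> \<le> real_cond_exp M F g \<omega>"
      using assms le by (intro real_cond_exp_mono) auto
    moreover have "AE \<omega> in M. real_cond_exp M F (\<lambda>\<omega>. (-1) * g \<omega>) \<omega> \<le> real_cond_exp M F (\<lambda>\<omega>. \<xi> \<omega> \<bullet> b) \<omega>"
      using assms le by (intro real_cond_exp_mono) auto
    moreover have "AE \<omega> in M. real_cond_exp M F (\<lambda>\<omega>. (-1) * g \<omega>) \<omega> = (-1) * real_cond_exp M F g \<omega>"
      using assms by (intro real_cond_exp_cmult)
    ultimately show ?thesis by eventually_elim linarith
  qed
  then have "AE \<omega> in M. \<forall>b\<in>Basis. \<bar>real_cond_exp M F (\<lambda>\<omega>. \<xi> \<omega> \<bullet> b) \<omega>\<bar> \<le> real_cond_exp M F g \<omega>"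
    by (intro AE_finite_allI) auto
  then show ?thesis
  proof eventually_elim
    case (elim \<omega>)
    have "norm (vec_cond_exp M F \<xi> \<omega>) \<le> (\<Sum>b\<in>Basis. \<bar>vec_cond_exp M F \<xi> \<omega> \<bullet> b\<bar>)"
      by (rule norm_le_l1)
    also have "\<dots> \<le> (\<Sum>b\<in>(Basis::'b set). real_cond_exp M F g \<omega>)"
      using elim by (intro sum_mono) (simp add: vec_cond_exp_inner_Basis)
    finally show ?case by simp
  qed
qed

lemma integral_norm_vec_cond_exp_le:
  fixes \<xi> :: "'a \<Rightarrow> 'b::euclidean_space"
  assumes "integrable M \<xi>"
  shows "(\<integral>\<omega>. norm (vec_cond_exp M F \<xi> \<omega>) \<partial>M) \<le> DIM('b) * (\<integral>\<omega>. norm (\<xi> \<omega>) \<partial>M)"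
proof -
  have "(\<integral>\<omega>. norm (vec_cond_exp M F \<xi> \<omega>) \<partial>M) \<le> (\<integral>\<omega>. DIM('b) * real_cond_exp M F (\<lambda>\<omega>. norm (\<xi> \<omega>)) \<omega> \<partial>M)"
    using assms by (intro integral_mono_AE vec_cond_exp_norm_le integrable_norm vec_cond_exp_integrable
        integrable_mult_right real_cond_exp_int) auto
  also have "\<dots> = DIM('b) * (\<integral>\<omega>. norm (\<xi> \<omega>) \<partial>M)"
    using assms by (simp add: real_cond_exp_int)
  finally show ?thesis .
qed

text \<open>The Lipschitz constant does not depend on the sub-algebra, so the estimate may be used
  along a sequence of different ones.\<close>

lemma integral_norm_vec_cond_exp_diff_le:
  fixes \<xi> \<eta> :: "'a \<Rightarrow> 'b::euclidean_space"
  assumes "integrable M \<xi>" "integrable M \<eta>"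
  shows "(\<integral>\<omega>. norm (vec_cond_exp M F \<xi> \<omega> - vec_cond_exp M F \<eta> \<omega>) \<partial>M) \<le> DIM('b) * (\<integral>\<omega>. norm (\<xi> \<omega> - \<eta> \<omega>) \<partial>M)"
proof -
  have "(\<integral>\<omega>. norm (vec_cond_exp M F \<xi> \<omega> - vec_cond_exp M F \<eta> \<omega>) \<partial>M) =
      (\<integral>\<omega>. norm (vec_cond_exp M F (\<lambda>\<omega>. \<xi> \<omega> - \<eta> \<omega>) \<omega>) \<partial>M)"
    using vec_cond_exp_diff[OF assms] by (intro integral_cong_AE) auto
  also have "\<dots> \<le> DIM('b) * (\<integral>\<omega>. norm (\<xi> \<omega> - \<eta> \<omega>) \<partial>M)"
    using assms by (intro integral_norm_vec_cond_exp_le) auto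
  finally show ?thesis .
qed

lemma integral_inner_vec_cond_exp:
  fixes \<xi> :: "'a \<Rightarrow> 'b::euclidean_space"
  assumes "integrable M \<xi>"
  shows "(\<integral>\<omega>. x \<bullet> vec_cond_exp M F \<xi> \<omega> \<partial>M) = (\<integral>\<omega>. x \<bullet> \<xi> \<omega> \<partial>M)"
proof -
  have "(\<integral>\<omega>. x \<bullet> vec_cond_exp M F \<xi> \<omega> \<partial>M) = (\<integral>\<omega>. real_cond_exp M F (\<lambda>\<omega>. x \<bullet> \<xi> \<omega>) \<omega> \<partial>M)"
    using vec_cond_exp_inner[OF assms] by (intro integral_cong_AE) auto
  then show ?thesis using assms by (simp add: real_cond_exp_int)
qed

end

lemma integrable_selection:
  fixes X :: "'a \<Rightarrow> 'b::euclidean_space set"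
  assumes "\<And>\<omega>. compact (X \<omega>)" "integrable P (\<lambda>\<omega>. radius (X \<omega>))" "\<xi> \<in> borel_measurable P"
    "AE \<omega> in P. \<xi> \<omega> \<in> X \<omega>"
  shows "integrable P \<xi>"
proof (rule Bochner_Integration.integrable_bound[OF assms(2,3)])
  show "AE \<omega> in P. norm (\<xi> \<omega>) \<le> norm (radius (X \<omega>))"
    using assms(4) by eventually_elim (use radius_upper[OF assms(1)] in force)
qed

lemma abs_supp_le:
  assumes "compact A" "A \<noteq> {}"
  shows "\<bar>supp x A\<bar> \<le> norm x * radius A"
proof -
  obtain y where y: "y \<in> A" "supp x A = x \<bullet> y" using supp_attained assms by blast
  then have "\<bar>supp x A\<bar> \<le> norm x * norm y" by (simp add: Cauchy_Schwarz_ineq2)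
  also have "\<dots> \<le> norm x * radius A" by (intro mult_left_mono radius_upper assms y) auto
  finally show ?thesis .
qed

lemma integrable_supp:
  assumes "compact_convex_rv P X" "integrable P (\<lambda>\<omega>. radius (X \<omega>))"
  shows "integrable P (\<lambda>\<omega>. supp x (X \<omega>))"
proof (rule Bochner_Integration.integrable_bound)
  show "integrable P (\<lambda>\<omega>. norm x * radius (X \<omega>))" using assms by simp
  show "AE \<omega> in P. norm (supp x (X \<omega>)) \<le> norm (norm x * radius (X \<omega>))"
    using abs_supp_le[OF compact_convex_rvD(1,3)[OF assms(1)], of x]
    by (intro AE_I2) (simp, blast intro: order_trans[OF _ abs_ge_self])
qed (rule supp_measurable[OF assms(1)])

text \<open>By separation, membership in a compact convex set is a countable family of linear inequalities,
  and each of them survives conditioning.\<close>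

lemma (in sigma_finite_subalgebra) vec_cond_exp_selection:
  fixes X :: "'a \<Rightarrow> 'b::euclidean_space set"
  assumes X: "compact_convex_rv F X" "integrable M (\<lambda>\<omega>. radius (X \<omega>))"
    and \<xi>: "\<xi> \<in> selections M M X"
  shows "AE \<omega> in M. vec_cond_exp M F \<xi> \<omega> \<in> X \<omega>"
proof -
  obtain W :: "'b set" where W: "countable W" "cball 0 1 \<subseteq> closure W" using separable by metis
  note \<xi> = selectionsD[OF \<xi>]
  have XM: "compact_convex_rv M X"
    using X(1) subalg by (auto simp: subalgebra_def intro: compact_convex_rv_mono)
  have "AE \<omega> in M. w \<bullet> vec_cond_exp M F \<xi> \<omega> \<le> supp w (X \<omega>)" for w
  proof -
    have "AE \<omega> in M. real_cond_exp M F (\<lambda>\<omega>. w \<bullet> \<xi> \<omega>) \<omega> \<le> real_cond_exp M F (\<lambda>\<omega>. supp w (X \<omega>)) \<omega>"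
    proof (rule real_cond_exp_mono)
      show "AE \<omega> in M. w \<bullet> \<xi> \<omega> \<le> supp w (X \<omega>)"
        using \<xi>(3) by eventually_elim (intro supp_upper compact_convex_rvD[OF X(1)])
    qed (use \<xi>(2) integrable_supp[OF XM X(2)] in auto)
    moreover have "AE \<omega> in M. real_cond_exp M F (\<lambda>\<omega>. supp w (X \<omega>)) \<omega> = supp w (X \<omega>)"
      using integrable_supp[OF XM X(2)] supp_measurable[OF X(1)] by (intro real_cond_exp_F_meas)
    ultimately show ?thesis using vec_cond_exp_inner[OF \<xi>(2), of w] by eventually_elim simp
  qed
  then have "AE \<omega> in M. \<forall>w\<in>W. w \<bullet> vec_cond_exp M F \<xi> \<omega> \<le> supp w (X \<omega>)"
    by (intro AE_ball_countable') (use W in auto)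
  then show ?thesis
    by eventually_elim (intro mem_of_supp_dense[OF _ _ _ W(2)] compact_convex_rvD[OF X(1)], auto)
qed

text \<open>Truncation at level \<open>K\<close> replaces the uniform integrability of conditional expectations:
  \<open>(E[g|G] - K)\<^sup>+ \<le> E[(g - K)\<^sup>+|G]\<close>, whose integral does not depend on \<open>G\<close>.\<close>

lemma (in sigma_finite_subalgebra) integral_real_cond_exp_excess_le:
  assumes g: "integrable M g" and K: "integrable M (\<lambda>_. K)"
  shows "integrable M (\<lambda>\<omega>. max 0 (real_cond_exp M F g \<omega> - K))"
    "(\<integral>\<omega>. max 0 (real_cond_exp M F g \<omega> - K) \<partial>M) \<le> (\<integral>\<omega>. max 0 (g \<omega> - K) \<partial>M)"
proof -
  have gK: "integrable M (\<lambda>\<omega>. max 0 (g \<omega> - K))" using g K by simp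
  show 1: "integrable M (\<lambda>\<omega>. max 0 (real_cond_exp M F g \<omega> - K))"
    using real_cond_exp_int(1)[OF g] K by simp
  have "AE \<omega> in M. real_cond_exp M F (\<lambda>\<omega>. g \<omega> - K) \<omega> = real_cond_exp M F g \<omega> - real_cond_exp M F (\<lambda>_. K) \<omega>"
    using g K by (rule real_cond_exp_diff)
  moreover have "AE \<omega> in M. real_cond_exp M F (\<lambda>_. K) \<omega> = K"
    by (rule real_cond_exp_F_meas[OF K borel_measurable_const])
  moreover have "AE \<omega> in M. real_cond_exp M F (\<lambda>\<omega>. g \<omega> - K) \<omega> \<le> real_cond_exp M F (\<lambda>\<omega>. max 0 (g \<omega> - K)) \<omega>"
    using g K gK by (intro real_cond_exp_mono) auto
  moreover have "AE \<omega> in M. 0 \<le> real_cond_exp M F (\<lambda>\<omega>. max 0 (g \<omega> - K)) \<omega>"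
    using gK by (intro real_cond_exp_pos) auto
  ultimately have "AE \<omega> in M. max 0 (real_cond_exp M F g \<omega> - K) \<le> real_cond_exp M F (\<lambda>\<omega>. max 0 (g \<omega> - K)) \<omega>"
    by eventually_elim auto
  then have "(\<integral>\<omega>. max 0 (real_cond_exp M F g \<omega> - K) \<partial>M) \<le> (\<integral>\<omega>. real_cond_exp M F (\<lambda>\<omega>. max 0 (g \<omega> - K)) \<omega> \<partial>M)"
    using 1 gK by (intro integral_mono_AE real_cond_exp_int(1))
  then show "(\<integral>\<omega>. max 0 (real_cond_exp M F g \<omega> - K) \<partial>M) \<le> (\<integral>\<omega>. max 0 (g \<omega> - K) \<partial>M)"
    using real_cond_exp_int(2)[OF gK] by simp
qed

section \<open>Dominated convergence with varying conditional expectations as majorants\<close>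

lemma (in finite_measure) excess_integral_tendsto_0:
  fixes g :: "'a \<Rightarrow> real"
  assumes g: "integrable M g"
  shows "(\<lambda>K::nat. \<integral>\<omega>. max 0 (g \<omega> - real K) \<partial>M) \<longlonglongrightarrow> 0"
proof -
  have "(\<lambda>K::nat. \<integral>\<omega>. max 0 (g \<omega> - real K) \<partial>M) \<longlonglongrightarrow> (\<integral>\<omega>. 0 \<partial>M)"
  proof (rule integral_dominated_convergence[where w="\<lambda>\<omega>. \<bar>g \<omega>\<bar>"])
    show "AE \<omega> in M. (\<lambda>K::nat. max 0 (g \<omega> - real K)) \<longlonglongrightarrow> 0"
    proof (intro AE_I2 tendsto_eventually)
      fix \<omega>
      obtain N :: nat where "g \<omega> \<le> real N" using real_arch_simple by blast
      then show "\<forall>\<^sub>F K::nat in sequentially. max 0 (g \<omega> - real K) = 0"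
        by (intro eventually_sequentiallyI[of N]) (auto simp: max_def)
    qed
  qed (use g in auto)
  then show ?thesis by simp
qed

text \<open>Almost surely |f n| is at most min(|f n|, 2K) plus the excesses over K of E[g | G n] and
  of k. The excesses are small uniformly in n once K is large, and the truncated part tends to 0 for
  fixed K.\<close>

lemma (in finite_measure) integral_tendsto_0_dominated_cond_exp:
  fixes f :: "nat \<Rightarrow> 'a \<Rightarrow> real"
  assumes sub: "\<And>n. subalgebra M (G n)"
    and g: "integrable M g" and k: "integrable M k"
    and f[measurable]: "\<And>n. f n \<in> borel_measurable M"
    and lim: "AE \<omega> in M. (\<lambda>n. f n \<omega>) \<longlonglongrightarrow> 0"
    and le: "\<And>n. AE \<omega> in M. \<bar>f n \<omega>\<bar> \<le> real_cond_exp M (G n) g \<omega> + k \<omega>"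
  shows "\<And>n. integrable M (f n)" "(\<lambda>n. \<integral>\<omega>. \<bar>f n \<omega>\<bar> \<partial>M) \<longlonglongrightarrow> 0"
proof -
  have sf: "sigma_finite_subalgebra M (G n)" for n
    using sub finite_measure_subalgebra_is_sigma_finite[of M "G n"]
    by (simp add: finite_measure_subalgebra_def finite_measure_subalgebra_axioms_def finite_measure_axioms)
  note rint = sigma_finite_subalgebra.real_cond_exp_int(1)[OF sf g]
  note excess = sigma_finite_subalgebra.integral_real_cond_exp_excess_le[OF sf g]
  show fint: "integrable M (f n)" for n
    by (rule Bochner_Integration.integrable_bound[OF Bochner_Integration.integrable_add[OF rint[of n] k]])
      (use le[of n] in \<open>auto elim!: eventually_mono\<close>)
  show "(\<lambda>n. \<integral>\<omega>. \<bar>f n \<omega>\<bar> \<partial>M) \<longlonglongrightarrow> 0"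
  proof (rule tendstoI)
    fix e :: real assume "e > 0"
    then have "\<forall>\<^sub>F K::nat in sequentially. (\<integral>\<omega>. max 0 (g \<omega> - real K) \<partial>M) < e / 3 \<and> (\<integral>\<omega>. max 0 (k \<omega> - real K) \<partial>M) < e / 3"
      using excess_integral_tendsto_0[OF g] excess_integral_tendsto_0[OF k]
      by (intro eventually_conj order_tendstoD(2)) auto
    then obtain K :: nat where K: "(\<integral>\<omega>. max 0 (g \<omega> - real K) \<partial>M) < e / 3" "(\<integral>\<omega>. max 0 (k \<omega> - real K) \<partial>M) < e / 3"
      by (auto simp: eventually_sequentially)
    \<comment> \<open>The level is 2K because the majorant has two summands, each cut at K.\<close>
    have "(\<lambda>n. \<integral>\<omega>. min \<bar>f n \<omega>\<bar> (2 * real K) \<partial>M) \<longlonglongrightarrow> (\<integral>\<omega>. 0 \<partial>M)"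
    proof (rule integral_dominated_convergence[where w="\<lambda>_. 2 * real K"])
      show "AE \<omega> in M. (\<lambda>n. min \<bar>f n \<omega>\<bar> (2 * real K)) \<longlonglongrightarrow> 0"
        using lim
      proof eventually_elim
        case (elim \<omega>)
        have "(\<lambda>n. min \<bar>f n \<omega>\<bar> (2 * real K)) \<longlonglongrightarrow> min \<bar>0\<bar> (2 * real K)"
          by (intro tendsto_min tendsto_rabs elim tendsto_const)
        then show ?case by simp
      qed
    qed auto
    then have "\<forall>\<^sub>F n in sequentially. (\<integral>\<omega>. min \<bar>f n \<omega>\<bar> (2 * real K) \<partial>M) < e / 3"
      using \<open>e > 0\<close> by (intro order_tendstoD(2)) auto
    then show "\<forall>\<^sub>F n in sequentially. dist (\<integral>\<omega>. \<bar>f n \<omega>\<bar> \<partial>M) 0 < e"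
    proof eventually_elim
      case (elim n)
      have i: "integrable M (\<lambda>\<omega>. min \<bar>f n \<omega>\<bar> (2 * real K))" using fint by simp
      have j: "integrable M (\<lambda>\<omega>. max 0 (real_cond_exp M (G n) g \<omega> - real K))"
        by (rule excess(1)) simp
      have l: "integrable M (\<lambda>\<omega>. max 0 (k \<omega> - real K))" using k by simp
      have "(\<integral>\<omega>. \<bar>f n \<omega>\<bar> \<partial>M) \<le> (\<integral>\<omega>. (min \<bar>f n \<omega>\<bar> (2 * real K) +
          max 0 (real_cond_exp M (G n) g \<omega> - real K)) + max 0 (k \<omega> - real K) \<partial>M)"
        using i j l fint le[of n]
        by (intro integral_mono_AE Bochner_Integration.integrable_add integrable_abs)
          (auto elim!: eventually_mono simp: min_def max_def)
      also have "\<dots> = (\<integral>\<omega>. min \<bar>f n \<omega>\<bar> (2 * real K) \<partial>M) +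
          (\<integral>\<omega>. max 0 (real_cond_exp M (G n) g \<omega> - real K) \<partial>M) + (\<integral>\<omega>. max 0 (k \<omega> - real K) \<partial>M)"
        using i j l by (simp add: Bochner_Integration.integral_add)
      also have "(\<integral>\<omega>. max 0 (real_cond_exp M (G n) g \<omega> - real K) \<partial>M) \<le> (\<integral>\<omega>. max 0 (g \<omega> - real K) \<partial>M)"
        by (rule excess(2)) simp
      finally have "(\<integral>\<omega>. \<bar>f n \<omega>\<bar> \<partial>M) < e" using elim K by linarith
      moreover have "0 \<le> (\<integral>\<omega>. \<bar>f n \<omega>\<bar> \<partial>M)" by simp
      ultimately show ?case by simp
    qed
  qed
qed

section \<open>Existence of set-valued conditional expectations\<close>

lemma L1_closureD:
  assumes "\<eta> \<in> L1_closure P G A"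
  shows "\<eta> \<in> borel_measurable G" "integrable P \<eta>"
    "\<And>e. 0 < e \<Longrightarrow> \<exists>\<zeta>\<in>A. (\<integral>\<omega>. norm (\<eta> \<omega> - \<zeta> \<omega>) \<partial>P) < e"
  using assms by (auto simp: L1_closure_def)

lemma L1_closureI:
  assumes "\<eta> \<in> borel_measurable G" "integrable P \<eta>"
    "\<And>e. 0 < e \<Longrightarrow> \<exists>\<zeta>\<in>A. (\<integral>\<omega>. norm (\<eta> \<omega> - \<zeta> \<omega>) \<partial>P) < e"
  shows "\<eta> \<in> L1_closure P G A"
  using assms by (auto simp: L1_closure_def)

lemma L1_closure_sequence:
  assumes "\<eta> \<in> L1_closure P G A"
  obtains \<zeta> where "\<And>n. \<zeta> n \<in> A" "(\<lambda>n. \<integral>\<omega>. norm (\<eta> \<omega> - \<zeta> n \<omega>) \<partial>P) \<longlonglongrightarrow> 0"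
proof -
  have "\<exists>\<zeta>\<in>A. (\<integral>\<omega>. norm (\<eta> \<omega> - \<zeta> \<omega>) \<partial>P) < 1 / Suc n" for n :: nat
    using L1_closureD(3)[OF assms] by simp
  then obtain \<zeta> where \<zeta>: "\<And>n. \<zeta> n \<in> A" "\<And>n::nat. (\<integral>\<omega>. norm (\<eta> \<omega> - \<zeta> n \<omega>) \<partial>P) < 1 / Suc n"
    by metis
  have "(\<lambda>n. \<integral>\<omega>. norm (\<eta> \<omega> - \<zeta> n \<omega>) \<partial>P) \<longlonglongrightarrow> 0"
    by (rule real_tendsto_sandwich[OF _ _ tendsto_const LIMSEQ_inverse_real_of_nat])
      (use \<zeta>(2) in \<open>auto intro!: always_eventually less_imp_le simp: inverse_eq_divide\<close>)
  with \<zeta>(1) show thesis by (rule that)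
qed

lemma L1_closure_limit:
  assumes A: "\<And>\<zeta>. \<zeta> \<in> A \<Longrightarrow> integrable P \<zeta>"
    and \<eta>: "\<eta> \<in> borel_measurable G" "integrable P \<eta>"
    and ex: "\<And>e. 0 < e \<Longrightarrow> \<exists>\<zeta>\<in>L1_closure P G A. (\<integral>\<omega>. norm (\<eta> \<omega> - \<zeta> \<omega>) \<partial>P) < e"
  shows "\<eta> \<in> L1_closure P G A"
proof (rule L1_closureI[OF \<eta>])
  fix e :: real assume "0 < e"
  then obtain \<zeta> where \<zeta>: "\<zeta> \<in> L1_closure P G A" "(\<integral>\<omega>. norm (\<eta> \<omega> - \<zeta> \<omega>) \<partial>P) < e / 2"
    using ex[of "e / 2"] by auto
  then obtain \<theta> where \<theta>: "\<theta> \<in> A" "(\<integral>\<omega>. norm (\<zeta> \<omega> - \<theta> \<omega>) \<partial>P) < e / 2"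
    using L1_closureD(3)[OF \<zeta>(1), of "e / 2"] \<open>0 < e\<close> by auto
  have "(\<integral>\<omega>. norm (\<eta> \<omega> - \<theta> \<omega>) \<partial>P) < e"
    using integral_norm_triangle[OF \<eta>(2) L1_closureD(2)[OF \<zeta>(1)] A[OF \<theta>(1)]] \<zeta>(2) \<theta>(2) by linarith
  then show "\<exists>\<theta>\<in>A. (\<integral>\<omega>. norm (\<eta> \<omega> - \<theta> \<omega>) \<partial>P) < e" using \<theta>(1) by auto
qed

lemma integrable_If:
  fixes \<xi> \<eta> :: "'a \<Rightarrow> 'b::euclidean_space"
  assumes "integrable P \<xi>" "integrable P \<eta>" "B \<in> sets P"
  shows "integrable P (\<lambda>\<omega>. if \<omega> \<in> B then \<xi> \<omega> else \<eta> \<omega>)"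
proof -
  have "integrable P (\<lambda>\<omega>. indicator B \<omega> *\<^sub>R (\<xi> \<omega> - \<eta> \<omega>) + \<eta> \<omega>)"
    using assms by (intro Bochner_Integration.integrable_add integrable_mult_indicator Bochner_Integration.integrable_diff)
  moreover have "(\<lambda>\<omega>. indicator B \<omega> *\<^sub>R (\<xi> \<omega> - \<eta> \<omega>) + \<eta> \<omega>) = (\<lambda>\<omega>. if \<omega> \<in> B then \<xi> \<omega> else \<eta> \<omega>)"
    by (auto simp: fun_eq_iff)
  ultimately show ?thesis by simp
qed

text \<open>The approximating selections are spliced along \<open>B\<close> before conditioning. As
  \<open>B\<close> belongs to \<open>F\<close>, conditioning respects the splice, and its L1-error
  is at most the sum of the two errors.\<close>

lemma (in sigma_finite_subalgebra) L1_closure_cond_exp_decomposable: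
  fixes X :: "'a \<Rightarrow> 'b::euclidean_space set"
  defines "H \<equiv> L1_closure M F (vec_cond_exp M F ` selections M M X)"
  assumes "\<eta> \<in> H" "\<eta>' \<in> H" and B: "B \<in> sets F"
  shows "(\<lambda>\<omega>. if \<omega> \<in> B then \<eta> \<omega> else \<eta>' \<omega>) \<in> H"
  unfolding H_def
proof (rule L1_closureI)
  note \<eta> = L1_closureD[OF assms(2)[unfolded H_def]] and \<eta>' = L1_closureD[OF assms(3)[unfolded H_def]]
  have BM: "B \<in> sets M" using B subalg by (auto simp: subalgebra_def)
  show "(\<lambda>\<omega>. if \<omega> \<in> B then \<eta> \<omega> else \<eta>' \<omega>) \<in> borel_measurable F"
    using \<eta>(1) \<eta>'(1) B by simp
  show i: "integrable M (\<lambda>\<omega>. if \<omega> \<in> B then \<eta> \<omega> else \<eta>' \<omega>)"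
    using \<eta>(2) \<eta>'(2) BM by (rule integrable_If)
  fix e :: real assume "0 < e"
  obtain \<xi> where \<xi>: "\<xi> \<in> selections M M X" "(\<integral>\<omega>. norm (\<eta> \<omega> - vec_cond_exp M F \<xi> \<omega>) \<partial>M) < e / 2"
    using \<eta>(3)[of "e / 2"] \<open>0 < e\<close> by auto
  obtain \<xi>' where \<xi>': "\<xi>' \<in> selections M M X" "(\<integral>\<omega>. norm (\<eta>' \<omega> - vec_cond_exp M F \<xi>' \<omega>) \<partial>M) < e / 2"
    using \<eta>'(3)[of "e / 2"] \<open>0 < e\<close> by auto
  note s = selectionsD[OF \<xi>(1)] and s' = selectionsD[OF \<xi>'(1)]
  let ?\<theta> = "\<lambda>\<omega>. if \<omega> \<in> B then \<xi> \<omega> else \<xi>' \<omega>"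
  have "?\<theta> \<in> selections M M X"
    unfolding selections_def using s s' BM by (auto intro!: integrable_If elim: eventually_elim2)
  moreover have "(\<integral>\<omega>. norm ((if \<omega> \<in> B then \<eta> \<omega> else \<eta>' \<omega>) - vec_cond_exp M F ?\<theta> \<omega>) \<partial>M) < e"
  proof -
    have d: "integrable M (\<lambda>\<omega>. norm (\<eta> \<omega> - vec_cond_exp M F \<xi> \<omega>))"
      "integrable M (\<lambda>\<omega>. norm (\<eta>' \<omega> - vec_cond_exp M F \<xi>' \<omega>))"
      using \<eta>(2) \<eta>'(2) s(2) s'(2) by (auto intro!: integrable_norm_diff vec_cond_exp_integrable)
    have "integrable M ?\<theta>" using s(2) s'(2) BM by (rule integrable_If)
    then have "(\<integral>\<omega>. norm ((if \<omega> \<in> B then \<eta> \<omega> else \<eta>' \<omega>) - vec_cond_exp M F ?\<theta> \<omega>) \<partial>M) \<le>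
      (\<integral>\<omega>. norm (\<eta> \<omega> - vec_cond_exp M F \<xi> \<omega>) + norm (\<eta>' \<omega> - vec_cond_exp M F \<xi>' \<omega>) \<partial>M)"
      using d i s(2) s'(2) \<eta>(2) \<eta>'(2) vec_cond_exp_if[OF s(2) s'(2) B]
      by (intro integral_mono_AE integrable_norm_diff vec_cond_exp_integrable Bochner_Integration.integrable_add)
        (auto elim!: eventually_mono)
    also have "\<dots> < e" using d \<xi>(2) \<xi>'(2) by (simp add: Bochner_Integration.integral_add)
    finally show ?thesis .
  qed
  ultimately show "\<exists>\<zeta>\<in>vec_cond_exp M F ` selections M M X.
      (\<integral>\<omega>. norm ((if \<omega> \<in> B then \<eta> \<omega> else \<eta>' \<omega>) - \<zeta> \<omega>) \<partial>M) < e" by auto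
qed

text \<open>The distance to the closure of a sequence is an infimum of countably many distances. The
  version with a moving point \<zeta> makes the event that \<zeta> stays away from the closure
  measurable.\<close>

lemma closure_range_sv_random_variable:
  fixes \<eta> :: "nat \<Rightarrow> 'a \<Rightarrow> 'b::euclidean_space"
  assumes \<eta>: "\<And>n. \<eta> n \<in> borel_measurable G"
  shows "sv_random_variable G (\<lambda>\<omega>. closure (range (\<lambda>n. \<eta> n \<omega>)))"
    "\<And>\<zeta>. \<zeta> \<in> borel_measurable G \<Longrightarrow> (\<lambda>\<omega>. infdist (\<zeta> \<omega>) (closure (range (\<lambda>n. \<eta> n \<omega>)))) \<in> borel_measurable G"
proof -
  show *: "(\<lambda>\<omega>. infdist (\<zeta> \<omega>) (closure (range (\<lambda>n. \<eta> n \<omega>)))) \<in> borel_measurable G"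
    if "\<zeta> \<in> borel_measurable G" for \<zeta>
  proof -
    have "infdist x (closure A) = infdist x A" if "A \<noteq> {}" for x and A :: "'b set"
      by (simp add: infdist_eq_setdist)
    then have "(\<lambda>\<omega>. infdist (\<zeta> \<omega>) (closure (range (\<lambda>n. \<eta> n \<omega>)))) = (\<lambda>\<omega>. INF n. dist (\<zeta> \<omega>) (\<eta> n \<omega>))"
      by (simp add: infdist_notempty image_image)
    also have "\<dots> \<in> borel_measurable G"
      using \<eta> that by (intro borel_measurable_cINF_real borel_measurable_dist) (auto intro!: bdd_belowI2)
    finally show ?thesis .
  qed
  show "sv_random_variable G (\<lambda>\<omega>. closure (range (\<lambda>n. \<eta> n \<omega>)))"
    by (rule sv_random_variableI_infdist) (auto intro: * simp: closure_eq_empty)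
qed

text \<open>The representation theorem of Hiai and Umegaki: the set \<open>Y\<close> is the closure of countably many
  members \<open>\<eta>\<close> of \<open>H\<close> that almost minimise the \<open>L\<^sup>1\<close>-distance to the constants of a countable dense set.
  A member of \<open>H\<close> leaving \<open>Y\<close> with positive probability could be spliced into one
  of them to beat the minimum.\<close>

lemma (in finite_measure_subalgebra) decomposable_eq_selections:
  fixes H :: "('a \<Rightarrow> 'b::euclidean_space) set"
  assumes meas: "\<And>\<eta>. \<eta> \<in> H \<Longrightarrow> \<eta> \<in> borel_measurable F" and int: "\<And>\<eta>. \<eta> \<in> H \<Longrightarrow> integrable M \<eta>"
    and ne: "H \<noteq> {}"
    and closed: "\<And>\<eta>. \<eta> \<in> borel_measurable F \<Longrightarrow> integrable M \<eta> \<Longrightarrow>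
      (\<And>e. 0 < e \<Longrightarrow> \<exists>\<zeta>\<in>H. (\<integral>\<omega>. norm (\<eta> \<omega> - \<zeta> \<omega>) \<partial>M) < e) \<Longrightarrow> \<eta> \<in> H"
    and dec: "\<And>\<eta> \<zeta> B. \<eta> \<in> H \<Longrightarrow> \<zeta> \<in> H \<Longrightarrow> B \<in> sets F \<Longrightarrow> (\<lambda>\<omega>. if \<omega> \<in> B then \<eta> \<omega> else \<zeta> \<omega>) \<in> H"
  shows "\<exists>Y. sv_random_variable F Y \<and> sv_integrable M Y \<and> selections M F Y = H"
proof -
  have FM: "f \<in> borel_measurable M" if "f \<in> borel_measurable F" for f :: "'a \<Rightarrow> 'b"
    using that by (rule measurable_from_subalg[OF subalg])
  have sub: "space F = space M" "\<And>B. B \<in> sets F \<Longrightarrow> B \<in> sets M" using subalg by (auto simp: subalgebra_def)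
  obtain D :: "'b set" where D: "countable D" "\<And>U. open U \<Longrightarrow> U \<noteq> {} \<Longrightarrow> \<exists>d\<in>D. d \<in> U"
    by (rule countable_dense_setE) blast
  have "D \<noteq> {}" using D(2)[of UNIV] by auto
  define q where "q = from_nat_into D"
  have q: "\<exists>i. dist y (q i) < r" if "0 < r" for y r
    using D(2)[of "ball y r"] that \<open>D \<noteq> {}\<close> D(1) unfolding q_def
    by (metis ball_eq_empty centre_in_ball empty_iff from_nat_into_surj mem_ball open_ball)
  define \<alpha> where "\<alpha> i = (INF \<eta>\<in>H. \<integral>\<omega>. norm (\<eta> \<omega> - q i) \<partial>M)" for i
  have bdd: "bdd_below ((\<lambda>\<eta>. \<integral>\<omega>. norm (\<eta> \<omega> - q i) \<partial>M) ` H)" for i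
    by (rule bdd_belowI2[where m=0]) simp
  have "\<exists>\<eta>\<in>H. (\<integral>\<omega>. norm (\<eta> \<omega> - q i) \<partial>M) < \<alpha> i + 1 / Suc j" for i j :: nat
    using cINF_less_iff[OF ne bdd, of i "\<alpha> i + 1 / Suc j"] by (auto simp: \<alpha>_def)
  then obtain h where h: "\<And>i j. h i j \<in> H"
    "\<And>i j :: nat. (\<integral>\<omega>. norm (h i j \<omega> - q i) \<partial>M) < \<alpha> i + 1 / Suc j"
    by metis
  define \<eta> where "\<eta> k = case_prod h (prod_decode k)" for k
  have \<eta>H: "\<eta> k \<in> H" for k using h(1) by (simp add: \<eta>_def split: prod.split)
  have h\<eta>: "h i j = \<eta> (prod_encode (i, j))" for i j by (simp add: \<eta>_def)
  define Y where "Y \<omega> = closure (range (\<lambda>k. \<eta> k \<omega>))" for \<omega>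
  have Y: "sv_random_variable F Y"
    "\<And>\<zeta>. \<zeta> \<in> borel_measurable F \<Longrightarrow> (\<lambda>\<omega>. infdist (\<zeta> \<omega>) (Y \<omega>)) \<in> borel_measurable F"
    unfolding Y_def[abs_def] using closure_range_sv_random_variable[OF meas[OF \<eta>H]] by auto
  have \<eta>Y: "\<eta> k \<omega> \<in> Y \<omega>" for k \<omega>
    unfolding Y_def by (rule subsetD[OF closure_subset]) simp
  have "sv_integrable M Y"
    unfolding sv_integrable_def selections_def
    using FM[OF meas[OF \<eta>H[of 0]]] int[OF \<eta>H[of 0]] \<eta>Y by blast
  \<comment> \<open>At almost every point some \<eta> k is within \<open>d\<close> of a given
    selection. Finite splices of the \<eta> k therefore approximate it up to \<open>d\<close>, apart
    from an excess that vanishes by dominated convergence.\<close>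
  moreover have "\<zeta> \<in> H" if \<zeta>: "\<zeta> \<in> selections M F Y" for \<zeta>
  proof (rule closed[OF selectionsD(1,2)[OF \<zeta>]])
    fix e :: real assume "0 < e"
    define c where "c = measure M (space M) + 1"
    have "0 < c" unfolding c_def by (intro add_nonneg_pos) auto
    \<comment> \<open>With \<open>c\<close> one more than the total mass, hence positive, an error
      of \<open>d\<close> everywhere costs at most e/2 in L1.\<close>
    define d where "d = e / (2 * c)"
    have "0 < d" using \<open>0 < e\<close> \<open>0 < c\<close> by (simp add: d_def)
    \<comment> \<open>At each point stage N keeps the last of \<eta> 0, ..., \<eta> (N-1) within
      \<open>d\<close> of \<zeta>. The default \<eta> 0 supplies the integrable majorant in
      \<open>far\<close>.\<close>
    define \<theta> where "\<theta> = rec_nat (\<eta> 0) (\<lambda>N f \<omega>. if \<omega> \<in> {\<omega>\<in>space M. norm (\<zeta> \<omega> - \<eta> N \<omega>) < d} then \<eta> N \<omega> else f \<omega>)"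
    have [measurable]: "\<zeta> \<in> borel_measurable F" "\<And>k. \<eta> k \<in> borel_measurable F"
      using selectionsD(1)[OF \<zeta>] meas[OF \<eta>H] by auto
    have B: "{\<omega>\<in>space M. norm (\<zeta> \<omega> - \<eta> N \<omega>) < d} \<in> sets F" for N
      unfolding sub(1)[symmetric] by measurable
    have \<theta>H: "\<theta> N \<in> H" for N
      by (induction N) (auto simp: \<theta>_def \<eta>H intro!: dec[OF _ _ B, simplified])
    have near: "norm (\<zeta> \<omega> - \<theta> N \<omega>) < d" if "k < N" "norm (\<zeta> \<omega> - \<eta> k \<omega>) < d" "\<omega> \<in> space M" for k N \<omega>
      using that by (induction N) (auto simp: \<theta>_def less_Suc_eq)
    have far: "norm (\<zeta> \<omega> - \<theta> N \<omega>) \<le> d + norm (\<zeta> \<omega> - \<eta> 0 \<omega>)" if "\<omega> \<in> space M" for N \<omega>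
      using that \<open>0 < d\<close> by (induction N) (auto simp: \<theta>_def intro: order_trans[OF less_imp_le])
    have ip: "integrable M (\<lambda>\<omega>. max 0 (norm (\<zeta> \<omega> - \<theta> N \<omega>) - d))" for N
      using integrable_norm_diff[OF selectionsD(2)[OF \<zeta>] int[OF \<theta>H]] by simp
    have "(\<lambda>N. \<integral>\<omega>. max 0 (norm (\<zeta> \<omega> - \<theta> N \<omega>) - d) \<partial>M) \<longlonglongrightarrow> (\<integral>\<omega>. 0 \<partial>M)"
    proof (rule integral_dominated_convergence[where w="\<lambda>\<omega>. norm (\<zeta> \<omega> - \<eta> 0 \<omega>)"])
      show "AE \<omega> in M. (\<lambda>N. max 0 (norm (\<zeta> \<omega> - \<theta> N \<omega>) - d)) \<longlonglongrightarrow> 0"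
        using selectionsD(3)[OF \<zeta>] AE_space
      proof eventually_elim
        case (elim \<omega>)
        then obtain k where "norm (\<zeta> \<omega> - \<eta> k \<omega>) < d"
          using closure_approachableD[of "\<zeta> \<omega>" "range (\<lambda>k. \<eta> k \<omega>)", OF _ \<open>0 < d\<close>]
          by (auto simp: Y_def dist_norm)
        then have "max 0 (norm (\<zeta> \<omega> - \<theta> N \<omega>) - d) = 0" if "Suc k \<le> N" for N
          using near[of k N \<omega>] elim(2) that by simp
        then show ?case
          by (intro tendsto_eventually eventually_sequentiallyI[of "Suc k"])
      qed
      show "AE \<omega> in M. norm (max 0 (norm (\<zeta> \<omega> - \<theta> N \<omega>) - d)) \<le> norm (\<zeta> \<omega> - \<eta> 0 \<omega>)" for N
      proof (rule AE_I2)
        fix \<omega> assume "\<omega> \<in> space M"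
        then show "norm (max 0 (norm (\<zeta> \<omega> - \<theta> N \<omega>) - d)) \<le> norm (\<zeta> \<omega> - \<eta> 0 \<omega>)"
          using far[of \<omega> N] by simp
      qed
      show "integrable M (\<lambda>\<omega>. norm (\<zeta> \<omega> - \<eta> 0 \<omega>))"
        by (intro integrable_norm_diff selectionsD(2)[OF \<zeta>] int[OF \<eta>H])
    qed (use ip in auto)
    then have "\<forall>\<^sub>F N in sequentially. (\<integral>\<omega>. max 0 (norm (\<zeta> \<omega> - \<theta> N \<omega>) - d) \<partial>M) < e / 2"
      using \<open>0 < e\<close> by (intro order_tendstoD(2)) auto
    then obtain N where N: "(\<integral>\<omega>. max 0 (norm (\<zeta> \<omega> - \<theta> N \<omega>) - d) \<partial>M) < e / 2"
      by (auto simp: eventually_sequentially)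
    have "(\<integral>\<omega>. norm (\<zeta> \<omega> - \<theta> N \<omega>) \<partial>M) \<le> (\<integral>\<omega>. max 0 (norm (\<zeta> \<omega> - \<theta> N \<omega>) - d) + d \<partial>M)"
      using ip by (intro integral_mono integrable_norm_diff selectionsD(2)[OF \<zeta>] int[OF \<theta>H]
          Bochner_Integration.integrable_add integrable_const) auto
    also have "\<dots> = (\<integral>\<omega>. max 0 (norm (\<zeta> \<omega> - \<theta> N \<omega>) - d) \<partial>M) + d * measure M (space M)"
      using ip by simp
    finally have "(\<integral>\<omega>. norm (\<zeta> \<omega> - \<theta> N \<omega>) \<partial>M) \<le> \<dots>" .
    moreover have "d * measure M (space M) \<le> d * c"
      using \<open>0 < d\<close> by (simp add: c_def)
    moreover have "d * c = e / 2" using \<open>0 < c\<close> by (simp add: d_def)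
    ultimately show "\<exists>\<theta>\<in>H. (\<integral>\<omega>. norm (\<zeta> \<omega> - \<theta> \<omega>) \<partial>M) < e"
      using N \<theta>H by (intro bexI[of _ "\<theta> N"]) linarith+
  qed
  moreover have "\<zeta> \<in> selections M F Y" if \<zeta>: "\<zeta> \<in> H" for \<zeta>
  proof -
    have [measurable]: "\<zeta> \<in> borel_measurable F" "\<And>k. \<eta> k \<in> borel_measurable F" "\<And>i j. h i j \<in> borel_measurable F"
      using meas[OF \<zeta>] meas[OF \<eta>H] meas[OF h(1)] by auto
    note [measurable] = Y(2)[OF meas[OF \<zeta>]]
    \<comment> \<open>On \<open>B i n\<close> every h i j lies in Y, hence at distance at least
      3/(n+1) from \<zeta> and more than 2/(n+1) from q i, while \<zeta> is within 1/(n+1) of q i.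
      Putting \<zeta> there gains at least 1/(n+1) pointwise, but h i j is within 1/(j+1) of the
      infimum; letting j grow makes \<open>B i n\<close> null.\<close>
    define B where "B i n = {\<omega>\<in>space F. norm (\<zeta> \<omega> - q i) < 1 / Suc n \<and> 3 / Suc n \<le> infdist (\<zeta> \<omega>) (Y \<omega>)}" for i n :: nat
    have B[measurable]: "B i n \<in> sets F" for i n unfolding B_def by measurable
    have "B i n \<in> null_sets M" for i n
    proof -
      have le: "1 / Suc n * measure M (B i n) \<le> 1 / Suc j" for j :: nat
      proof -
        let ?\<theta> = "\<lambda>\<omega>. if \<omega> \<in> B i n then \<zeta> \<omega> else h i j \<omega>"
        have \<theta>: "?\<theta> \<in> H" using \<zeta> h(1) B by (rule dec)
        have int': "integrable M (\<lambda>\<omega>. norm (f \<omega> - q i))" if "f \<in> H" for f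
          using int[OF that] by (intro integrable_norm_diff) auto
        have BM: "B i n \<in> sets M" using sub(2)[OF B] .
        have bi: "integrable M (\<lambda>\<omega>. indicator (B i n) \<omega> * (1 / Suc n) :: real)"
          using BM by (intro integrable_mult_left integrable_real_indicator) (auto simp: emeasure_finite less_top[symmetric])
        have "(\<integral>\<omega>. indicator (B i n) \<omega> * (1 / Suc n) \<partial>M) \<le> (\<integral>\<omega>. norm (h i j \<omega> - q i) - norm (?\<theta> \<omega> - q i) \<partial>M)"
        proof (rule integral_mono[OF bi])
          show "integrable M (\<lambda>\<omega>. norm (h i j \<omega> - q i) - norm (?\<theta> \<omega> - q i))"
            using int'[OF h(1)] int'[OF \<theta>] by (rule Bochner_Integration.integrable_diff)
          fix \<omega> assume "\<omega> \<in> space M"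
          show "indicator (B i n) \<omega> * (1 / Suc n) \<le> norm (h i j \<omega> - q i) - norm (?\<theta> \<omega> - q i)"
          proof (cases "\<omega> \<in> B i n")
            case True
            have "infdist (\<zeta> \<omega>) (Y \<omega>) \<le> dist (\<zeta> \<omega>) (h i j \<omega>)"
              unfolding h\<eta> by (rule infdist_le[OF \<eta>Y])
            also have "\<dots> \<le> norm (\<zeta> \<omega> - q i) + norm (h i j \<omega> - q i)"
              by (metis dist_norm dist_triangle2)
            finally have "3 / Suc n - norm (\<zeta> \<omega> - q i) \<le> norm (h i j \<omega> - q i)"
              using True by (auto simp: B_def)
            moreover have "norm (\<zeta> \<omega> - q i) < 1 / Suc n" using True by (auto simp: B_def)
            ultimately have "1 / Suc n \<le> norm (h i j \<omega> - q i) - norm (\<zeta> \<omega> - q i)"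
              by (simp add: field_simps)
            then show ?thesis using True by simp
          qed simp
        qed
        also have "\<dots> = (\<integral>\<omega>. norm (h i j \<omega> - q i) \<partial>M) - (\<integral>\<omega>. norm (?\<theta> \<omega> - q i) \<partial>M)"
          using int'[OF h(1)] int'[OF \<theta>] by (rule Bochner_Integration.integral_diff)
        also have "\<dots> \<le> 1 / Suc j"
          using h(2)[of i j] cINF_lower[OF bdd[of i] \<theta>] by (simp add: \<alpha>_def)
        finally show ?thesis using BM by simp
      qed
      have "1 / Suc n * measure M (B i n) \<le> 0"
        by (rule LIMSEQ_le_const[OF LIMSEQ_inverse_real_of_nat]) (use le in \<open>auto simp: inverse_eq_divide\<close>)
      then have "measure M (B i n) = 0"
        using measure_nonneg[of M "B i n"] by (simp add: divide_simps mult_le_0_iff)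
      then show ?thesis using sub(2)[OF B] by (simp add: emeasure_eq_measure null_setsI)
    qed
    then have "AE \<omega> in M. \<forall>i n. \<omega> \<notin> B i n"
      by (auto simp: AE_all_countable intro: AE_not_in)
    then have "AE \<omega> in M. \<zeta> \<omega> \<in> Y \<omega>"
      using AE_space
    proof eventually_elim
      case (elim \<omega>)
      show ?case
      proof (rule ccontr)
        assume "\<zeta> \<omega> \<notin> Y \<omega>"
        then have "0 < infdist (\<zeta> \<omega>) (Y \<omega>)"
          by (intro infdist_pos_not_in_closed) (auto simp: Y_def closure_eq_empty)
        then obtain n :: nat where n: "1 / Suc n < infdist (\<zeta> \<omega>) (Y \<omega>) / 3"
          using nat_approx_posE[of "infdist (\<zeta> \<omega>) (Y \<omega>) / 3"] by auto
        obtain i where "dist (\<zeta> \<omega>) (q i) < 1 / Suc n" using q[of "1 / Suc n" "\<zeta> \<omega>"] by auto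
        then have "\<omega> \<in> B i n" using n elim(2) by (auto simp: B_def dist_norm sub(1))
        then show False using elim(1) by auto
      qed
    qed
    then show ?thesis using meas[OF \<zeta>] int[OF \<zeta>] by (simp add: selections_def)
  qed
  ultimately show ?thesis using Y(1) by blast
qed

text \<open>The L1-closure of the conditioned selections is nonempty, closed and decomposable, hence
  the set of selections of a random set. This provides the version demanded in the submartingale
  property of the right limits.\<close>

lemma (in finite_measure_subalgebra) sv_cond_exp_exists:
  fixes X :: "'a \<Rightarrow> 'b::euclidean_space set"
  assumes "sv_integrable M X"
  shows "\<exists>Y. has_sv_cond_exp M F X Y"
proof -
  let ?A = "vec_cond_exp M F ` selections M M X"
  have A: "integrable M \<zeta>" if "\<zeta> \<in> ?A" for \<zeta>
    using that by (auto simp: selections_def intro: vec_cond_exp_integrable)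
  obtain \<xi> where "\<xi> \<in> selections M M X" using assms by (auto simp: sv_integrable_def)
  then have ne: "vec_cond_exp M F \<xi> \<in> L1_closure M F ?A"
    using A by (intro L1_closureI) (auto intro!: bexI[of _ \<xi>])
  have "\<exists>Y. sv_random_variable F Y \<and> sv_integrable M Y \<and> selections M F Y = L1_closure M F ?A"
  proof (rule decomposable_eq_selections)
    show "L1_closure M F ?A \<noteq> {}" using ne by blast
    show "\<eta> \<in> L1_closure M F ?A" if "\<eta> \<in> borel_measurable F" "integrable M \<eta>"
      "\<And>e. 0 < e \<Longrightarrow> \<exists>\<zeta>\<in>L1_closure M F ?A. (\<integral>\<omega>. norm (\<eta> \<omega> - \<zeta> \<omega>) \<partial>M) < e" for \<eta>
      using A that by (rule L1_closure_limit)
  qed (auto dest: L1_closureD intro: L1_closure_cond_exp_decomposable)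
  then show ?thesis by (auto simp: has_sv_cond_exp_def)
qed

section \<open>Selections of compact convex random sets\<close>

text \<open>Integrability comes from the bound by the radius, whatever the size of
  \<open>f\<close>.\<close>

lemma closest_point_selection:
  assumes "subalgebra P G" "compact_convex_rv G X" "integrable P (\<lambda>\<omega>. radius (X \<omega>))" "f \<in> borel_measurable G"
  shows "(\<lambda>\<omega>. closest_point (X \<omega>) (f \<omega>)) \<in> selections P G X"
proof -
  have "(\<lambda>\<omega>. closest_point (X \<omega>) (f \<omega>)) \<in> borel_measurable G"
    using assms by (intro closest_point_measurable)
  moreover have "(\<lambda>\<omega>. closest_point (X \<omega>) (f \<omega>)) \<in> borel_measurable P"
    using assms(1) calculation by (rule measurable_from_subalg)
  ultimately show ?thesis
    using closest_point_mem[OF assms(2)] compact_convex_rvD(1)[OF assms(2)] assms(3)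
    by (auto simp: selections_def intro!: integrable_selection[of X])
qed

text \<open>The projections of a countable dense set of points are dense in the value of
  \<open>X\<close>, since projecting is nonexpansive and fixes the points of the set. Countably many
  selections thus decide the inclusion, with a single exceptional null set.\<close>

lemma subset_if_selections:
  assumes "subalgebra P G" and X: "compact_convex_rv G X" "integrable P (\<lambda>\<omega>. radius (X \<omega>))"
    and sel: "\<And>\<xi>. \<xi> \<in> selections P G X \<Longrightarrow> AE \<omega> in P. \<xi> \<omega> \<in> Y \<omega>"
    and Y: "AE \<omega> in P. closed (Y \<omega>)"
  shows "AE \<omega> in P. X \<omega> \<subseteq> Y \<omega>"
proof -
  obtain D :: "'b set" where D: "countable D" "\<And>U. open U \<Longrightarrow> U \<noteq> {} \<Longrightarrow> \<exists>d\<in>D. d \<in> U"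
    by (rule countable_dense_setE) blast
  have "AE \<omega> in P. \<forall>q\<in>D. closest_point (X \<omega>) q \<in> Y \<omega>"
    using D(1) by (intro AE_ball_countable' sel closest_point_selection[OF assms(1) X]) auto
  then show ?thesis using Y
  proof eventually_elim
    case (elim \<omega>)
    note c = compact_convex_rvD[OF X(1), of \<omega>]
    show ?case
    proof
      fix x assume x: "x \<in> X \<omega>"
      have "x \<in> closure (Y \<omega>)"
        unfolding closure_approachable
      proof (intro allI impI)
        fix e :: real assume "0 < e"
        then obtain q where q: "q \<in> D" "dist x q < e"
          using D(2)[of "ball x e"] by auto
        have "dist (closest_point (X \<omega>) x) (closest_point (X \<omega>) q) \<le> dist x q"
          using c by (intro closest_point_lipschitz)
        then have "dist (closest_point (X \<omega>) q) x < e"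
          using q(2) closest_point_self[OF x] by (simp add: dist_commute)
        then show "\<exists>y\<in>Y \<omega>. dist y x < e" using elim(1) q(1) by blast
      qed
      then show "x \<in> Y \<omega>" using elim(2) by (simp add: closure_closed)
    qed
  qed
qed

text \<open>A subsequence converges almost everywhere, and the values of \<open>Y\<close> are
  closed.\<close>

lemma L1_limit_mem:
  fixes \<eta> :: "'a \<Rightarrow> 'b::euclidean_space"
  assumes "integrable P \<eta>" "\<And>n. integrable P (\<zeta> n)" "(\<lambda>n. \<integral>\<omega>. norm (\<eta> \<omega> - \<zeta> n \<omega>) \<partial>P) \<longlonglongrightarrow> 0"
    and mem: "\<And>n. AE \<omega> in P. \<zeta> n \<omega> \<in> Y \<omega>" and Y: "AE \<omega> in P. closed (Y \<omega>)"
  shows "AE \<omega> in P. \<eta> \<omega> \<in> Y \<omega>"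
proof -
  obtain r where r: "strict_mono r" "AE \<omega> in P. (\<lambda>n. \<eta> \<omega> - \<zeta> (r n) \<omega>) \<longlonglongrightarrow> 0"
    using tendsto_L1_AE_subseq[of P "\<lambda>n \<omega>. \<eta> \<omega> - \<zeta> n \<omega>"] assms(1-3) by auto
  have "AE \<omega> in P. \<forall>n. \<zeta> n \<omega> \<in> Y \<omega>" using mem by (simp add: AE_all_countable)
  with r(2) Y show ?thesis
  proof eventually_elim
    case (elim \<omega>)
    have "(\<lambda>n. \<eta> \<omega> - (\<eta> \<omega> - \<zeta> (r n) \<omega>)) \<longlonglongrightarrow> \<eta> \<omega> - 0"
      by (intro tendsto_diff tendsto_const elim)
    then have "(\<lambda>n. \<zeta> (r n) \<omega>) \<longlonglongrightarrow> \<eta> \<omega>" by simp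
    then show ?case
      by (rule closed_sequentially[OF elim(2) _, rotated]) (use elim(3) in blast)
  qed
qed

text \<open>Closest points to \<open>n x\<close> are measurable near-maximisers of the functional \<open>x\<close>; no measurable choice of a
  maximiser is needed.\<close>

lemma supp_le_inner_closest_point:
  assumes "compact A" "convex A" "A \<noteq> {}" "0 < n"
  shows "supp x A \<le> x \<bullet> closest_point A (n *\<^sub>R x) + (radius A)\<^sup>2 / (2 * n)"
proof -
  obtain y where y: "y \<in> A" "supp x A = x \<bullet> y" using supp_attained assms by blast
  let ?p = "closest_point A (n *\<^sub>R x)"
  have "dist (n *\<^sub>R x) ?p \<le> dist (n *\<^sub>R x) y"
    using assms y by (intro closest_point_le compact_imp_closed)
  then have "(norm (n *\<^sub>R x - ?p))\<^sup>2 \<le> (norm (n *\<^sub>R x - y))\<^sup>2"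
    unfolding dist_norm by (rule power_mono) simp
  \<comment> \<open>The squares of n x cancel; dividing by 2n later produces the error term.\<close>
  then have "2 * n * (x \<bullet> y) \<le> 2 * n * (x \<bullet> ?p) + (norm y)\<^sup>2 - (norm ?p)\<^sup>2"
    by (simp add: power2_norm_eq_inner inner_diff_left inner_diff_right inner_commute algebra_simps)
  also have "\<dots> \<le> 2 * n * (x \<bullet> ?p) + (radius A)\<^sup>2"
    using power_mono[OF radius_upper[OF assms(1) y(1)] norm_ge_zero, of 2] zero_le_power2[of "norm ?p"] by linarith
  finally show ?thesis using y(2) assms(4) by (simp add: field_simps)
qed

lemma integral_inner_closest_point_tendsto:
  assumes X: "compact_convex_rv P X" "integrable P (\<lambda>\<omega>. radius (X \<omega>))"
  shows "(\<lambda>n. \<integral>\<omega>. x \<bullet> closest_point (X \<omega>) (real n *\<^sub>R x) \<partial>P) \<longlonglongrightarrow> (\<integral>\<omega>. supp x (X \<omega>) \<partial>P)"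
proof -
  note c = compact_convex_rvD[OF X(1)]
  define p where "p n \<omega> = closest_point (X \<omega>) (real n *\<^sub>R x)" for n :: nat and \<omega>
  have "(\<lambda>n. \<integral>\<omega>. x \<bullet> p n \<omega> \<partial>P) \<longlonglongrightarrow> (\<integral>\<omega>. supp x (X \<omega>) \<partial>P)"
  proof (rule integral_dominated_convergence[where w="\<lambda>\<omega>. norm x * radius (X \<omega>)"])
    show "AE \<omega> in P. (\<lambda>n. x \<bullet> p n \<omega>) \<longlonglongrightarrow> supp x (X \<omega>)"
    proof (rule AE_I2, rule real_tendsto_sandwich[OF _ _ _ tendsto_const])
      fix \<omega>
      have "(\<lambda>n. supp x (X \<omega>) - ((radius (X \<omega>))\<^sup>2 / 2) * (1 / real n)) \<longlonglongrightarrow> supp x (X \<omega>) - ((radius (X \<omega>))\<^sup>2 / 2) * 0"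
        by (intro tendsto_intros lim_1_over_n)
      then show "(\<lambda>n. supp x (X \<omega>) - ((radius (X \<omega>))\<^sup>2 / 2) * (1 / real n)) \<longlonglongrightarrow> supp x (X \<omega>)" by simp
      show "\<forall>\<^sub>F n in sequentially. supp x (X \<omega>) - ((radius (X \<omega>))\<^sup>2 / 2) * (1 / real n) \<le> x \<bullet> p n \<omega>"
        using eventually_gt_at_top[of 0]
      proof eventually_elim
        case (elim n)
        then show ?case
          using supp_le_inner_closest_point[OF c(1-3), of "real n" x \<omega>] by (simp add: p_def)
      qed
      show "\<forall>\<^sub>F n in sequentially. x \<bullet> p n \<omega> \<le> supp x (X \<omega>)"
        unfolding p_def by (intro always_eventually allI supp_upper c closest_point_mem[OF X(1)])
    qed
    show "AE \<omega> in P. norm (x \<bullet> p n \<omega>) \<le> norm x * radius (X \<omega>)" for n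
    proof (rule AE_I2)
      fix \<omega>
      have "norm (x \<bullet> p n \<omega>) \<le> norm x * norm (p n \<omega>)" by (simp add: Cauchy_Schwarz_ineq2)
      also have "\<dots> \<le> norm x * radius (X \<omega>)"
        unfolding p_def by (intro mult_left_mono radius_upper c closest_point_mem[OF X(1)]) simp
      finally show "norm (x \<bullet> p n \<omega>) \<le> norm x * radius (X \<omega>)" .
    qed
    show "(\<lambda>\<omega>. supp x (X \<omega>)) \<in> borel_measurable P" by (rule supp_measurable[OF X(1)])
    show "(\<lambda>\<omega>. x \<bullet> p n \<omega>) \<in> borel_measurable P" for n
      unfolding p_def using closest_point_measurable_const[OF X(1)] by simp
  qed (use X(2) in simp)
  then show ?thesis by (simp add: p_def)
qed

text \<open>The upper bound holds on a closed half-space and hence survives the closure in the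
  expectation; the lower bound comes from the closest points to n x, which are selections.\<close>

lemma supp_sv_expectation:
  assumes X: "compact_convex_rv P X" "integrable P (\<lambda>\<omega>. radius (X \<omega>))"
  shows "support_fun x (sv_expectation P X) = ereal (\<integral>\<omega>. supp x (X \<omega>) \<partial>P)"
proof -
  note c = compact_convex_rvD[OF X(1)]
  have sub: "subalgebra P P" by (simp add: subalgebra_def)
  let ?I = "\<integral>\<omega>. supp x (X \<omega>) \<partial>P"
  have le: "x \<bullet> integral\<^sup>L P \<xi> \<le> ?I" if "\<xi> \<in> selections P P X" for \<xi>
  proof -
    note s = selectionsD[OF that]
    have "(\<integral>\<omega>. x \<bullet> \<xi> \<omega> \<partial>P) \<le> ?I"
      using s integrable_supp[OF X] by (intro integral_mono_AE) (auto elim!: eventually_mono intro: supp_upper c)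
    then show ?thesis using s by simp
  qed
  define p where "p n \<omega> = closest_point (X \<omega>) (real n *\<^sub>R x)" for n :: nat and \<omega>
  have p: "p n \<in> selections P P X" for n
    unfolding p_def[abs_def] by (rule closest_point_selection[OF sub X]) simp
  have "(\<lambda>n. \<integral>\<omega>. x \<bullet> p n \<omega> \<partial>P) \<longlonglongrightarrow> ?I"
    unfolding p_def by (rule integral_inner_closest_point_tendsto[OF X])
  then have lim: "(\<lambda>n. ereal (x \<bullet> integral\<^sup>L P (p n))) \<longlonglongrightarrow> ereal ?I"
    using selectionsD(2)[OF p] by simp
  let ?S = "integral\<^sup>L P ` selections P P X"
  have up: "closure ?S \<subseteq> {y. x \<bullet> y \<le> ?I}"
    by (rule closure_minimal) (use le in \<open>auto intro: closed_halfspace_le\<close>)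
  show ?thesis
    unfolding sv_expectation_def support_fun_def
  proof (rule antisym)
    show "(SUP y\<in>closure ?S. ereal (x \<bullet> y)) \<le> ereal ?I"
      using up by (intro SUP_least) auto
    show "ereal ?I \<le> (SUP y\<in>closure ?S. ereal (x \<bullet> y))"
    proof (rule LIMSEQ_le_const2[OF lim], intro exI allI impI SUP_upper)
      fix n show "integral\<^sup>L P (p n) \<in> closure ?S"
        using p by (intro subsetD[OF closure_subset]) auto
    qed
  qed
qed

lemma selections_cong_AE:
  assumes "AE \<omega> in P. X \<omega> = Y \<omega>"
  shows "selections P G X = selections P G Y"
proof -
  have "(AE \<omega> in P. \<xi> \<omega> \<in> X \<omega>) \<longleftrightarrow> (AE \<omega> in P. \<xi> \<omega> \<in> Y \<omega>)" for \<xi>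
    using assms by (intro eventually_cong) (auto elim: eventually_mono)
  then show ?thesis by (simp add: selections_def)
qed

lemma sv_expectation_cong_AE:
  "AE \<omega> in P. X \<omega> = Y \<omega> \<Longrightarrow> sv_expectation P X = sv_expectation P Y"
  unfolding sv_expectation_def by (simp add: selections_cong_AE)

lemma selections_mono: "subalgebra P G \<Longrightarrow> selections P G X \<subseteq> selections P P X"
  by (auto simp: selections_def intro: measurable_from_subalg)

section \<open>Right limits of a set-valued submartingale\<close>

text \<open>The bound t + 1 lets the single random set at time t + 1 dominate the whole
  sequence.\<close>

definition rational_approx :: "real \<Rightarrow> (nat \<Rightarrow> real) \<Rightarrow> bool" where
  "rational_approx t r \<longleftrightarrow> (\<forall>n. r n \<in> \<rat> \<and> t < r n \<and> r n \<le> t + 1) \<and> r \<longlonglongrightarrow> t"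

text \<open>The bounds \<open>b\<close> serve to keep the sequence below a fixed later time, or
  termwise below another sequence.\<close>

lemma rational_approx_exists:
  assumes "\<And>n. t < b n"
  obtains r where "rational_approx t r" "\<And>n. r n < b n"
proof -
  have "\<exists>x\<in>\<rat>. t < x \<and> x < min (b n) (t + 1 / Suc n)" for n
    using Rats_dense_in_real[of t "min (b n) (t + 1 / Suc n)"] assms[of n] by auto
  then obtain r where r: "\<And>n. r n \<in> \<rat>" "\<And>n. t < r n" "\<And>n. r n < min (b n) (t + 1 / Suc n)"
    by metis
  have "r n \<le> t + 1" for n
  proof -
    have "1 / real (Suc n) \<le> 1" by simp
    then show ?thesis using r(3)[of n] by linarith
  qed
  moreover have "r \<longlonglongrightarrow> t"
  proof (rule real_tendsto_sandwich[where f="\<lambda>_. t" and h="\<lambda>n. t + 1 / Suc n"])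
    show "(\<lambda>n. t + 1 / real (Suc n)) \<longlonglongrightarrow> t"
      using tendsto_add[OF tendsto_const LIMSEQ_inverse_real_of_nat, of t] by (simp add: inverse_eq_divide)
  qed (use r in \<open>auto intro!: always_eventually less_imp_le\<close>)
  ultimately have "rational_approx t r" using r by (simp add: rational_approx_def)
  then show thesis using r(3) that by simp
qed

lemma rational_approxD:
  assumes "rational_approx t r"
  shows "r n \<in> \<rat>" "t < r n" "r n \<le> t + 1" "r \<longlonglongrightarrow> t"
  using assms by (auto simp: rational_approx_def)

lemma rational_approx_filterlim:
  assumes "rational_approx t r"
  shows "filterlim r (rational_right t) sequentially"
  unfolding rational_right_def filterlim_at
  using rational_approxD[OF assms] by (auto intro!: always_eventually simp: less_imp_neq[THEN not_sym])

lemma rational_right_neq_bot: "rational_right t \<noteq> bot"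
proof -
  obtain r where "rational_approx t r"
    by (rule rational_approx_exists[of t "\<lambda>_. t + 1"]) auto
  from rational_approx_filterlim[OF this] show ?thesis
    by (auto simp: filterlim_def filtermap_bot_iff bot_unique)
qed

locale sv_right_limit = prob_space P for P :: "'a measure" +
  fixes F :: "real \<Rightarrow> 'a measure" and M :: "real \<Rightarrow> 'a \<Rightarrow> 'b::euclidean_space set" and \<Omega>' :: "'a set"
  assumes filt: "time_filtration P F" and usual: "usual_conditions P F"
    and submart: "sv_submartingale P F M" and convex_values: "convex_process P M"
    and bounded: "integrably_bounded_process P M" and event: "limit_event P M \<Omega>'"
begin

section \<open>The filtration and the compact convex modification\<close>

lemma subalgebra_F: "0 \<le> t \<Longrightarrow> subalgebra P (F t)"
  using filt by (simp add: time_filtration_def)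

lemma space_F: "0 \<le> t \<Longrightarrow> space (F t) = space P"
  using subalgebra_F by (simp add: subalgebra_def)

lemma sets_F_mono: "0 \<le> s \<Longrightarrow> s \<le> t \<Longrightarrow> sets (F s) \<subseteq> sets (F t)"
  using filt by (simp add: time_filtration_def)

lemma subalgebra_F_mono: "0 \<le> s \<Longrightarrow> s \<le> t \<Longrightarrow> subalgebra (F t) (F s)"
  using sets_F_mono[of s t] space_F[of s] space_F[of t] by (simp add: subalgebra_def)

lemma finite_measure_subalgebra_F: "0 \<le> t \<Longrightarrow> finite_measure_subalgebra P (F t)"
  using subalgebra_F by (simp add: finite_measure_subalgebra_def finite_measure_subalgebra_axioms_def finite_measure_axioms)

lemma sigma_finite_subalgebra_F: "0 \<le> t \<Longrightarrow> sigma_finite_subalgebra P (F t)"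
  using finite_measure_subalgebra_F finite_measure_subalgebra_is_sigma_finite by blast

lemma measurable_F_mono:
  fixes f :: "'a \<Rightarrow> 'c::topological_space"
  shows "f \<in> borel_measurable (F s) \<Longrightarrow> 0 \<le> s \<Longrightarrow> s \<le> t \<Longrightarrow> f \<in> borel_measurable (F t)"
  using measurable_from_subalg[OF subalgebra_F_mono] .

text \<open>The complement is contained in a null set, hence is itself one by completeness of
  \<open>P\<close>, and all null sets belong to \<open>F 0\<close>.\<close>

lemma AE_set_in_F:
  assumes "0 \<le> t" "AE \<omega> in P. Q \<omega>"
  shows "{\<omega>\<in>space P. Q \<omega>} \<in> sets (F t)"
proof -
  have cm: "complete_measure P" and null: "null_sets P \<subseteq> sets (F 0)"
    using usual unfolding usual_conditions_def by blast+
  have "{\<omega>\<in>space P. \<not> Q \<omega>} \<in> sets (F t)"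
    using complete_measure.AE_iff_null_sets[OF cm, of Q] assms null sets_F_mono[of 0 t] by auto
  then have "space (F t) - {\<omega>\<in>space P. \<not> Q \<omega>} \<in> sets (F t)" by (rule sets.compl_sets)
  moreover have "space (F t) - {\<omega>\<in>space P. \<not> Q \<omega>} = {\<omega>\<in>space P. Q \<omega>}"
    using space_F[OF assms(1)] by auto
  ultimately show ?thesis by simp
qed

lemma M_adapted: "0 \<le> t \<Longrightarrow> sv_random_variable (F t) (M t)"
  using submart by (simp add: sv_submartingale_def sv_adapted_def)

lemma M_closed: "0 \<le> t \<Longrightarrow> \<omega> \<in> space P \<Longrightarrow> closed (M t \<omega>) \<and> M t \<omega> \<noteq> {}"
  using M_adapted[of t] space_F[of t] by (simp add: sv_random_variable_def)

text \<open>A finite integral makes the norm of the set finite almost surely, and closed bounded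
  sets are compact.\<close>

lemma M_compact_convex:
  assumes "0 \<le> t"
  shows "AE \<omega> in P. compact (M t \<omega>) \<and> convex (M t \<omega>) \<and> M t \<omega> \<noteq> {}"
proof -
  have "(\<lambda>\<omega>. set_norm (M t \<omega>)) \<in> borel_measurable P"
    using set_norm_measurable[OF M_adapted[OF assms]] by (rule measurable_from_subalg[OF subalgebra_F[OF assms]])
  moreover have "(\<integral>\<^sup>+\<omega>. set_norm (M t \<omega>) \<partial>P) < \<infinity>"
    using bounded assms by (simp add: integrably_bounded_process_def integrably_bounded_def)
  ultimately have "AE \<omega> in P. set_norm (M t \<omega>) \<noteq> \<infinity>"
    by (intro nn_integral_PInf_AE) auto
  moreover have "AE \<omega> in P. convex (M t \<omega>)"
    using convex_values assms by (simp add: convex_process_def)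
  ultimately show ?thesis using AE_space
  proof eventually_elim
    case (elim \<omega>)
    have "norm x \<le> enn2real (set_norm (M t \<omega>))" if "x \<in> M t \<omega>" for x
    proof -
      have "ennreal (norm x) \<le> set_norm (M t \<omega>)"
        unfolding set_norm_def using that by (rule SUP_upper)
      then show ?thesis using elim(1) by (metis enn2real_mono enn2real_ennreal norm_ge_zero infinity_ennreal_def less_top)
    qed
    then have "bounded (M t \<omega>)" by (auto simp: bounded_iff)
    then show ?case using elim M_closed[OF assms] by (auto simp: compact_eq_bounded_closed)
  qed
qed

text \<open>Adaptedness of this modification of \<open>M\<close> needs the completeness of the filtration.\<close>

definition N :: "real \<Rightarrow> 'a \<Rightarrow> 'b set" where
  "N t \<omega> = (if compact (M t \<omega>) \<and> convex (M t \<omega>) \<and> M t \<omega> \<noteq> {} then M t \<omega> else {0})"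

lemma N_eq:
  assumes "0 \<le> t"
  shows "AE \<omega> in P. N t \<omega> = M t \<omega>"
  using M_compact_convex[OF assms] by eventually_elim (simp add: N_def)

lemma N_rv:
  assumes "0 \<le> t"
  shows "compact_convex_rv (F t) (N t)"
proof -
  have cc: "compact (N t \<omega>) \<and> convex (N t \<omega>) \<and> N t \<omega> \<noteq> {}" for \<omega> by (simp add: N_def)
  let ?A = "{\<omega>\<in>space P. compact (M t \<omega>) \<and> convex (M t \<omega>) \<and> M t \<omega> \<noteq> {}}"
  have A: "?A \<in> sets (F t)" by (rule AE_set_in_F[OF assms M_compact_convex[OF assms]])
  have "{\<omega>\<in>space (F t). N t \<omega> \<inter> C \<noteq> {}} \<in> sets (F t)" if "closed C" for C
  proof -
    have "{\<omega>\<in>space (F t). N t \<omega> \<inter> C \<noteq> {}} =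
        ({\<omega>\<in>space (F t). M t \<omega> \<inter> C \<noteq> {}} \<inter> ?A) \<union> (if 0 \<in> C then space (F t) - ?A else {})"
      using space_F[OF assms] by (auto simp: N_def split: if_splits)
    also have "\<dots> \<in> sets (F t)"
      using A sv_random_variable_hits[OF M_adapted[OF assms] that] by auto
    finally show ?thesis .
  qed
  then have "sv_random_variable (F t) (N t)"
    using cc by (simp add: sv_random_variable_def compact_imp_closed)
  then show ?thesis using cc by (simp add: compact_convex_rv_def)
qed

lemma rv_P: "compact_convex_rv (F s) Y \<Longrightarrow> 0 \<le> s \<Longrightarrow> compact_convex_rv P Y"
  using subalgebra_F[of s] by (simp add: compact_convex_rv_mono[of "F s"] subalgebra_def)

lemma N_radius:
  assumes "0 \<le> t"
  shows "integrable P (\<lambda>\<omega>. radius (N t \<omega>))"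
proof (rule integrableI_bounded)
  note c = compact_convex_rvD[OF N_rv[OF assms]]
  show "(\<lambda>\<omega>. radius (N t \<omega>)) \<in> borel_measurable P"
    by (rule radius_measurable[OF rv_P[OF N_rv[OF assms] assms]])
  have "(\<integral>\<^sup>+\<omega>. ennreal (norm (radius (N t \<omega>))) \<partial>P) = (\<integral>\<^sup>+\<omega>. set_norm (M t \<omega>) \<partial>P)"
  proof (rule nn_integral_cong_AE)
    show "AE \<omega> in P. ennreal (norm (radius (N t \<omega>))) = set_norm (M t \<omega>)"
      using N_eq[OF assms]
    proof eventually_elim
      case (elim \<omega>)
      then show ?case
        using set_norm_eq_radius[OF c(1,3), of \<omega>] radius_nonneg[OF c(1,3), of \<omega>] by simp
    qed
  qed
  also have "\<dots> < \<infinity>"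
    using bounded assms by (simp add: integrably_bounded_process_def integrably_bounded_def)
  finally show "(\<integral>\<^sup>+\<omega>. ennreal (norm (radius (N t \<omega>))) \<partial>P) < \<infinity>" .
qed

lemma selections_N: "0 \<le> t \<Longrightarrow> selections P G (N t) = selections P G (M t)"
  by (rule selections_cong_AE[OF N_eq])

text \<open>The submartingale property freed of the version \<open>Y\<close>: this is the form in
  which it is used throughout.\<close>

lemma N_selections_subset:
  assumes "0 \<le> s" "s \<le> t"
  shows "selections P (F s) (N s) \<subseteq> L1_closure P (F s) (vec_cond_exp P (F s) ` selections P P (N t))"
proof
  fix \<xi> assume \<xi>: "\<xi> \<in> selections P (F s) (N s)"
  obtain Y where Y: "has_sv_cond_exp P (F s) (M t) Y" "AE \<omega> in P. M s \<omega> \<subseteq> Y \<omega>"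
    using submart assms by (auto simp: sv_submartingale_def)
  have "AE \<omega> in P. \<xi> \<omega> \<in> Y \<omega>"
    using Y(2) selectionsD(3)[OF \<xi>] N_eq[OF assms(1)] by eventually_elim auto
  then have "\<xi> \<in> selections P (F s) Y" using \<xi> by (simp add: selections_def)
  then show "\<xi> \<in> L1_closure P (F s) (vec_cond_exp P (F s) ` selections P P (N t))"
    using Y(1) assms by (simp add: has_sv_cond_exp_def selections_N)
qed

text \<open>A selection of \<open>N r\<close> is an L1-limit of conditioned selections of
  \<open>N u\<close>, each of which is bounded by the right-hand side. Testing on selections then
  puts the whole of \<open>N r\<close> into a random closed ball of that radius.\<close>

lemma radius_N_le:
  assumes "0 \<le> r" "r \<le> u"
  shows "AE \<omega> in P. radius (N r \<omega>) \<le> DIM('b) * real_cond_exp P (F r) (\<lambda>\<omega>. radius (N u \<omega>)) \<omega>"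
proof -
  interpret Fr: sigma_finite_subalgebra P "F r" using sigma_finite_subalgebra_F[OF assms(1)] .
  have u: "0 \<le> u" using assms by simp
  let ?k = "\<lambda>\<omega>. DIM('b) * real_cond_exp P (F r) (\<lambda>\<omega>. radius (N u \<omega>)) \<omega>"
  have "AE \<omega> in P. N r \<omega> \<subseteq> cball 0 (?k \<omega>)"
  proof (rule subset_if_selections[OF subalgebra_F[OF assms(1)] N_rv[OF assms(1)] N_radius[OF assms(1)]])
    fix \<xi> assume "\<xi> \<in> selections P (F r) (N r)"
    then have \<xi>: "\<xi> \<in> L1_closure P (F r) (vec_cond_exp P (F r) ` selections P P (N u))"
      using N_selections_subset[OF assms] by blast
    then obtain \<zeta> where \<zeta>: "\<And>n. \<zeta> n \<in> vec_cond_exp P (F r) ` selections P P (N u)"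
      "(\<lambda>n. \<integral>\<omega>. norm (\<xi> \<omega> - \<zeta> n \<omega>) \<partial>P) \<longlonglongrightarrow> 0"
      using L1_closure_sequence by blast
    show "AE \<omega> in P. \<xi> \<omega> \<in> cball 0 (?k \<omega>)"
    proof (rule L1_limit_mem[OF L1_closureD(2)[OF \<xi>] _ \<zeta>(2)])
      fix n
      obtain \<theta> where \<theta>: "\<theta> \<in> selections P P (N u)" "\<zeta> n = vec_cond_exp P (F r) \<theta>" using \<zeta>(1)[of n] by auto
      note s = selectionsD[OF \<theta>(1)]
      show "integrable P (\<zeta> n)" unfolding \<theta>(2) by (rule Fr.vec_cond_exp_integrable[OF s(2)])
      have "AE \<omega> in P. norm (\<theta> \<omega>) \<le> radius (N u \<omega>)"
        using s(3) by eventually_elim (intro radius_upper compact_convex_rvD[OF N_rv[OF u]])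
      then have "AE \<omega> in P. norm (\<zeta> n \<omega>) \<le> ?k \<omega>"
        unfolding \<theta>(2) by (rule Fr.vec_cond_exp_norm_le[OF s(2) N_radius[OF u]])
      then show "AE \<omega> in P. \<zeta> n \<omega> \<in> cball 0 (?k \<omega>)" by simp
    qed simp
  qed simp
  then show ?thesis
  proof eventually_elim
    case (elim \<omega>)
    note c = compact_convex_rvD[OF N_rv[OF assms(1)], of \<omega>]
    obtain y where "y \<in> N r \<omega>" "radius (N r \<omega>) = norm y" using radius_attained c by blast
    then show ?case using elim by auto
  qed
qed

section \<open>Right limits: values, adaptedness and integrability\<close>

definition X :: "real \<Rightarrow> 'a \<Rightarrow> 'b set" where "X = right_limit \<Omega>' M"

lemma \<Omega>'_space: "\<Omega>' \<subseteq> space P"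
  using event sets.sets_into_space by (auto simp: limit_event_def)

lemma AE_\<Omega>': "AE \<omega> in P. \<omega> \<in> \<Omega>'"
  using event prob_eq_1[of \<Omega>'] by (simp add: limit_event_def)

text \<open>\<open>limit_event\<close> only places this event in \<open>sets P\<close>; its full
  measure and completeness put it into every \<open>F t\<close>.\<close>

lemma \<Omega>'_F: "0 \<le> t \<Longrightarrow> \<Omega>' \<in> sets (F t)"
  using AE_set_in_F[OF _ AE_\<Omega>', of t] \<Omega>'_space by (simp add: Collect_conj_eq Int_absorb1)

lemma X_limit:
  assumes "\<omega> \<in> \<Omega>'" "0 \<le> t"
  shows "hausdorff_limit (\<lambda>r. M r \<omega>) (X t \<omega>) (rational_right t)"
    "compact (X t \<omega>) \<and> convex (X t \<omega>) \<and> X t \<omega> \<noteq> {}"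
proof -
  obtain L where L: "L \<noteq> {}" "compact L" "convex L" "hausdorff_limit (\<lambda>r. M r \<omega>) L (rational_right t)"
    using event assms unfolding limit_event_def by blast
  have "\<forall>\<^sub>F r in rational_right t. M r \<omega> \<noteq> {}"
    unfolding rational_right_def using M_closed assms \<Omega>'_space by (auto simp: eventually_at_filter intro!: always_eventually)
  then have "(THE L. hausdorff_limit (\<lambda>r. M r \<omega>) L (rational_right t)) = L"
    using L(4) by (intro the_equality hausdorff_limit_unique[OF _ _ rational_right_neq_bot])
  then have "X t \<omega> = L" using assms by (simp add: X_def right_limit_def)
  then show "hausdorff_limit (\<lambda>r. M r \<omega>) (X t \<omega>) (rational_right t)"
    "compact (X t \<omega>) \<and> convex (X t \<omega>) \<and> X t \<omega> \<noteq> {}" using L by auto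
qed

lemma X_outside: "\<omega> \<notin> \<Omega>' \<Longrightarrow> X t \<omega> = {0}"
  by (simp add: X_def right_limit_def)

lemma X_compact_convex: "0 \<le> t \<Longrightarrow> compact (X t \<omega>) \<and> convex (X t \<omega>) \<and> X t \<omega> \<noteq> {}"
  using X_limit(2) X_outside by (cases "\<omega> \<in> \<Omega>'") auto

lemma X_limit_sequence:
  assumes "\<omega> \<in> \<Omega>'" "0 \<le> t" "rational_approx t r" "0 < e"
  shows "\<forall>\<^sub>F n in sequentially. hausdorff_dist (M (r n) \<omega>) (X t \<omega>) \<le> ennreal e"
proof -
  have "\<forall>\<^sub>F q in rational_right t. hausdorff_dist (M q \<omega>) (X t \<omega>) \<le> ennreal e"
    using X_limit(1)[OF assms(1,2)] assms(4) by (simp add: hausdorff_limit_iff)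
  then show ?thesis
    by (rule eventually_compose_filterlim[OF _ rational_approx_filterlim[OF assms(3)]])
qed

text \<open>For each s > t the approximating times can be kept below s, so the distance functions of
  \<open>X t\<close> are measurable for \<open>F s\<close>; right-continuity of the filtration
  intersects over s.\<close>

lemma X_rv:
  assumes "0 \<le> t"
  shows "compact_convex_rv (F t) (X t)"
proof -
  have later: "sv_random_variable (F s) (X t)" if "t < s" for s
  proof (rule sv_random_variableI_infdist)
    have s: "0 \<le> s" using assms that by simp
    obtain r where r: "rational_approx t r" "\<And>n. r n < s"
      using rational_approx_exists[of t "\<lambda>_. s"] \<open>t < s\<close> by blast
    fix x :: 'b
    show "(\<lambda>\<omega>. infdist x (X t \<omega>)) \<in> borel_measurable (F s)"
    proof (rule borel_measurable_LIMSEQ_real)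
      fix n
      have "0 \<le> r n" using rational_approxD(2)[OF r(1), of n] assms by simp
      then have "(\<lambda>\<omega>. infdist x (M (r n) \<omega>)) \<in> borel_measurable (F s)"
        using measurable_F_mono[OF sv_random_variable_infdist[OF M_adapted]] r(2)[of n] less_imp_le by blast
      \<comment> \<open>Off the event the right limit is {0}, and \<open>norm x\<close> is the
        distance from \<open>x\<close> to it.\<close>
      then show "(\<lambda>\<omega>. if \<omega> \<in> \<Omega>' then infdist x (M (r n) \<omega>) else norm x) \<in> borel_measurable (F s)"
        using \<Omega>'_F[OF s] by simp
    next
      fix \<omega> assume "\<omega> \<in> space (F s)"
      show "(\<lambda>n. if \<omega> \<in> \<Omega>' then infdist x (M (r n) \<omega>) else norm x) \<longlonglongrightarrow> infdist x (X t \<omega>)"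
      proof (cases "\<omega> \<in> \<Omega>'")
        case True
        have "(\<lambda>n. infdist x (M (r n) \<omega>)) \<longlonglongrightarrow> infdist x (X t \<omega>)"
        proof (rule tendstoI)
          fix e :: real assume "0 < e"
          then have "\<forall>\<^sub>F n in sequentially. hausdorff_dist (M (r n) \<omega>) (X t \<omega>) \<le> ennreal (e / 2)"
            by (intro X_limit_sequence[OF True assms r(1)]) simp
          then show "\<forall>\<^sub>F n in sequentially. dist (infdist x (M (r n) \<omega>)) (infdist x (X t \<omega>)) < e"
          proof eventually_elim
            case (elim n)
            then have h: "\<forall>x\<in>M (r n) \<omega>. infdist x (X t \<omega>) \<le> e / 2" "\<forall>x\<in>X t \<omega>. infdist x (M (r n) \<omega>) \<le> e / 2"
              using \<open>0 < e\<close> by (auto simp: hausdorff_dist_le_iff)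
            have "M (r n) \<omega> \<noteq> {}"
              using M_closed[of "r n" \<omega>] rational_approxD(2)[OF r(1), of n] assms True \<Omega>'_space by auto
            then have "infdist x (X t \<omega>) \<le> infdist x (M (r n) \<omega>) + e / 2"
              "infdist x (M (r n) \<omega>) \<le> infdist x (X t \<omega>) + e / 2"
              using h X_compact_convex[OF assms] by (auto intro!: infdist_le_add)
            then show ?case using \<open>0 < e\<close> by (simp add: dist_real_def)
          qed
        qed
        then show ?thesis using True by simp
      qed (simp add: X_outside)
    qed
  qed (use X_compact_convex[OF assms] compact_imp_closed in blast)+
  have "{\<omega>\<in>space (F t). X t \<omega> \<inter> C \<noteq> {}} \<in> sets (F t)" if "closed C" for C
  proof -
    have "{\<omega>\<in>space P. X t \<omega> \<inter> C \<noteq> {}} \<in> sets (F s)" if "t < s" for s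
      using sv_random_variable_hits[OF later[OF that] \<open>closed C\<close>] space_F[of s] assms that by simp
    moreover have "sets (F t) = (\<Inter>s\<in>{t<..}. sets (F s))"
      using usual assms unfolding usual_conditions_def by blast
    ultimately show ?thesis unfolding space_F[OF assms] by blast
  qed
  then show ?thesis
    using X_compact_convex[OF assms] by (simp add: compact_convex_rv_def sv_random_variable_def compact_imp_closed)
qed

lemma N_limit_sequence:
  assumes "0 \<le> t" "rational_approx t r"
  shows "AE \<omega> in P. \<forall>e>0. \<forall>\<^sub>F n in sequentially. hausdorff_dist (N (r n) \<omega>) (X t \<omega>) \<le> ennreal e"
proof -
  have "AE \<omega> in P. \<forall>n. N (r n) \<omega> = M (r n) \<omega>"
    using N_eq rational_approxD(2)[OF assms(2)] assms(1) by (auto simp: AE_all_countable intro: less_imp_le less_trans le_less_trans)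
  then show ?thesis using AE_\<Omega>'
    by eventually_elim (use X_limit_sequence[OF _ assms] in simp)
qed

lemma integral_radius_N_le:
  assumes "0 \<le> r" "r \<le> u"
  shows "(\<integral>\<omega>. radius (N r \<omega>) \<partial>P) \<le> DIM('b) * (\<integral>\<omega>. radius (N u \<omega>) \<partial>P)"
proof -
  interpret Fr: sigma_finite_subalgebra P "F r" using sigma_finite_subalgebra_F[OF assms(1)] .
  note i = Fr.real_cond_exp_int[OF N_radius[OF order_trans[OF assms]]]
  have "(\<integral>\<omega>. radius (N r \<omega>) \<partial>P) \<le> (\<integral>\<omega>. DIM('b) * real_cond_exp P (F r) (\<lambda>\<omega>. radius (N u \<omega>)) \<omega> \<partial>P)"
    using i N_radius[OF assms(1)] by (intro integral_mono_AE radius_N_le assms integrable_mult_right)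
  then show ?thesis using i by simp
qed

text \<open>Fatou's lemma along the approximating times, whose expected radii are bounded through
  the radius at t + 1.\<close>

lemma X_radius:
  assumes "0 \<le> t"
  shows "integrable P (\<lambda>\<omega>. radius (X t \<omega>))"
proof (rule integrableI_bounded)
  obtain r where r: "rational_approx t r"
    by (rule rational_approx_exists[of t "\<lambda>_. t + 1"]) auto
  have r0: "0 \<le> r n" "r n \<le> t + 1" for n using rational_approxD(2,3)[OF r, of n] assms by auto
  note c = compact_convex_rvD[OF X_rv[OF assms]] and d = compact_convex_rvD[OF N_rv[OF r0(1)]]
  show "(\<lambda>\<omega>. radius (X t \<omega>)) \<in> borel_measurable P"
    by (rule radius_measurable[OF rv_P[OF X_rv[OF assms] assms]])
  have "(\<integral>\<^sup>+\<omega>. ennreal (norm (radius (X t \<omega>))) \<partial>P) = (\<integral>\<^sup>+\<omega>. liminf (\<lambda>n. ennreal (radius (N (r n) \<omega>))) \<partial>P)"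
  proof (rule nn_integral_cong_AE)
    show "AE \<omega> in P. ennreal (norm (radius (X t \<omega>))) = liminf (\<lambda>n. ennreal (radius (N (r n) \<omega>)))"
      using N_limit_sequence[OF assms r]
    proof eventually_elim
      case (elim \<omega>)
      have "(\<lambda>n. radius (N (r n) \<omega>)) \<longlonglongrightarrow> radius (X t \<omega>)"
      proof (rule tendstoI)
        fix e :: real assume "0 < e"
        then have "\<forall>\<^sub>F n in sequentially. hausdorff_dist (N (r n) \<omega>) (X t \<omega>) \<le> ennreal (e / 2)"
          using elim by simp
        then show "\<forall>\<^sub>F n in sequentially. dist (radius (N (r n) \<omega>)) (radius (X t \<omega>)) < e"
        proof eventually_elim
          case (elim n)
          then have h: "\<forall>x\<in>N (r n) \<omega>. infdist x (X t \<omega>) \<le> e / 2" "\<forall>x\<in>X t \<omega>. infdist x (N (r n) \<omega>) \<le> e / 2"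
            using \<open>0 < e\<close> by (auto simp: hausdorff_dist_le_iff)
          have "radius (N (r n) \<omega>) \<le> radius (X t \<omega>) + e / 2" "radius (X t \<omega>) \<le> radius (N (r n) \<omega>) + e / 2"
            using h c d by (auto intro!: radius_le_add)
          then show ?case using \<open>0 < e\<close> by (simp add: dist_real_def)
        qed
      qed
      then have "(\<lambda>n. ennreal (radius (N (r n) \<omega>))) \<longlonglongrightarrow> ennreal (radius (X t \<omega>))" by (rule tendsto_ennrealI)
      then show ?case
        using radius_nonneg[OF c(1,3), of \<omega>] by (simp add: lim_imp_Liminf)
    qed
  qed
  also have "\<dots> \<le> liminf (\<lambda>n. \<integral>\<^sup>+\<omega>. ennreal (radius (N (r n) \<omega>)) \<partial>P)"
    by (intro nn_integral_liminf) (use N_radius[OF r0(1)] in auto)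
  also have "\<dots> \<le> ennreal (DIM('b) * (\<integral>\<omega>. radius (N (t + 1) \<omega>) \<partial>P))"
  proof (rule Liminf_le)
    show "\<forall>\<^sub>F n in sequentially. (\<integral>\<^sup>+\<omega>. ennreal (radius (N (r n) \<omega>)) \<partial>P) \<le> ennreal (DIM('b) * (\<integral>\<omega>. radius (N (t + 1) \<omega>) \<partial>P))"
      using integral_radius_N_le[OF r0] N_radius[OF r0(1)] radius_nonneg[OF d(1,3)]
      by (auto intro!: always_eventually ennreal_leI simp: nn_integral_eq_integral)
  qed simp
  also have "\<dots> < \<infinity>" by simp
  finally show "(\<integral>\<^sup>+\<omega>. ennreal (norm (radius (X t \<omega>))) \<partial>P) < \<infinity>" .
qed

lemma rational_approx_nonneg: "rational_approx t r \<Longrightarrow> 0 \<le> t \<Longrightarrow> 0 \<le> r n"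
  using rational_approxD(2)[of t r n] by simp

section \<open>Moving selections between \<open>N (r n)\<close> and \<open>X t\<close> in L1\<close>

text \<open>The radius at time r n is at most the dimension times the conditional expectation of the
  radius at t + 1, so the majorant has the form asked for by
  \<open>integral_tendsto_0_dominated_cond_exp\<close>. Projections use c = 1, support functions c =
  \<open>norm x\<close>.\<close>

lemma integral_tendsto_0:
  fixes f :: "nat \<Rightarrow> 'a \<Rightarrow> real"
  assumes t: "0 \<le> t" and r: "rational_approx t r" and c: "0 \<le> c"
    and f: "\<And>n. f n \<in> borel_measurable P"
    and le: "\<And>n. AE \<omega> in P. \<bar>f n \<omega>\<bar> \<le> c * (radius (N (r n) \<omega>) + radius (X t \<omega>))"
    and lim: "AE \<omega> in P. (\<lambda>n. f n \<omega>) \<longlonglongrightarrow> 0"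
  shows "(\<lambda>n. \<integral>\<omega>. \<bar>f n \<omega>\<bar> \<partial>P) \<longlonglongrightarrow> 0"
proof (rule integral_tendsto_0_dominated_cond_exp(2)[OF _ _ _ f lim])
  note r0 = rational_approx_nonneg[OF r t]
  let ?g = "\<lambda>\<omega>. radius (N (t + 1) \<omega>)"
  show "subalgebra P (F (r n))" for n by (rule subalgebra_F[OF r0])
  have g: "integrable P ?g" using t by (intro N_radius) simp
  then show "integrable P (\<lambda>\<omega>. (c * DIM('b)) * ?g \<omega>)" by (rule integrable_mult_right)
  show "integrable P (\<lambda>\<omega>. c * radius (X t \<omega>))" using X_radius[OF t] by simp
  fix n
  interpret Fr: sigma_finite_subalgebra P "F (r n)" by (rule sigma_finite_subalgebra_F[OF r0])
  have "AE \<omega> in P. real_cond_exp P (F (r n)) (\<lambda>\<omega>. (c * DIM('b)) * ?g \<omega>) \<omega> = (c * DIM('b)) * real_cond_exp P (F (r n)) ?g \<omega>"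
    using g by (rule Fr.real_cond_exp_cmult)
  with le[of n] radius_N_le[OF r0 rational_approxD(3)[OF r], of n]
  show "AE \<omega> in P. \<bar>f n \<omega>\<bar> \<le> real_cond_exp P (F (r n)) (\<lambda>\<omega>. (c * DIM('b)) * ?g \<omega>) \<omega> + c * radius (X t \<omega>)"
  proof eventually_elim
    case (elim \<omega>)
    show ?case using elim mult_left_mono[OF elim(2) c] by (simp add: algebra_simps)
  qed
qed

text \<open>The projection error is a distance to a set, hence at most the Hausdorff distance, and
  it is dominated by the sum of the two radii. The disjunction treats both directions of the move at
  once.\<close>

lemma closest_point_tendsto_0:
  assumes t: "0 \<le> t" and r: "rational_approx t r"
    and Y: "\<And>n. compact_convex_rv P (Y n)" and \<zeta>: "\<And>n. \<zeta> n \<in> selections P P (Z n)"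
    and YZ: "(\<forall>n. Y n = X t \<and> Z n = N (r n)) \<or> (\<forall>n. Y n = N (r n) \<and> Z n = X t)"
  shows "(\<lambda>n. \<integral>\<omega>. norm (\<zeta> n \<omega> - closest_point (Y n \<omega>) (\<zeta> n \<omega>)) \<partial>P) \<longlonglongrightarrow> 0"
proof -
  note r0 = rational_approx_nonneg[OF r t]
  note c = compact_convex_rvD[OF X_rv[OF t]] and d = compact_convex_rvD[OF N_rv[OF r0]]
  have "(\<lambda>n. \<integral>\<omega>. \<bar>norm (\<zeta> n \<omega> - closest_point (Y n \<omega>) (\<zeta> n \<omega>))\<bar> \<partial>P) \<longlonglongrightarrow> 0"
  proof (rule integral_tendsto_0[OF t r zero_le_one])
    show "(\<lambda>\<omega>. norm (\<zeta> n \<omega> - closest_point (Y n \<omega>) (\<zeta> n \<omega>))) \<in> borel_measurable P" for n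
      using selectionsD(1)[OF \<zeta>] closest_point_measurable[OF Y] by measurable
    show "AE \<omega> in P. \<bar>norm (\<zeta> n \<omega> - closest_point (Y n \<omega>) (\<zeta> n \<omega>))\<bar> \<le> 1 * (radius (N (r n) \<omega>) + radius (X t \<omega>))" for n
      using selectionsD(3)[OF \<zeta>[of n]]
    proof eventually_elim
      case (elim \<omega>)
      have "closest_point (Y n \<omega>) (\<zeta> n \<omega>) \<in> Y n \<omega>" by (rule closest_point_mem[OF Y])
      then have "norm (\<zeta> n \<omega>) + norm (closest_point (Y n \<omega>) (\<zeta> n \<omega>)) \<le> radius (N (r n) \<omega>) + radius (X t \<omega>)"
        using YZ elim radius_upper[OF c(1)] radius_upper[OF d(1)] by (force intro: add_mono)
      then show ?case using norm_triangle_ineq4[of "\<zeta> n \<omega>" "closest_point (Y n \<omega>) (\<zeta> n \<omega>)"] by simp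
    qed
    have "AE \<omega> in P. \<forall>n. \<zeta> n \<omega> \<in> Z n \<omega>" using selectionsD(3)[OF \<zeta>] by (simp add: AE_all_countable)
    then show "AE \<omega> in P. (\<lambda>n. norm (\<zeta> n \<omega> - closest_point (Y n \<omega>) (\<zeta> n \<omega>))) \<longlonglongrightarrow> 0"
      using N_limit_sequence[OF t r]
    proof eventually_elim
      case (elim \<omega>)
      show ?case
      proof (rule tendstoI)
        fix e :: real assume "0 < e"
        then have "\<forall>\<^sub>F n in sequentially. hausdorff_dist (N (r n) \<omega>) (X t \<omega>) \<le> ennreal (e / 2)"
          using elim(2) by simp
        then show "\<forall>\<^sub>F n in sequentially. dist (norm (\<zeta> n \<omega> - closest_point (Y n \<omega>) (\<zeta> n \<omega>))) 0 < e"
        proof eventually_elim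
          case h: (elim n)
          then have "infdist (\<zeta> n \<omega>) (Y n \<omega>) \<le> e / 2"
            using YZ elim(1) \<open>0 < e\<close> by (auto simp: hausdorff_dist_le_iff)
          then show ?case
            using \<open>0 < e\<close> infdist_nonneg[of "\<zeta> n \<omega>" "Y n \<omega>"] by (simp add: dist_closest_point[OF Y])
        qed
      qed
    qed
  qed
  then show ?thesis by simp
qed

lemma closest_point_X_tendsto_0:
  assumes "0 \<le> t" "rational_approx t r" "\<And>n. \<zeta> n \<in> selections P P (N (r n))"
  shows "(\<lambda>n. \<integral>\<omega>. norm (\<zeta> n \<omega> - closest_point (X t \<omega>) (\<zeta> n \<omega>)) \<partial>P) \<longlonglongrightarrow> 0"
  by (rule closest_point_tendsto_0[where Y="\<lambda>_. X t" and Z="\<lambda>n. N (r n)", OF assms(1,2)])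
    (use assms in \<open>auto intro: rv_P X_rv\<close>)

lemma closest_point_N_tendsto_0:
  assumes "0 \<le> t" "rational_approx t r" "\<eta> \<in> selections P P (X t)"
  shows "(\<lambda>n. \<integral>\<omega>. norm (\<eta> \<omega> - closest_point (N (r n) \<omega>) (\<eta> \<omega>)) \<partial>P) \<longlonglongrightarrow> 0"
  by (rule closest_point_tendsto_0[where Z="\<lambda>_. X t" and Y="\<lambda>n. N (r n)", OF assms(1,2)])
    (use assms rational_approx_nonneg[OF assms(2,1)] in \<open>auto intro: rv_P N_rv\<close>)

section \<open>Inclusion, submartingale and martingale relations in terms of selections\<close>

lemma selection_X:
  assumes "0 \<le> t" "f \<in> borel_measurable P"
  shows "(\<lambda>\<omega>. closest_point (X t \<omega>) (f \<omega>)) \<in> selections P P (X t)"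
  using rv_P[OF X_rv[OF assms(1)] assms(1)] X_radius[OF assms(1)] assms(2)
  by (intro closest_point_selection) (auto simp: subalgebra_def)

text \<open>By the tower property \<xi> may first be conditioned on the larger \<open>F q\<close>;
  conditioning on \<open>F s\<close> is then Lipschitz.\<close>

lemma nested_approximation:
  fixes \<eta> \<xi> :: "'a \<Rightarrow> 'b"
  assumes "0 \<le> s" "s \<le> q" "integrable P \<eta>" "integrable P \<xi>"
  shows "(\<integral>\<omega>. norm (vec_cond_exp P (F s) \<eta> \<omega> - vec_cond_exp P (F s) \<xi> \<omega>) \<partial>P) \<le>
    DIM('b) * (\<integral>\<omega>. norm (\<eta> \<omega> - vec_cond_exp P (F q) \<xi> \<omega>) \<partial>P)"
proof -
  interpret Fs: sigma_finite_subalgebra P "F s" by (rule sigma_finite_subalgebra_F[OF assms(1)])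
  interpret Fq: sigma_finite_subalgebra P "F q" using assms by (intro sigma_finite_subalgebra_F) simp
  have i: "integrable P (vec_cond_exp P (F q) \<xi>)" by (rule Fq.vec_cond_exp_integrable[OF assms(4)])
  have "(\<integral>\<omega>. norm (vec_cond_exp P (F s) \<eta> \<omega> - vec_cond_exp P (F s) \<xi> \<omega>) \<partial>P) =
      (\<integral>\<omega>. norm (vec_cond_exp P (F s) \<eta> \<omega> - vec_cond_exp P (F s) (vec_cond_exp P (F q) \<xi>) \<omega>) \<partial>P)"
    using Fs.vec_cond_exp_nested[OF Fq.subalg subalgebra_F_mono[OF assms(1,2)] assms(4)]
    by (intro integral_cong_AE) (auto elim!: eventually_mono)
  also have "\<dots> \<le> DIM('b) * (\<integral>\<omega>. norm (\<eta> \<omega> - vec_cond_exp P (F q) \<xi> \<omega>) \<partial>P)"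
    by (rule Fs.integral_norm_vec_cond_exp_diff_le[OF assms(3) i])
  finally show ?thesis .
qed

text \<open>A selection \<open>\<eta>\<close> of \<open>X s\<close> is moved to \<open>N (q n)\<close>, approximated there by the conditional expectation of a
  selection of \<open>N (r n)\<close>, which in turn is moved to \<open>X t\<close>.\<close>

lemma X_selections_subset:
  assumes s: "0 \<le> s" and st: "s \<le> t"
  shows "selections P (F s) (X s) \<subseteq> L1_closure P (F s) (vec_cond_exp P (F s) ` selections P P (X t))"
proof
  fix \<eta> assume \<eta>: "\<eta> \<in> selections P (F s) (X s)"
  have t: "0 \<le> t" using s st by simp
  obtain r where r: "rational_approx t r" by (rule rational_approx_exists[of t "\<lambda>_. t + 1"]) auto
  \<comment> \<open>Strict even when s = t, which leaves room for q n between s and r n.\<close>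
  have "s < r n" for n using rational_approxD(2)[OF r, of n] st by simp
  then obtain q where q: "rational_approx s q" "\<And>n. q n < r n" using rational_approx_exists[of s r] by blast
  note q0 = rational_approx_nonneg[OF q(1) s] and r0 = rational_approx_nonneg[OF r t]
  have sq: "s \<le> q n" for n using rational_approxD(2)[OF q(1), of n] by simp
  interpret Fs: sigma_finite_subalgebra P "F s" by (rule sigma_finite_subalgebra_F[OF s])
  note e = selectionsD[OF \<eta>]
  define \<eta>' where "\<eta>' n \<omega> = closest_point (N (q n) \<omega>) (\<eta> \<omega>)" for n \<omega>
  have \<eta>': "\<eta>' n \<in> selections P (F (q n)) (N (q n))" for n
    unfolding \<eta>'_def[abs_def]
    by (intro closest_point_selection subalgebra_F N_rv N_radius q0 measurable_F_mono[OF e(1) s sq])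
  have a: "(\<lambda>n. \<integral>\<omega>. norm (\<eta> \<omega> - \<eta>' n \<omega>) \<partial>P) \<longlonglongrightarrow> 0"
    unfolding \<eta>'_def by (rule closest_point_N_tendsto_0[OF s q(1) subsetD[OF selections_mono[OF subalgebra_F[OF s]] \<eta>]])
  have "\<exists>\<zeta>\<in>selections P P (N (r n)). (\<integral>\<omega>. norm (\<eta>' n \<omega> - vec_cond_exp P (F (q n)) \<zeta> \<omega>) \<partial>P) < 1 / Suc n" for n
  proof -
    have "\<eta>' n \<in> L1_closure P (F (q n)) (vec_cond_exp P (F (q n)) ` selections P P (N (r n)))"
      using \<eta>'[of n] N_selections_subset[OF q0[of n], of "r n"] q(2)[of n] by auto
    from L1_closureD(3)[OF this, of "1 / Suc n"] show ?thesis by auto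
  qed
  then obtain \<zeta> where \<zeta>: "\<And>n. \<zeta> n \<in> selections P P (N (r n))"
    "\<And>n. (\<integral>\<omega>. norm (\<eta>' n \<omega> - vec_cond_exp P (F (q n)) (\<zeta> n) \<omega>) \<partial>P) < 1 / Suc n"
    by metis
  define \<xi> where "\<xi> n \<omega> = closest_point (X t \<omega>) (\<zeta> n \<omega>)" for n \<omega>
  have \<xi>: "\<xi> n \<in> selections P P (X t)" for n
    unfolding \<xi>_def[abs_def] by (rule selection_X[OF t selectionsD(1)[OF \<zeta>(1)]])
  have c: "(\<lambda>n. \<integral>\<omega>. norm (\<zeta> n \<omega> - \<xi> n \<omega>) \<partial>P) \<longlonglongrightarrow> 0"
    unfolding \<xi>_def by (rule closest_point_X_tendsto_0[OF t r \<zeta>(1)])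
  let ?d = "real DIM('b)"
  have le: "(\<integral>\<omega>. norm (\<eta> \<omega> - vec_cond_exp P (F s) (\<xi> n) \<omega>) \<partial>P) \<le>
      ?d * ((\<integral>\<omega>. norm (\<eta> \<omega> - \<eta>' n \<omega>) \<partial>P) + 1 / Suc n + ?d * (\<integral>\<omega>. norm (\<zeta> n \<omega> - \<xi> n \<omega>) \<partial>P))" for n
  proof -
    interpret Fq: sigma_finite_subalgebra P "F (q n)" by (rule sigma_finite_subalgebra_F[OF q0])
    note i = selectionsD(2)[OF \<eta>'[of n]] selectionsD(2)[OF \<zeta>(1)[of n]] selectionsD(2)[OF \<xi>[of n]]
    note j = Fq.vec_cond_exp_integrable[OF i(2)] Fq.vec_cond_exp_integrable[OF i(3)]
    \<comment> \<open>Conditioning on \<open>F s\<close> fixes \<eta>, so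
      \<open>nested_approximation\<close> lifts the comparison from \<open>F s\<close> to
      \<open>F (q n)\<close>.\<close>
    have "(\<integral>\<omega>. norm (\<eta> \<omega> - vec_cond_exp P (F s) (\<xi> n) \<omega>) \<partial>P) =
        (\<integral>\<omega>. norm (vec_cond_exp P (F s) \<eta> \<omega> - vec_cond_exp P (F s) (\<xi> n) \<omega>) \<partial>P)"
      using Fs.vec_cond_exp_F_meas[OF e(2,1)] e(2) by (intro integral_cong_AE) (auto elim!: eventually_mono)
    also have "\<dots> \<le> ?d * (\<integral>\<omega>. norm (\<eta> \<omega> - vec_cond_exp P (F (q n)) (\<xi> n) \<omega>) \<partial>P)"
      by (rule nested_approximation[OF s sq e(2) i(3)])
    also have "(\<integral>\<omega>. norm (\<eta> \<omega> - vec_cond_exp P (F (q n)) (\<xi> n) \<omega>) \<partial>P) \<le>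
        (\<integral>\<omega>. norm (\<eta> \<omega> - \<eta>' n \<omega>) \<partial>P) + (\<integral>\<omega>. norm (\<eta>' n \<omega> - vec_cond_exp P (F (q n)) (\<xi> n) \<omega>) \<partial>P)"
      by (rule integral_norm_triangle[OF e(2) i(1) j(2)])
    also have "(\<integral>\<omega>. norm (\<eta>' n \<omega> - vec_cond_exp P (F (q n)) (\<xi> n) \<omega>) \<partial>P) \<le>
        (\<integral>\<omega>. norm (\<eta>' n \<omega> - vec_cond_exp P (F (q n)) (\<zeta> n) \<omega>) \<partial>P) +
        (\<integral>\<omega>. norm (vec_cond_exp P (F (q n)) (\<zeta> n) \<omega> - vec_cond_exp P (F (q n)) (\<xi> n) \<omega>) \<partial>P)"
      by (rule integral_norm_triangle[OF i(1) j(1) j(2)])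
    also have "(\<integral>\<omega>. norm (vec_cond_exp P (F (q n)) (\<zeta> n) \<omega> - vec_cond_exp P (F (q n)) (\<xi> n) \<omega>) \<partial>P) \<le>
        ?d * (\<integral>\<omega>. norm (\<zeta> n \<omega> - \<xi> n \<omega>) \<partial>P)"
      by (rule Fq.integral_norm_vec_cond_exp_diff_le[OF i(2,3)])
    also have "(\<integral>\<omega>. norm (\<eta>' n \<omega> - vec_cond_exp P (F (q n)) (\<zeta> n) \<omega>) \<partial>P) \<le> 1 / Suc n"
      using \<zeta>(2)[of n] by simp
    finally show ?thesis by (simp add: add.assoc mult_left_mono)
  qed
  have "(\<lambda>n. ?d * ((\<integral>\<omega>. norm (\<eta> \<omega> - \<eta>' n \<omega>) \<partial>P) + 1 / Suc n + ?d * (\<integral>\<omega>. norm (\<zeta> n \<omega> - \<xi> n \<omega>) \<partial>P)))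
      \<longlonglongrightarrow> ?d * (0 + 0 + ?d * 0)"
    using LIMSEQ_inverse_real_of_nat by (intro tendsto_intros a c) (simp add: inverse_eq_divide)
  then have lim: "(\<lambda>n. ?d * ((\<integral>\<omega>. norm (\<eta> \<omega> - \<eta>' n \<omega>) \<partial>P) + 1 / Suc n + ?d * (\<integral>\<omega>. norm (\<zeta> n \<omega> - \<xi> n \<omega>) \<partial>P))) \<longlonglongrightarrow> 0"
    by simp
  show "\<eta> \<in> L1_closure P (F s) (vec_cond_exp P (F s) ` selections P P (X t))"
  proof (rule L1_closureI[OF e(1,2)])
    fix \<epsilon> :: real assume "0 < \<epsilon>"
    then obtain n where "?d * ((\<integral>\<omega>. norm (\<eta> \<omega> - \<eta>' n \<omega>) \<partial>P) + 1 / Suc n + ?d * (\<integral>\<omega>. norm (\<zeta> n \<omega> - \<xi> n \<omega>) \<partial>P)) < \<epsilon>"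
      using order_tendstoD(2)[OF lim] by (auto simp: eventually_sequentially)
    then have "(\<integral>\<omega>. norm (\<eta> \<omega> - vec_cond_exp P (F s) (\<xi> n) \<omega>) \<partial>P) < \<epsilon>" using le[of n] by linarith
    then show "\<exists>\<zeta>\<in>vec_cond_exp P (F s) ` selections P P (X t). (\<integral>\<omega>. norm (\<eta> \<omega> - \<zeta> \<omega>) \<partial>P) < \<epsilon>"
      using \<xi>[of n] by blast
  qed
qed

text \<open>A selection of \<open>N t\<close> is approximated by conditioned selections of
  \<open>N (r n)\<close>, and these selections are projected to \<open>X t\<close>. Conditioning on
  \<open>F t\<close> keeps them in \<open>X t\<close>, because \<open>X t\<close> is convex and
  measurable for \<open>F t\<close> itself.\<close>

lemma N_subset_X:
  assumes t: "0 \<le> t"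
  shows "AE \<omega> in P. N t \<omega> \<subseteq> X t \<omega>"
proof (rule subset_if_selections[OF subalgebra_F[OF t] N_rv[OF t] N_radius[OF t]])
  interpret Ft: sigma_finite_subalgebra P "F t" by (rule sigma_finite_subalgebra_F[OF t])
  fix \<eta> assume \<eta>: "\<eta> \<in> selections P (F t) (N t)"
  note e = selectionsD[OF \<eta>]
  obtain r where r: "rational_approx t r" by (rule rational_approx_exists[of t "\<lambda>_. t + 1"]) auto
  have "\<exists>\<zeta>\<in>selections P P (N (r n)). (\<integral>\<omega>. norm (\<eta> \<omega> - vec_cond_exp P (F t) \<zeta> \<omega>) \<partial>P) < 1 / Suc n" for n
  proof -
    have "\<eta> \<in> L1_closure P (F t) (vec_cond_exp P (F t) ` selections P P (N (r n)))"
      using \<eta> N_selections_subset[OF t, of "r n"] rational_approxD(2)[OF r, of n] by auto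
    from L1_closureD(3)[OF this, of "1 / Suc n"] show ?thesis by auto
  qed
  then obtain \<zeta> where \<zeta>: "\<And>n. \<zeta> n \<in> selections P P (N (r n))"
    "\<And>n. (\<integral>\<omega>. norm (\<eta> \<omega> - vec_cond_exp P (F t) (\<zeta> n) \<omega>) \<partial>P) < 1 / Suc n"
    by metis
  define \<xi> where "\<xi> n \<omega> = closest_point (X t \<omega>) (\<zeta> n \<omega>)" for n \<omega>
  have \<xi>: "\<xi> n \<in> selections P P (X t)" for n
    unfolding \<xi>_def[abs_def] by (rule selection_X[OF t selectionsD(1)[OF \<zeta>(1)]])
  have c: "(\<lambda>n. \<integral>\<omega>. norm (\<zeta> n \<omega> - \<xi> n \<omega>) \<partial>P) \<longlonglongrightarrow> 0"
    unfolding \<xi>_def by (rule closest_point_X_tendsto_0[OF t r \<zeta>(1)])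
  note i = selectionsD(2)[OF \<zeta>(1)] selectionsD(2)[OF \<xi>]
  show "AE \<omega> in P. \<eta> \<omega> \<in> X t \<omega>"
  proof (rule L1_limit_mem[OF e(2) Ft.vec_cond_exp_integrable[OF i(2)]])
    show "AE \<omega> in P. vec_cond_exp P (F t) (\<xi> n) \<omega> \<in> X t \<omega>" for n
      by (rule Ft.vec_cond_exp_selection[OF X_rv[OF t] X_radius[OF t] \<xi>])
    show "(\<lambda>n. \<integral>\<omega>. norm (\<eta> \<omega> - vec_cond_exp P (F t) (\<xi> n) \<omega>) \<partial>P) \<longlonglongrightarrow> 0"
    proof (rule real_tendsto_sandwich[OF _ _ tendsto_const])
      have "(\<lambda>n. 1 / Suc n + DIM('b) * (\<integral>\<omega>. norm (\<zeta> n \<omega> - \<xi> n \<omega>) \<partial>P)) \<longlonglongrightarrow> 0 + real DIM('b) * 0"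
        using LIMSEQ_inverse_real_of_nat by (intro tendsto_intros c) (simp add: inverse_eq_divide)
      then show "(\<lambda>n. 1 / Suc n + DIM('b) * (\<integral>\<omega>. norm (\<zeta> n \<omega> - \<xi> n \<omega>) \<partial>P)) \<longlonglongrightarrow> 0" by simp
      have "(\<integral>\<omega>. norm (\<eta> \<omega> - vec_cond_exp P (F t) (\<xi> n) \<omega>) \<partial>P) \<le>
          1 / Suc n + DIM('b) * (\<integral>\<omega>. norm (\<zeta> n \<omega> - \<xi> n \<omega>) \<partial>P)" for n
        using integral_norm_triangle[OF e(2) Ft.vec_cond_exp_integrable[OF i(1)[of n]] Ft.vec_cond_exp_integrable[OF i(2)[of n]]]
          Ft.integral_norm_vec_cond_exp_diff_le[OF i(1)[of n] i(2)[of n]] \<zeta>(2)[of n] by linarith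
      then show "\<forall>\<^sub>F n in sequentially. (\<integral>\<omega>. norm (\<eta> \<omega> - vec_cond_exp P (F t) (\<xi> n) \<omega>) \<partial>P) \<le>
          1 / Suc n + DIM('b) * (\<integral>\<omega>. norm (\<zeta> n \<omega> - \<xi> n \<omega>) \<partial>P)" by simp
    qed simp
  qed (use compact_convex_rvD(4)[OF X_rv[OF t]] in simp)
qed (use compact_convex_rvD(4)[OF X_rv[OF t]] in simp)

lemma martingale_N_selections:
  assumes "sv_martingale P F M" "0 \<le> s" "s \<le> t"
  shows "L1_closure P (F s) (vec_cond_exp P (F s) ` selections P P (N t)) = selections P (F s) (N s)"
proof -
  obtain Y where Y: "has_sv_cond_exp P (F s) (M t) Y" "AE \<omega> in P. M s \<omega> = Y \<omega>"
    using assms unfolding sv_martingale_def by blast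
  then show ?thesis
    using selections_cong_AE[OF Y(2), of "F s"] assms by (simp add: has_sv_cond_exp_def selections_N)
qed

text \<open>A selection of \<open>X t\<close> is projected to \<open>N (r n)\<close>; its
  conditional expectation given \<open>F (q n)\<close> is a selection of \<open>N (q n)\<close> by
  the martingale property and is projected to \<open>X s\<close>. Conditioning on \<open>F s\<close>
  stays in \<open>X s\<close>, and the errors vanish in L1.\<close>

lemma X_martingale_selections:
  assumes mart: "sv_martingale P F M" and s: "0 \<le> s" and st: "s \<le> t"
  shows "L1_closure P (F s) (vec_cond_exp P (F s) ` selections P P (X t)) \<subseteq> selections P (F s) (X s)"
proof
  fix \<theta> assume \<theta>: "\<theta> \<in> L1_closure P (F s) (vec_cond_exp P (F s) ` selections P P (X t))"
  have t: "0 \<le> t" using s st by simp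
  obtain r where r: "rational_approx t r" by (rule rational_approx_exists[of t "\<lambda>_. t + 1"]) auto
  have "s < r n" for n using rational_approxD(2)[OF r, of n] st by simp
  then obtain q where q: "rational_approx s q" "\<And>n. q n < r n" using rational_approx_exists[of s r] by blast
  note q0 = rational_approx_nonneg[OF q(1) s] and r0 = rational_approx_nonneg[OF r t]
  have sq: "s \<le> q n" for n using rational_approxD(2)[OF q(1), of n] by simp
  interpret Fs: sigma_finite_subalgebra P "F s" by (rule sigma_finite_subalgebra_F[OF s])
  have mem: "AE \<omega> in P. vec_cond_exp P (F s) \<xi> \<omega> \<in> X s \<omega>" if \<xi>: "\<xi> \<in> selections P P (X t)" for \<xi>
  proof -
    define \<zeta> where "\<zeta> n \<omega> = closest_point (N (r n) \<omega>) (\<xi> \<omega>)" for n \<omega>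
    have \<zeta>: "\<zeta> n \<in> selections P P (N (r n))" for n
      unfolding \<zeta>_def[abs_def] using rv_P[OF N_rv[OF r0] r0] N_radius[OF r0] selectionsD(1)[OF \<xi>]
      by (intro closest_point_selection) (auto simp: subalgebra_def)
    have a: "(\<lambda>n. \<integral>\<omega>. norm (\<xi> \<omega> - \<zeta> n \<omega>) \<partial>P) \<longlonglongrightarrow> 0"
      unfolding \<zeta>_def by (rule closest_point_N_tendsto_0[OF t r \<xi>])
    define \<kappa> where "\<kappa> n = vec_cond_exp P (F (q n)) (\<zeta> n)" for n
    have \<kappa>: "\<kappa> n \<in> selections P P (N (q n))" for n
    proof -
      interpret Fq: sigma_finite_subalgebra P "F (q n)" by (rule sigma_finite_subalgebra_F[OF q0])
      have "\<kappa> n \<in> L1_closure P (F (q n)) (vec_cond_exp P (F (q n)) ` selections P P (N (r n)))"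
        unfolding \<kappa>_def using \<zeta>[of n] Fq.vec_cond_exp_integrable[OF selectionsD(2)[OF \<zeta>[of n]]]
        by (intro L1_closureI) (auto intro!: bexI[of _ "\<zeta> n"])
      then show ?thesis
        using martingale_N_selections[OF mart q0[of n], of "r n"] q(2)[of n] selections_mono[OF subalgebra_F[OF q0[of n]]] by auto
    qed
    define p where "p n \<omega> = closest_point (X s \<omega>) (\<kappa> n \<omega>)" for n \<omega>
    have p: "p n \<in> selections P P (X s)" for n
      unfolding p_def[abs_def] by (rule selection_X[OF s selectionsD(1)[OF \<kappa>]])
    have c: "(\<lambda>n. \<integral>\<omega>. norm (\<kappa> n \<omega> - p n \<omega>) \<partial>P) \<longlonglongrightarrow> 0"
      unfolding p_def by (rule closest_point_X_tendsto_0[OF s q(1) \<kappa>])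
    note i = selectionsD(2)[OF \<xi>] selectionsD(2)[OF \<zeta>] selectionsD(2)[OF p]
    note j = i[THEN Fs.vec_cond_exp_integrable]
    show ?thesis
    proof (rule L1_limit_mem[OF j(1) j(3)])
      show "AE \<omega> in P. vec_cond_exp P (F s) (p n) \<omega> \<in> X s \<omega>" for n
        by (rule Fs.vec_cond_exp_selection[OF X_rv[OF s] X_radius[OF s] p])
      let ?b = "\<lambda>n. DIM('b) * (\<integral>\<omega>. norm (\<xi> \<omega> - \<zeta> n \<omega>) \<partial>P) + DIM('b) * (\<integral>\<omega>. norm (\<kappa> n \<omega> - p n \<omega>) \<partial>P)"
      show "(\<lambda>n. \<integral>\<omega>. norm (vec_cond_exp P (F s) \<xi> \<omega> - vec_cond_exp P (F s) (p n) \<omega>) \<partial>P) \<longlonglongrightarrow> 0"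
      proof (rule real_tendsto_sandwich[OF _ _ tendsto_const])
        have "?b \<longlonglongrightarrow> real DIM('b) * 0 + real DIM('b) * 0" by (intro tendsto_intros a c)
        then show "?b \<longlonglongrightarrow> 0" by simp
        have "(\<integral>\<omega>. norm (vec_cond_exp P (F s) \<xi> \<omega> - vec_cond_exp P (F s) (p n) \<omega>) \<partial>P) \<le> ?b n" for n
        proof -
          have "(\<integral>\<omega>. norm (vec_cond_exp P (F s) (\<zeta> n) \<omega> - vec_cond_exp P (F s) (p n) \<omega>) \<partial>P) =
              (\<integral>\<omega>. norm (vec_cond_exp P (F s) (p n) \<omega> - vec_cond_exp P (F s) (\<zeta> n) \<omega>) \<partial>P)"
            by (simp add: norm_minus_commute)
          also have "\<dots> \<le> DIM('b) * (\<integral>\<omega>. norm (p n \<omega> - vec_cond_exp P (F (q n)) (\<zeta> n) \<omega>) \<partial>P)"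
            by (rule nested_approximation[OF s sq i(3) i(2)])
          also have "\<dots> = DIM('b) * (\<integral>\<omega>. norm (\<kappa> n \<omega> - p n \<omega>) \<partial>P)"
            by (simp add: \<kappa>_def norm_minus_commute)
          finally show ?thesis
            using integral_norm_triangle[OF j(1) j(2)[of n] j(3)[of n]]
              Fs.integral_norm_vec_cond_exp_diff_le[OF i(1) i(2)[of n]] by linarith
        qed
        then show "\<forall>\<^sub>F n in sequentially.
          (\<integral>\<omega>. norm (vec_cond_exp P (F s) \<xi> \<omega> - vec_cond_exp P (F s) (p n) \<omega>) \<partial>P) \<le> ?b n" by simp
      qed simp
    qed (use compact_convex_rvD(4)[OF X_rv[OF s]] in simp)
  qed
  obtain \<zeta> where \<zeta>: "\<And>n. \<zeta> n \<in> vec_cond_exp P (F s) ` selections P P (X t)"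
    "(\<lambda>n. \<integral>\<omega>. norm (\<theta> \<omega> - \<zeta> n \<omega>) \<partial>P) \<longlonglongrightarrow> 0"
    using L1_closure_sequence[OF \<theta>] by blast
  have "AE \<omega> in P. \<theta> \<omega> \<in> X s \<omega>"
  proof (rule L1_limit_mem[OF L1_closureD(2)[OF \<theta>] _ \<zeta>(2)])
    fix n
    obtain \<xi> where "\<xi> \<in> selections P P (X t)" "\<zeta> n = vec_cond_exp P (F s) \<xi>" using \<zeta>(1)[of n] by auto
    then show "integrable P (\<zeta> n)" "AE \<omega> in P. \<zeta> n \<omega> \<in> X s \<omega>"
      using mem Fs.vec_cond_exp_integrable[OF selectionsD(2)] by auto
  qed (use compact_convex_rvD(4)[OF X_rv[OF s]] in simp)
  then show "\<theta> \<in> selections P (F s) (X s)"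
    using L1_closureD(1,2)[OF \<theta>] by (simp add: selections_def)
qed

section \<open>Expected support functions and the criterion for \<open>M t = X t\<close>\<close>

lemma support_fun_expectation:
  "0 \<le> t \<Longrightarrow> support_fun x (sv_expectation P (M t)) = ereal (\<integral>\<omega>. supp x (N t \<omega>) \<partial>P)"
  using supp_sv_expectation[OF rv_P[OF N_rv] N_radius, of t x] sv_expectation_cong_AE[OF N_eq, of t] by simp

text \<open>Conditioning preserves the integral of an inner product with \<open>x\<close>, so
  selections of \<open>N s\<close> cannot exceed the expected support function of
  \<open>N t\<close>. The closest points to n x in \<open>N s\<close> turn this into a bound for the
  support function.\<close>

lemma integral_supp_N_mono:
  assumes "0 \<le> s" "s \<le> t"
  shows "(\<integral>\<omega>. supp x (N s \<omega>) \<partial>P) \<le> (\<integral>\<omega>. supp x (N t \<omega>) \<partial>P)"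
proof -
  have t: "0 \<le> t" using assms by simp
  interpret Fs: sigma_finite_subalgebra P "F s" by (rule sigma_finite_subalgebra_F[OF assms(1)])
  let ?I = "\<integral>\<omega>. supp x (N t \<omega>) \<partial>P"
  have le: "(\<integral>\<omega>. x \<bullet> \<xi> \<omega> \<partial>P) \<le> ?I" if "\<xi> \<in> selections P (F s) (N s)" for \<xi>
  proof (rule field_le_epsilon)
    fix e :: real assume "0 < e"
    have \<xi>: "\<xi> \<in> L1_closure P (F s) (vec_cond_exp P (F s) ` selections P P (N t))"
      using N_selections_subset[OF assms] that by blast
    \<comment> \<open>The summand 1 keeps the divisor positive when x = 0.\<close>
    define c where "c = norm x + 1"
    have "0 < c" unfolding c_def by (intro add_nonneg_pos) auto
    then obtain \<zeta> where \<zeta>: "\<zeta> \<in> selections P P (N t)"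
      "(\<integral>\<omega>. norm (\<xi> \<omega> - vec_cond_exp P (F s) \<zeta> \<omega>) \<partial>P) < e / c"
      using L1_closureD(3)[OF \<xi>, of "e / c"] \<open>0 < e\<close> by auto
    note z = selectionsD[OF \<zeta>(1)] and i = L1_closureD(2)[OF \<xi>]
    note j = Fs.vec_cond_exp_integrable[OF z(2)]
    have "(\<integral>\<omega>. x \<bullet> \<xi> \<omega> \<partial>P) - (\<integral>\<omega>. x \<bullet> vec_cond_exp P (F s) \<zeta> \<omega> \<partial>P) =
        (\<integral>\<omega>. x \<bullet> (\<xi> \<omega> - vec_cond_exp P (F s) \<zeta> \<omega>) \<partial>P)"
      using i j by (simp add: inner_diff_right)
    also have "\<dots> \<le> (\<integral>\<omega>. c * norm (\<xi> \<omega> - vec_cond_exp P (F s) \<zeta> \<omega>) \<partial>P)"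
    proof (rule integral_mono)
      fix \<omega>
      show "x \<bullet> (\<xi> \<omega> - vec_cond_exp P (F s) \<zeta> \<omega>) \<le> c * norm (\<xi> \<omega> - vec_cond_exp P (F s) \<zeta> \<omega>)"
        by (rule order_trans[OF norm_cauchy_schwarz]) (simp add: c_def mult_right_mono)
    qed (use i j in auto)
    also have "\<dots> \<le> e"
      using \<zeta>(2) \<open>0 < c\<close> by (simp add: pos_less_divide_eq mult.commute less_imp_le)
    finally have "(\<integral>\<omega>. x \<bullet> \<xi> \<omega> \<partial>P) \<le> (\<integral>\<omega>. x \<bullet> \<zeta> \<omega> \<partial>P) + e"
      using Fs.integral_inner_vec_cond_exp[OF z(2), of x] by simp
    moreover have "(\<integral>\<omega>. x \<bullet> \<zeta> \<omega> \<partial>P) \<le> ?I"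
    proof (rule integral_mono_AE)
      show "AE \<omega> in P. x \<bullet> \<zeta> \<omega> \<le> supp x (N t \<omega>)"
        using z(3) by eventually_elim (intro supp_upper compact_convex_rvD[OF N_rv[OF t]])
    qed (use z integrable_supp[OF rv_P[OF N_rv[OF t] t] N_radius[OF t]] in auto)
    ultimately show "(\<integral>\<omega>. x \<bullet> \<xi> \<omega> \<partial>P) \<le> ?I + e" by simp
  qed
  show ?thesis
  proof (rule LIMSEQ_le_const2[OF integral_inner_closest_point_tendsto[OF rv_P[OF N_rv[OF assms(1)] assms(1)] N_radius[OF assms(1)]]],
      intro exI allI impI le)
    show "(\<lambda>\<omega>. closest_point (N s \<omega>) (real n *\<^sub>R x)) \<in> selections P (F s) (N s)" for n
      by (rule closest_point_selection[OF subalgebra_F N_rv N_radius]) (use assms in auto)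
  qed
qed

text \<open>Support functions differ by at most \<open>norm x\<close> times the Hausdorff distance,
  so \<open>integral_tendsto_0\<close> yields convergence even in L1.\<close>

lemma integral_supp_N_sequence:
  assumes t: "0 \<le> t" and r: "rational_approx t r"
  shows "(\<lambda>n. \<integral>\<omega>. supp x (N (r n) \<omega>) \<partial>P) \<longlonglongrightarrow> (\<integral>\<omega>. supp x (X t \<omega>) \<partial>P)"
proof -
  note r0 = rational_approx_nonneg[OF r t]
  note c = compact_convex_rvD[OF X_rv[OF t]] and d = compact_convex_rvD[OF N_rv[OF r0]]
  note i = integrable_supp[OF rv_P[OF X_rv[OF t] t] X_radius[OF t], of x]
    and j = integrable_supp[OF rv_P[OF N_rv[OF r0] r0] N_radius[OF r0], of x]
  define f where "f n \<omega> = supp x (N (r n) \<omega>) - supp x (X t \<omega>)" for n \<omega>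
  have f: "integrable P (f n)" for n unfolding f_def[abs_def] using i j by simp
  have "(\<lambda>n. \<integral>\<omega>. \<bar>f n \<omega>\<bar> \<partial>P) \<longlonglongrightarrow> 0"
  proof (rule integral_tendsto_0[OF t r norm_ge_zero[of x]])
    show "f n \<in> borel_measurable P" for n using f by simp
    show "AE \<omega> in P. \<bar>f n \<omega>\<bar> \<le> norm x * (radius (N (r n) \<omega>) + radius (X t \<omega>))" for n
    proof (rule AE_I2)
      fix \<omega>
      show "\<bar>f n \<omega>\<bar> \<le> norm x * (radius (N (r n) \<omega>) + radius (X t \<omega>))"
        using abs_supp_le[of "X t \<omega>" x, OF c(1,3)] abs_supp_le[of "N (r n) \<omega>" x, OF d(1,3)]
        unfolding f_def distrib_left by linarith
    qed
    show "AE \<omega> in P. (\<lambda>n. f n \<omega>) \<longlonglongrightarrow> 0"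
      using N_limit_sequence[OF t r]
    proof eventually_elim
      case (elim \<omega>)
      show ?case
      proof (rule tendstoI)
        fix e :: real assume "0 < e"
        define b where "b = norm x + 1"
        have "0 < b" unfolding b_def by (intro add_nonneg_pos) auto
        then have "\<forall>\<^sub>F n in sequentially. hausdorff_dist (N (r n) \<omega>) (X t \<omega>) \<le> ennreal (e / (2 * b))"
          using elim \<open>0 < e\<close> by simp
        then show "\<forall>\<^sub>F n in sequentially. dist (f n \<omega>) 0 < e"
        proof eventually_elim
          case (elim n)
          then have h: "\<And>x. x \<in> N (r n) \<omega> \<Longrightarrow> infdist x (X t \<omega>) \<le> e / (2 * b)"
            "\<And>x. x \<in> X t \<omega> \<Longrightarrow> infdist x (N (r n) \<omega>) \<le> e / (2 * b)"
            using \<open>0 < e\<close> \<open>0 < b\<close> by (auto simp: hausdorff_dist_le_iff)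
          have "\<bar>f n \<omega>\<bar> \<le> norm x * (e / (2 * b))"
            using supp_le_add[of "N (r n) \<omega>" "X t \<omega>" _ x, OF d(1,3) c(1,3) h(1)]
              supp_le_add[of "X t \<omega>" "N (r n) \<omega>" _ x, OF c(1,3) d(1,3) h(2)]
            unfolding f_def by linarith
          also have "\<dots> \<le> b * (e / (2 * b))"
            using \<open>0 < e\<close> \<open>0 < b\<close> by (intro mult_right_mono) (auto simp: b_def)
          also have "\<dots> < e" using \<open>0 < e\<close> \<open>0 < b\<close> by simp
          finally show ?case by simp
        qed
      qed
    qed
  qed
  then have "(\<lambda>n. \<integral>\<omega>. f n \<omega> \<partial>P) \<longlonglongrightarrow> 0"
    by (rule Lim_null_comparison[rotated]) (auto intro!: always_eventually integral_abs_bound)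
  then have "(\<lambda>n. (\<integral>\<omega>. supp x (N (r n) \<omega>) \<partial>P) - (\<integral>\<omega>. supp x (X t \<omega>) \<partial>P)) \<longlonglongrightarrow> 0"
    unfolding f_def using i j by simp
  then show ?thesis by (simp add: LIM_zero_iff)
qed

text \<open>The right limits only see rational times; monotonicity in r extends the convergence
  along one rational sequence to all real r decreasing to t.\<close>

lemma integral_supp_N_at_right:
  assumes t: "0 \<le> t"
  shows "((\<lambda>r. \<integral>\<omega>. supp x (N r \<omega>) \<partial>P) \<longlongrightarrow> (\<integral>\<omega>. supp x (X t \<omega>) \<partial>P)) (at_right t)"
proof -
  let ?\<phi> = "\<lambda>r. \<integral>\<omega>. supp x (N r \<omega>) \<partial>P" and ?L = "\<integral>\<omega>. supp x (X t \<omega>) \<partial>P"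
  obtain r where r: "rational_approx t r" by (rule rational_approx_exists[of t "\<lambda>_. t + 1"]) auto
  note lim = integral_supp_N_sequence[OF t r, of x]
  have lower: "?L \<le> ?\<phi> u" if "t < u" for u
  proof (rule LIMSEQ_le_const2[OF lim])
    have "\<forall>\<^sub>F n in sequentially. r n < u"
      using order_tendstoD(2)[OF rational_approxD(4)[OF r] that] .
    then obtain n0 where "\<forall>n\<ge>n0. r n < u" by (auto simp: eventually_sequentially)
    then show "\<exists>n0. \<forall>n\<ge>n0. ?\<phi> (r n) \<le> ?\<phi> u"
      using integral_supp_N_mono[OF rational_approx_nonneg[OF r t], of _ u x] less_imp_le by blast
  qed
  show ?thesis
  proof (rule order_tendstoI)
    fix a assume "a < ?L"
    then show "\<forall>\<^sub>F u in at_right t. a < ?\<phi> u"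
      using lower by (auto simp: eventually_at_filter intro!: always_eventually intro: less_le_trans)
  next
    fix a assume "?L < a"
    then obtain n where n: "?\<phi> (r n) < a"
      using order_tendstoD(2)[OF lim] by (auto simp: eventually_sequentially)
    have "?\<phi> u < a" if "t < u" "u < r n" for u
      using integral_supp_N_mono[of u "r n" x] that t n by simp
    then show "\<forall>\<^sub>F u in at_right t. ?\<phi> u < a"
      using rational_approxD(2)[OF r, of n] by (auto simp: eventually_at_right)
  qed
qed

text \<open>The limit from the right always exists, so continuity is equality of this limit with the
  value at t.\<close>

lemma right_continuous_support_iff:
  assumes t: "0 \<le> t"
  shows "continuous (at_right t) (\<lambda>r. support_fun x (sv_expectation P (M r))) \<longleftrightarrow>
    (\<integral>\<omega>. supp x (N t \<omega>) \<partial>P) = (\<integral>\<omega>. supp x (X t \<omega>) \<partial>P)" (is "_ \<longleftrightarrow> ?a = ?b")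
proof -
  let ?f = "\<lambda>r. support_fun x (sv_expectation P (M r))"
  have "((\<lambda>r. ereal (\<integral>\<omega>. supp x (N r \<omega>) \<partial>P)) \<longlongrightarrow> ereal ?b) (at_right t)"
    using integral_supp_N_at_right[OF t] by (rule tendsto_ereal)
  moreover have "\<forall>\<^sub>F r in at_right t. ereal (\<integral>\<omega>. supp x (N r \<omega>) \<partial>P) = ?f r"
    using t by (auto simp: eventually_at_filter support_fun_expectation intro!: always_eventually)
  ultimately have lim: "(?f \<longlongrightarrow> ereal ?b) (at_right t)"
    by (rule Lim_transform_eventually)
  have ft: "?f t = ereal ?a" by (rule support_fun_expectation[OF t])
  have "continuous (at_right t) ?f \<longleftrightarrow> (?f \<longlongrightarrow> ereal ?a) (at_right t)"
    unfolding continuous_within ft ..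
  also have "\<dots> \<longleftrightarrow> ereal ?a = ereal ?b"
    using lim tendsto_unique[OF trivial_limit_at_right_real] by metis
  finally show ?thesis by simp
qed

text \<open>A nonnegative function with integral 0 vanishes almost surely. Countability of
  \<open>W\<close> leaves one exceptional null set, outside which \<open>mem_of_supp_dense\<close>
  gives the reverse inclusion.\<close>

lemma M_eq_X_iff:
  assumes t: "0 \<le> t" and W: "countable W" "cball 0 1 \<subseteq> closure W"
  shows "(AE \<omega> in P. M t \<omega> = X t \<omega>) \<longleftrightarrow>
    (\<forall>x\<in>W. (\<integral>\<omega>. supp x (N t \<omega>) \<partial>P) = (\<integral>\<omega>. supp x (X t \<omega>) \<partial>P))"
proof
  note c = compact_convex_rvD[OF X_rv[OF t]] and d = compact_convex_rvD[OF N_rv[OF t]]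
  note i = integrable_supp[OF rv_P[OF X_rv[OF t] t] X_radius[OF t]]
    and j = integrable_supp[OF rv_P[OF N_rv[OF t] t] N_radius[OF t]]
  {
    assume "AE \<omega> in P. M t \<omega> = X t \<omega>"
    then have "AE \<omega> in P. supp x (N t \<omega>) = supp x (X t \<omega>)" for x
      using N_eq[OF t] by eventually_elim simp
    then show "\<forall>x\<in>W. (\<integral>\<omega>. supp x (N t \<omega>) \<partial>P) = (\<integral>\<omega>. supp x (X t \<omega>) \<partial>P)"
      using i j by (intro ballI integral_cong_AE) auto
  next
    assume eq: "\<forall>x\<in>W. (\<integral>\<omega>. supp x (N t \<omega>) \<partial>P) = (\<integral>\<omega>. supp x (X t \<omega>) \<partial>P)"
    have "AE \<omega> in P. supp x (X t \<omega>) = supp x (N t \<omega>)" if "x \<in> W" for x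
    proof -
      have "integrable P (\<lambda>\<omega>. supp x (X t \<omega>) - supp x (N t \<omega>))" using i j by simp
      moreover have "AE \<omega> in P. 0 \<le> supp x (X t \<omega>) - supp x (N t \<omega>)"
        using N_subset_X[OF t] by eventually_elim (use supp_mono[OF d(1) c(1) _ d(3)] in simp)
      moreover have "(\<integral>\<omega>. supp x (X t \<omega>) - supp x (N t \<omega>) \<partial>P) = 0"
        using eq that i j by simp
      ultimately have "AE \<omega> in P. supp x (X t \<omega>) - supp x (N t \<omega>) = 0"
        using integral_nonneg_eq_0_iff_AE by blast
      then show ?thesis by simp
    qed
    then have "AE \<omega> in P. \<forall>x\<in>W. supp x (X t \<omega>) = supp x (N t \<omega>)"
      using W(1) by (intro AE_ball_countable')
    then show "AE \<omega> in P. M t \<omega> = X t \<omega>"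
      using N_subset_X[OF t] N_eq[OF t]
    proof eventually_elim
      case (elim \<omega>)
      have "y \<in> N t \<omega>" if "y \<in> X t \<omega>" for y
        using elim(1) supp_upper[OF c(1) that] by (intro mem_of_supp_dense[OF d(1-3) W(2)]) metis
      then show ?case using elim by auto
    qed
  }
qed

section \<open>Path regularity\<close>

text \<open>A bound at the rational times of an interval passes to the right limit at u through one
  rational time close to u. The set \<open>L\<close> is arbitrary, since it will be both a right
  limit and a left limit.\<close>

lemma X_near:
  assumes \<omega>: "\<omega> \<in> \<Omega>'" and u: "0 \<le> u" "u < b" and L: "0 \<le> a"
    "\<And>q. q \<in> \<rat> \<Longrightarrow> u < q \<Longrightarrow> q < b \<Longrightarrow> hausdorff_dist (M q \<omega>) L \<le> ennreal a" and e: "0 < e"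
  shows "hausdorff_dist (X u \<omega>) L \<le> ennreal (e + a)"
proof -
  obtain r where r: "rational_approx u r" "\<And>n. r n < b"
    using rational_approx_exists[of u "\<lambda>_. b"] u(2) by blast
  obtain n where n: "hausdorff_dist (M (r n) \<omega>) (X u \<omega>) \<le> ennreal e"
    using X_limit_sequence[OF \<omega> u(1) r(1) e] by (auto simp: eventually_sequentially)
  have "M (r n) \<omega> \<noteq> {}"
    using M_closed[of "r n" \<omega>] rational_approx_nonneg[OF r(1) u(1)] \<omega> \<Omega>'_space by auto
  moreover have "hausdorff_dist (M (r n) \<omega>) L \<le> ennreal a"
    using L(2) rational_approxD(1,2)[OF r(1)] r(2) by blast
  ultimately show ?thesis
    using n e L(1) by (intro hausdorff_dist_triangle_le[of "M (r n) \<omega>"]) (auto simp: hausdorff_dist_commute)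
qed

text \<open>The left limit of \<open>X\<close> is that of \<open>M\<close> along the rationals. Off
  the limit event the path is constantly {0}.\<close>

lemma X_cadlag: "hausdorff_cadlag (\<lambda>t. X t \<omega>)"
proof (cases "\<omega> \<in> \<Omega>'")
  case False
  have "hausdorff_dist {0} {0::'b} = 0" by (simp add: hausdorff_dist_def)
  then have "hausdorff_limit (\<lambda>t. X t \<omega>) {0} A" for A
    using X_outside[OF False] by (simp add: hausdorff_limit_def)
  then show ?thesis
    unfolding hausdorff_cadlag_def using X_outside[OF False] by auto
next
  case \<omega>: True
  have right: "hausdorff_limit (\<lambda>t. X t \<omega>) (X t \<omega>) (at_right t)" if t: "0 \<le> t" for t
    unfolding hausdorff_limit_iff
  proof (intro conjI allI impI)
    fix e :: real assume "0 < e"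
    then have "\<forall>\<^sub>F q in rational_right t. hausdorff_dist (M q \<omega>) (X t \<omega>) \<le> ennreal (e / 2)"
      using X_limit(1)[OF \<omega> t] by (simp add: hausdorff_limit_iff)
    then obtain d where d: "0 < d" "\<And>q. q \<in> \<rat> \<Longrightarrow> t < q \<Longrightarrow> q < t + d \<Longrightarrow> hausdorff_dist (M q \<omega>) (X t \<omega>) \<le> ennreal (e / 2)"
      unfolding rational_right_def eventually_at by (auto simp: dist_real_def)
    have "hausdorff_dist (X u \<omega>) (X t \<omega>) \<le> ennreal e" if "t < u" "u < t + d" for u
      using X_near[OF \<omega>, of u "t + d" "e / 2" "X t \<omega>" "e / 2"] that t d(2) \<open>0 < e\<close> by (simp del: ennreal_plus)
    then show "\<forall>\<^sub>F u in at_right t. hausdorff_dist (X u \<omega>) (X t \<omega>) \<le> ennreal e"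
      using \<open>0 < d\<close> by (intro eventually_at_rightI[of t "t + d"]) auto
  qed (use X_compact_convex[OF t] compact_imp_closed in auto)
  have left: "\<exists>L. hausdorff_limit (\<lambda>t. X t \<omega>) L (at_left t)" if t: "0 < t" for t
  proof -
    obtain L where L: "hausdorff_limit (\<lambda>r. M r \<omega>) L (rational_left t)"
      using event \<omega> t unfolding limit_event_def by blast
    have "hausdorff_limit (\<lambda>t. X t \<omega>) L (at_left t)"
      unfolding hausdorff_limit_iff
    proof (intro conjI allI impI)
      fix e :: real assume "0 < e"
      then have "\<forall>\<^sub>F q in rational_left t. hausdorff_dist (M q \<omega>) L \<le> ennreal (e / 2)"
        using L by (simp add: hausdorff_limit_iff)
      then obtain d where d: "0 < d" "\<And>q. q \<in> \<rat> \<Longrightarrow> 0 \<le> q \<Longrightarrow> q < t \<Longrightarrow> t - d < q \<Longrightarrow> hausdorff_dist (M q \<omega>) L \<le> ennreal (e / 2)"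
        unfolding rational_left_def eventually_at by (auto simp: dist_real_def)
      \<comment> \<open>The maximum with 0 is there because both \<open>X_near\<close> and
        \<open>rational_left\<close> concern nonnegative times.\<close>
      have "hausdorff_dist (X u \<omega>) L \<le> ennreal e" if "max 0 (t - d) < u" "u < t" for u
        using X_near[OF \<omega>, of u t "e / 2" L "e / 2"] that d(2) \<open>0 < e\<close> by (simp del: ennreal_plus)
      then show "\<forall>\<^sub>F u in at_left t. hausdorff_dist (X u \<omega>) L \<le> ennreal e"
        using \<open>0 < d\<close> t by (intro eventually_at_leftI[of "max 0 (t - d)"]) auto
    qed (use L in \<open>auto simp: hausdorff_limit_def\<close>)
    then show ?thesis ..
  qed
  show ?thesis using right left by (auto simp: hausdorff_cadlag_def)
qed

section \<open>The process of right limits\<close>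

lemma X_integrable: "0 \<le> t \<Longrightarrow> sv_integrable P (X t)"
  unfolding sv_integrable_def using selection_X[of t "\<lambda>_. 0"] by auto

lemma X_integrably_bounded:
  assumes t: "0 \<le> t"
  shows "integrably_bounded P (X t)"
proof -
  note c = compact_convex_rvD[OF X_rv[OF t]]
  have "(\<integral>\<^sup>+\<omega>. set_norm (X t \<omega>) \<partial>P) = (\<integral>\<^sup>+\<omega>. ennreal (radius (X t \<omega>)) \<partial>P)"
    by (simp add: set_norm_eq_radius[OF c(1,3)])
  also have "\<dots> < \<infinity>"
    using X_radius[OF t] radius_nonneg[OF c(1,3)] by (simp add: nn_integral_eq_integral)
  finally show ?thesis by (simp add: integrably_bounded_def)
qed

lemma X_process:
  "sv_process P X" "sv_adapted F X" "integrable_process P X"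
  using X_rv X_integrable rv_P compact_convex_rv_sv
  unfolding sv_process_def sv_adapted_def integrable_process_def by blast+

text \<open>The version comes from \<open>sv_cond_exp_exists\<close>; the inclusion is tested on
  selections, where it is \<open>X_selections_subset\<close>.\<close>

lemma X_submartingale: "sv_submartingale P F X"
  unfolding sv_submartingale_def
proof (intro conjI X_process allI impI)
  fix s t :: real assume s: "0 \<le> s" and st: "s \<le> t"
  interpret Fs: finite_measure_subalgebra P "F s" by (rule finite_measure_subalgebra_F[OF s])
  obtain Y where Y: "has_sv_cond_exp P (F s) (X t) Y"
    using Fs.sv_cond_exp_exists[OF X_integrable[of t]] s st by auto
  have "AE \<omega> in P. X s \<omega> \<subseteq> Y \<omega>"
  proof (rule subset_if_selections[OF subalgebra_F[OF s] X_rv[OF s] X_radius[OF s]])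
    fix \<xi> assume "\<xi> \<in> selections P (F s) (X s)"
    then have "\<xi> \<in> selections P (F s) Y"
      using X_selections_subset[OF s st] Y by (auto simp: has_sv_cond_exp_def)
    then show "AE \<omega> in P. \<xi> \<omega> \<in> Y \<omega>" by (rule selectionsD(3))
  next
    show "AE \<omega> in P. closed (Y \<omega>)"
      using Y space_F[OF s] by (intro AE_I2) (simp add: has_sv_cond_exp_def sv_random_variable_def)
  qed
  then show "\<exists>Y. has_sv_cond_exp P (F s) (X t) Y \<and> (AE \<omega> in P. X s \<omega> \<subseteq> Y \<omega>)" using Y by blast
qed

text \<open>\<open>X s\<close> itself serves as the version: its selections and the L1-closure
  contain each other.\<close>

lemma X_martingale:
  assumes "sv_martingale P F M"
  shows "sv_martingale P F X"
  unfolding sv_martingale_def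
proof (intro conjI X_process allI impI)
  fix s t :: real assume s: "0 \<le> s" and st: "s \<le> t"
  have "has_sv_cond_exp P (F s) (X t) (X s)"
    unfolding has_sv_cond_exp_def
    using compact_convex_rv_sv[OF X_rv[OF s]] X_integrable[OF s]
      X_selections_subset[OF s st] X_martingale_selections[OF assms s st] by blast
  then show "\<exists>Y. has_sv_cond_exp P (F s) (X t) Y \<and> (AE \<omega> in P. X s \<omega> = Y \<omega>)" by blast
qed

end

theorem theorem4p2:
  fixes P :: "'a measure"
    and F :: "real \<Rightarrow> 'a measure"
    and M :: "real \<Rightarrow> 'a \<Rightarrow> 'b::euclidean_space set"
    and W :: "'b set"
    and \<Omega>' :: "'a set"
  assumes "prob_space P"
    and "time_filtration P F"
    and "usual_conditions P F"
    and "countable W" and "W \<subseteq> cball 0 1" and "cball 0 1 \<subseteq> closure W" and "0 \<notin> W"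
    and "sv_submartingale P F M"
    and "convex_process P M"
    and "integrably_bounded_process P M"
    and "limit_event P M \<Omega>'"
  shows
    "(\<forall>t\<ge>0.
        sv_random_variable (F t) (right_limit \<Omega>' M t) \<and>
        integrably_bounded P (right_limit \<Omega>' M t) \<and>
        (AE \<omega> in P. compact (right_limit \<Omega>' M t \<omega>) \<and> convex (right_limit \<Omega>' M t \<omega>)) \<and>
        (AE \<omega> in P. M t \<omega> \<subseteq> right_limit \<Omega>' M t \<omega>) \<and>
        ((AE \<omega> in P. M t \<omega> = right_limit \<Omega>' M t \<omega>) \<longleftrightarrow>
          (\<forall>x'\<in>W. continuous (at_right t) (\<lambda>r. support_fun x' (sv_expectation P (M r))))))
     \<and>
     ((\<forall>\<omega>\<in>space P. hausdorff_cadlag (\<lambda>t. right_limit \<Omega>' M t \<omega>)) \<and>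
      (\<forall>t\<ge>0. \<forall>\<omega>\<in>space P. convex (right_limit \<Omega>' M t \<omega>)) \<and>
      integrably_bounded_process P (right_limit \<Omega>' M) \<and>
      sv_submartingale P F (right_limit \<Omega>' M) \<and>
      (sv_martingale P F M \<longrightarrow> sv_martingale P F (right_limit \<Omega>' M)))"
proof -
  interpret sv_right_limit P F M \<Omega>'
    using assms by (simp add: sv_right_limit_def sv_right_limit_axioms_def)
  have "AE \<omega> in P. M t \<omega> \<subseteq> X t \<omega>" if "0 \<le> t" for t
    using N_subset_X[OF that] N_eq[OF that] by eventually_elim simp
  then show ?thesis
    unfolding X_def[symmetric]
    using X_rv[THEN compact_convex_rv_sv] X_integrably_bounded X_compact_convex X_cadlag
      M_eq_X_iff[OF _ assms(4,6)] right_continuous_support_iff X_submartingale X_martingale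
    by (simp add: integrably_bounded_process_def)
qed

end
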